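(* Let $c_0, c_1>0$ with $c_0\neq c_1$, let $H$ be the Heaviside function and $c(t)=c_0+(c_1-c_0)H(t-1)$ for $t\in\mathbb{R}$. Let $\varphi$ and $\psi$ be (possibly different) admissible mollifiers (see context). Let $C\in\mathcal{G}([0,\infty)\times\mathbb{R})$ be the class of $(c^\varepsilon)_{\varepsilon\in(0,1]}$, where $$c^\varepsilon(t)=(c*\varphi_\varepsilon)(t)=c_0+(c_1-c_0)\int_{\mathbb{R}}H(t-1-\varepsilon s)\varphi(s)\,ds ,$$ let $U_0=0$ and let $U_1\in\mathcal{G}(\mathbb{R})$ be the class of $(\psi_\varepsilon)_{\varepsilon\in(0,1]}$. Let $U\in\mathcal{G}([0,\infty)\times\mathbb{R})$ be the (unique) solution of $$\partial_t^2U - C^2\partial_x^2U = 0 \ \text{ in } \mathcal{G}([0,\infty)\times\mathbb{R}),\qquad U|_{t = 0} = U_0,\quad \partial_tU|_{t = 0} = U_1 \ \text{ in } \mathcal{G}(\mathbb{R}).$$ Then $$\operatorname{sing\,supp}_{\mathcal{G}^\infty} U = \left\{(t,x) \;\Big|\; x = \pm\int_0^t c(s)\,ds,\ t \ge 0\right\} \cup \left\{(t,x) \;\Big|\; x = \pm\left(2\int_0^1 c(s)\,ds-\int_0^t c(s)\,ds\right),\ t \ge 1\right\}.$$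
   Context: Admissible mollifier: a function $\varphi\in\mathcal{C}^\infty_0(\mathbb{R})$ that is symmetric (even), with $\varphi'\ge 0$ on $[-1,0]$, $\operatorname{supp}\varphi\subset[-1,1]$ and $\int_{\mathbb{R}}\varphi(x)\,dx=1$. Notation: $\varphi_\varepsilon(x)=\varepsilon^{-1}\varphi(x/\varepsilon)$, and likewise for $\psi$. Colombeau algebra. Let $X$ be a non-empty open subset of $\mathbb{R}^d$, or a (relatively) open subset of $[0,\infty)\times\mathbb{R}$ (in which case $\mathcal{C}^\infty(X)$ denotes functions smooth up to the boundary part contained in $X$, and compact sets $K$ are compact subsets of $X$). Let $\mathcal{E}_M(X)$ be the set of families $(u^\varepsilon)_{\varepsilon\in(0,1]}$ of real-valued functions in $\mathcal{C}^\infty(X)$ such that for every compact $K\subset X$ and every multi-index $\alpha$ there is $p\ge 0$ with $\sup_{K}|\partial^\alpha u^\varepsilon| = O(\varepsilon^{-p})$ as $\varepsilon\downarrow 0$. Let $\mathcal{N}(X)$ be the set of families such that for every compact $K\subset X$, every $\alpha$ and every $q\ge 0$, $\sup_{K}|\partial^\alpha u^\varepsilon| = O(\varepsilon^{q})$ as $\varepsilon\downarrow 0$. Then $\mathcal{G}(X)=\mathcal{E}_M(X)/\mathcal{N}(X)$. Derivatives, products, restrictions to open subsets and the restriction $U|_{t=0}$ are defined on representatives. Functions of $t$ only are regarded as functions of $(t,x)$. Regular generalized functions. $\mathcal{G}^\infty(X)$ is the set of elements of $\mathcal{G}(X)$ having a representative $(u^\varepsilon)_\varepsilon$ such that for every compact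 $K\subset X$ there is $p\ge 0$ such that for all multi-indices $\alpha$, $\sup_K|\partial^\alpha u^\varepsilon|=O(\varepsilon^{-p})$ as $\varepsilon\downarrow0$ (with $p$ independent of $\alpha$). The set $\operatorname{sing\,supp}_{\mathcal{G}^\infty}U$ is the complement (in $[0,\infty)\times\mathbb{R}$) of the largest (relatively) open set on which $U$ is $\mathcal{G}^\infty$-regular. Under the hypotheses of the claim, the Cauchy problem has exactly one solution $U\in\mathcal{G}([0,\infty)\times\mathbb{R})$. *)

theory Defs
  imports "HOL-Analysis.Analysis"
begin

text \<open>
  The domains \<open>X\<close> of interest are open sets and relatively open subsets of the half-plane
  \<open>{0..} \<times> UNIV\<close>. At every point of such a set the derivative \<^emph>\<open>within\<close> \<open>X\<close> is unique; it is the usual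
  derivative at interior points and one-sided in the normal direction at boundary points.
  Values of functions outside \<open>X\<close> never matter.
\<close>

definition partial_on :: "'a::euclidean_space set \<Rightarrow> 'a \<Rightarrow> ('a \<Rightarrow> real) \<Rightarrow> 'a \<Rightarrow> real" where
  "partial_on X b f x = frechet_derivative f (at x within X) b"

text \<open>
  A multi-index is represented by a list of basis vectors. For smooth functions partial derivatives
  commute, so only the multiplicities in the list matter.
\<close>

definition multi_partial_on :: "'a::euclidean_space set \<Rightarrow> 'a list \<Rightarrow> ('a \<Rightarrow> real) \<Rightarrow> 'a \<Rightarrow> real" where
  "multi_partial_on X bs f = foldr (partial_on X) bs f"

definition multi_indices :: "'a::euclidean_space list set" where
  "multi_indices = lists Basis"

definition smooth_on :: "'a::euclidean_space set \<Rightarrow> ('a \<Rightarrow> real) \<Rightarrow> bool" where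
  "smooth_on X f \<longleftrightarrow> (\<forall>bs\<in>multi_indices. multi_partial_on X bs f differentiable_on X)"

text \<open>
  A family \<open>(u\<^sup>\<epsilon>)\<close> with \<open>\<epsilon> \<in> (0,1]\<close> is a function of type \<open>real \<Rightarrow> 'a \<Rightarrow> real\<close>, of which only the
  values at \<open>\<epsilon> \<in> {0<..1}\<close> and at points of \<open>X\<close> are relevant.
\<close>

definition smooth_family :: "'a::euclidean_space set \<Rightarrow> (real \<Rightarrow> 'a \<Rightarrow> real) \<Rightarrow> bool" where
  "smooth_family X u \<longleftrightarrow> (\<forall>\<epsilon>\<in>{0<..1}. smooth_on X (u \<epsilon>))"

text \<open>\<open>sup_K |\<partial>\<^sup>\<alpha> u\<^sup>\<epsilon>| = O(\<epsilon>\<^sup>r)\<close> as \<open>\<epsilon> \<down> 0\<close>, written out so that it is also correct for empty \<open>K\<close>.\<close>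

definition sup_bigo ::
  "'a::euclidean_space set \<Rightarrow> (real \<Rightarrow> 'a \<Rightarrow> real) \<Rightarrow> 'a set \<Rightarrow> 'a list \<Rightarrow> real \<Rightarrow> bool" where
  "sup_bigo X u K bs r \<longleftrightarrow>
     (\<exists>M. \<forall>\<^sub>F \<epsilon> in at_right 0. \<forall>x\<in>K. \<bar>multi_partial_on X bs (u \<epsilon>) x\<bar> \<le> M * \<epsilon> powr r)"

definition moderate :: "'a::euclidean_space set \<Rightarrow> (real \<Rightarrow> 'a \<Rightarrow> real) set" where
  "moderate X = {u. smooth_family X u \<and>
     (\<forall>K. compact K \<and> K \<subseteq> X \<longrightarrow> (\<forall>bs\<in>multi_indices. \<exists>p\<ge>0. sup_bigo X u K bs (- p)))}"

definition negligible_families :: "'a::euclidean_space set \<Rightarrow> (real \<Rightarrow> 'a \<Rightarrow> real) set" where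
  "negligible_families X = {u. smooth_family X u \<and>
     (\<forall>K. compact K \<and> K \<subseteq> X \<longrightarrow> (\<forall>bs\<in>multi_indices. \<forall>q\<ge>0. sup_bigo X u K bs q))}"

definition colombeau_rel ::
  "'a::euclidean_space set \<Rightarrow> ((real \<Rightarrow> 'a \<Rightarrow> real) \<times> (real \<Rightarrow> 'a \<Rightarrow> real)) set" where
  "colombeau_rel X = {(u, v). u \<in> moderate X \<and> v \<in> moderate X \<and>
     (\<lambda>\<epsilon> x. u \<epsilon> x - v \<epsilon> x) \<in> negligible_families X}"

definition colombeau :: "'a::euclidean_space set \<Rightarrow> (real \<Rightarrow> 'a \<Rightarrow> real) set set" where
  "colombeau X = moderate X // colombeau_rel X"

definition cg_class ::
  "'a::euclidean_space set \<Rightarrow> (real \<Rightarrow> 'a \<Rightarrow> real) \<Rightarrow> (real \<Rightarrow> 'a \<Rightarrow> real) set" where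
  "cg_class X u = colombeau_rel X `` {u}"

text \<open>
  Operations on classes. All of them respect \<open>colombeau_rel\<close>, so each union below is the class of
  the result for any choice of representatives.
\<close>

definition cg_partial ::
  "'a::euclidean_space set \<Rightarrow> 'a \<Rightarrow> (real \<Rightarrow> 'a \<Rightarrow> real) set \<Rightarrow> (real \<Rightarrow> 'a \<Rightarrow> real) set" where
  "cg_partial X b U = (\<Union>u\<in>U. cg_class X (\<lambda>\<epsilon>. partial_on X b (u \<epsilon>)))"

definition cg_diff ::
  "'a::euclidean_space set \<Rightarrow> (real \<Rightarrow> 'a \<Rightarrow> real) set \<Rightarrow> (real \<Rightarrow> 'a \<Rightarrow> real) set \<Rightarrow>
   (real \<Rightarrow> 'a \<Rightarrow> real) set" where
  "cg_diff X U V = (\<Union>u\<in>U. \<Union>v\<in>V. cg_class X (\<lambda>\<epsilon> x. u \<epsilon> x - v \<epsilon> x))"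

definition cg_mult ::
  "'a::euclidean_space set \<Rightarrow> (real \<Rightarrow> 'a \<Rightarrow> real) set \<Rightarrow> (real \<Rightarrow> 'a \<Rightarrow> real) set \<Rightarrow>
   (real \<Rightarrow> 'a \<Rightarrow> real) set" where
  "cg_mult X U V = (\<Union>u\<in>U. \<Union>v\<in>V. cg_class X (\<lambda>\<epsilon> x. u \<epsilon> x * v \<epsilon> x))"

definition cg_zero :: "'a::euclidean_space set \<Rightarrow> (real \<Rightarrow> 'a \<Rightarrow> real) set" where
  "cg_zero X = cg_class X (\<lambda>\<epsilon> x. 0)"

definition cg_restrict ::
  "'a::euclidean_space set \<Rightarrow> (real \<Rightarrow> 'a \<Rightarrow> real) set \<Rightarrow> (real \<Rightarrow> 'a \<Rightarrow> real) set" where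
  "cg_restrict W U = (\<Union>u\<in>U. cg_class W u)"

definition half_plane :: "(real \<times> real) set" where
  "half_plane = {0..} \<times> UNIV"

definition cg_initial :: "(real \<Rightarrow> real \<times> real \<Rightarrow> real) set \<Rightarrow> (real \<Rightarrow> real \<Rightarrow> real) set" where
  "cg_initial U = (\<Union>u\<in>U. cg_class UNIV (\<lambda>\<epsilon> x. u \<epsilon> (0, x)))"

abbreviation D_t :: "(real \<Rightarrow> real \<times> real \<Rightarrow> real) set \<Rightarrow> (real \<Rightarrow> real \<times> real \<Rightarrow> real) set" where
  "D_t \<equiv> cg_partial half_plane (1, 0)"

abbreviation D_x :: "(real \<Rightarrow> real \<times> real \<Rightarrow> real) set \<Rightarrow> (real \<Rightarrow> real \<times> real \<Rightarrow> real) set" where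
  "D_x \<equiv> cg_partial half_plane (0, 1)"

definition colombeau_regular :: "'a::euclidean_space set \<Rightarrow> (real \<Rightarrow> 'a \<Rightarrow> real) set set" where
  "colombeau_regular X = {U \<in> colombeau X. \<exists>u\<in>U.
     \<forall>K. compact K \<and> K \<subseteq> X \<longrightarrow> (\<exists>p\<ge>0. \<forall>bs\<in>multi_indices. sup_bigo X u K bs (- p))}"

text \<open>
  Regularity is a local property, so the union of all relatively open sets on which \<open>U\<close> is regular
  is the largest such set.
\<close>

definition sing_supp :: "(real \<Rightarrow> real \<times> real \<Rightarrow> real) set \<Rightarrow> (real \<times> real) set" where
  "sing_supp U = half_plane -
     \<Union>{W. openin (top_of_set half_plane) W \<and> cg_restrict W U \<in> colombeau_regular W}"

definition admissible_mollifier :: "(real \<Rightarrow> real) \<Rightarrow> bool" where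
  "admissible_mollifier \<phi> \<longleftrightarrow>
     smooth_on UNIV \<phi> \<and> compact (closure {x. \<phi> x \<noteq> 0}) \<and>
     (\<forall>x. \<phi> (- x) = \<phi> x) \<and>
     (\<forall>x\<in>{-1..0}. deriv \<phi> x \<ge> 0) \<and>
     closure {x. \<phi> x \<noteq> 0} \<subseteq> {-1..1} \<and>
     (LINT x|lborel. \<phi> x) = 1"

definition scaled :: "(real \<Rightarrow> real) \<Rightarrow> real \<Rightarrow> real \<Rightarrow> real" where
  "scaled \<phi> \<epsilon> x = \<phi> (x / \<epsilon>) / \<epsilon>"

definition convol :: "(real \<Rightarrow> real) \<Rightarrow> (real \<Rightarrow> real) \<Rightarrow> real \<Rightarrow> real" where
  "convol f g t = (LINT s|lborel. f (t - s) * g s)"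

text \<open>The value at \<open>0\<close> is immaterial, since \<open>heaviside\<close> is only used under integrals.\<close>

definition heaviside :: "real \<Rightarrow> real" where
  "heaviside x = (if x \<ge> 0 then 1 else 0)"

definition jump_coeff :: "real \<Rightarrow> real \<Rightarrow> real \<Rightarrow> real" where
  "jump_coeff c0 c1 t = c0 + (c1 - c0) * heaviside (t - 1)"

lemma convol_jump_coeff:
  assumes "admissible_mollifier \<phi>" and "\<epsilon> > 0"
  shows "convol (jump_coeff c0 c1) (scaled \<phi> \<epsilon>) t =
    c0 + (c1 - c0) * (LINT s|lborel. heaviside (t - 1 - \<epsilon> * s) * \<phi> s)"
proof -
  have one: "(LINT x|lborel. \<phi> x) = 1"
    using assms(1) by (simp add: admissible_mollifier_def)
  have int: "integrable lborel \<phi>"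
    using one not_integrable_integral_eq[of lborel \<phi>] by fastforce
  have [measurable]: "\<phi> \<in> borel_measurable borel"
    using borel_measurable_integrable[OF int] by simp
  have int2: "integrable lborel (\<lambda>s. heaviside (t - 1 - \<epsilon> * s) * \<phi> s)"
    by (rule Bochner_Integration.integrable_bound[OF int])
      (auto simp: heaviside_def)
  have "convol (jump_coeff c0 c1) (scaled \<phi> \<epsilon>) t =
      \<epsilon> * (LINT s|lborel. jump_coeff c0 c1 (t - \<epsilon> * s) * scaled \<phi> \<epsilon> (\<epsilon> * s))"
    unfolding convol_def
    using lborel_integral_real_affine[of \<epsilon> "\<lambda>s. jump_coeff c0 c1 (t - s) * scaled \<phi> \<epsilon> s" 0] assms(2)
    by simp
  also have "\<dots> = (LINT s|lborel. \<epsilon> * (jump_coeff c0 c1 (t - \<epsilon> * s) * scaled \<phi> \<epsilon> (\<epsilon> * s)))"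
    by simp
  also have "\<dots> = (LINT s|lborel. c0 * \<phi> s + (c1 - c0) * (heaviside (t - 1 - \<epsilon> * s) * \<phi> s))"
    using assms(2)
    by (intro Bochner_Integration.integral_cong)
      (auto simp: scaled_def jump_coeff_def algebra_simps)
  also have "\<dots> = c0 + (c1 - c0) * (LINT s|lborel. heaviside (t - 1 - \<epsilon> * s) * \<phi> s)"
    using int int2 one by simp
  finally show ?thesis .
qed

end

theory Submission
  imports Defs
begin

text \<open>
  For a representative \<open>u\<close> of the solution, the Riemann invariants \<open>w\<^sub>s = \<partial>\<^sub>t u - s c \<partial>\<^sub>x u\<close> with
  \<open>s = \<plusminus>1\<close> are transported along the characteristics of slope \<open>s c\<close>, and couple only where \<open>c' \<noteq> 0\<close>,
  that is for \<open>\<bar>t - 1\<bar> \<le> \<epsilon>\<close>. As \<open>\<integral> \<bar>c'\<bar> / c\<close> is bounded independently of \<open>\<epsilon>\<close>, a sup-norm estimate along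
  characteristics shows that both invariants are negligible outside tubes of width \<open>O(\<epsilon>)\<close> around the
  rays. So the first derivatives of \<open>u\<close> are negligible off the rays, where \<open>u\<close> is therefore regular.

  Through the layer the integral of \<open>\<partial>\<^sub>t u\<close> across a tube and the jump of \<open>u\<close> across it are conserved
  up to negligible terms. This gives the mass of the transmitted and of the reflected invariant,
  \<open>(1 \<plusminus> c1 / c0) / 2\<close>, neither of which vanishes since \<open>c0 \<noteq> c1\<close>. Hence \<open>\<partial>\<^sub>x u\<close> has a peak of width \<open>O(\<epsilon>)\<close>
  and nonvanishing mass on each ray, with negligible values on both sides. If all derivatives were \<open>O(\<epsilon>\<^sup>-\<^sup>p)\<close>
  with the same \<open>p\<close>, a difference of order \<open>m > p\<close> with step \<open>O(\<epsilon>)\<close> would bound the peak, and its mass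
  would tend to \<open>0\<close>.
\<close>

section \<open>Colombeau calculus on forward domains\<close>

text \<open>The equation is used only through the size of its residual, kept as a source \<delta> of
  the form \<open>M * e powr q\<close>; every bound for the invariants is linear in the data and
  \<delta>, with factors free of \<open>e\<close>. Differentiating the equation would bring in
  powers of 1/e through c'. This is avoided: a moderate family with negligible values has negligible
  derivatives of every order, by Landau interpolation.

  Off the rays only the derivatives can be claimed to be negligible, since \<open>u\<close> itself
  jumps by an amount of order one across a ray. This suffices, because the exponent of
  \<open>u\<close> then serves all derivatives.

  On a ray the argument concerns mass rather than height, because after the layer neither the shape
  of the peak nor its exact position inside the tube is known. A tube sees a single peaked invariant
  only where no other ray is near, which fails at t = 0 and where the reflected rays cross, while at
  t = 1 the layer interferes. A regular open set around such a point would also contain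
  unexceptional points of a ray.\<close>

text \<open>
  On these sets a partial derivative within the set is determined by the one-sided difference
  quotients in the positive coordinate direction. They include the open sets and the relatively open
  subsets of the half-plane.
\<close>

definition forward_domain :: "'a::euclidean_space set \<Rightarrow> bool" where
  "forward_domain X \<longleftrightarrow> (\<exists>G \<Omega>. X = G \<inter> \<Omega> \<and> open \<Omega> \<and> (\<forall>x\<in>G. \<forall>b\<in>Basis. \<forall>s\<ge>0. x + s *\<^sub>R b \<in> G))"

lemma forward_domain_UNIV: "forward_domain UNIV"
  unfolding forward_domain_def by blast

lemma forward_domain_half_plane: "forward_domain half_plane"
  unfolding forward_domain_def half_plane_def
  by (rule exI[of _ "{0..} \<times> UNIV"], rule exI[of _ UNIV]) (auto simp: Basis_prod_def)

lemma forward_domain_openin: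
  assumes "forward_domain X" "openin (top_of_set X) W"
  shows "forward_domain W"
proof -
  obtain G \<Omega> where X: "X = G \<inter> \<Omega>" "open \<Omega>" "\<forall>x\<in>G. \<forall>b\<in>Basis. \<forall>s\<ge>0. x + s *\<^sub>R b \<in> G"
    using assms(1) unfolding forward_domain_def by blast
  obtain T where T: "open T" "W = X \<inter> T"
    using assms(2) unfolding openin_open by blast
  have "W = G \<inter> (\<Omega> \<inter> T)" "open (\<Omega> \<inter> T)"
    using X T by auto
  then show ?thesis
    using X(3) unfolding forward_domain_def by blast
qed

text \<open>Supplies uniform room for forward steps on a compact set, which the interpolation
  inequality needs; the enlarged set stays compact, so moderateness is available on it.\<close>

lemma forward_domain_thicken:
  assumes "forward_domain X" "compact K" "K \<subseteq> X"
  obtains K' \<delta> where "compact K'" "K' \<subseteq> X" "K \<subseteq> K'" "\<delta> > 0"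
    "\<And>x b s. x \<in> K \<Longrightarrow> b \<in> Basis \<Longrightarrow> 0 \<le> s \<Longrightarrow> s \<le> \<delta> \<Longrightarrow> x + s *\<^sub>R b \<in> K'"
proof -
  obtain G \<Omega> where X: "X = G \<inter> \<Omega>" "open \<Omega>" "\<forall>x\<in>G. \<forall>b\<in>Basis. \<forall>s\<ge>0. x + s *\<^sub>R b \<in> G"
    using assms(1) unfolding forward_domain_def by blast
  obtain r where r: "r > 0" "(\<Union>x\<in>K. ball x r) \<subseteq> \<Omega>"
    using compact_subset_open_imp_ball_epsilon_subset[OF assms(2) X(2)] assms(3) X(1) by blast
  define \<delta> where "\<delta> = r / 2"
  define K' where "K' = (\<Union>b\<in>Basis. (\<lambda>(x, s). x + s *\<^sub>R b) ` (K \<times> {0..\<delta>})) \<union> K"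
  show thesis
  proof
    have "compact ((\<lambda>(x, s). x + s *\<^sub>R b) ` (K \<times> {0..\<delta>}))" for b :: 'a
      by (intro compact_continuous_image compact_Times assms(2) compact_Icc)
        (auto simp: case_prod_unfold intro!: continuous_intros)
    then show "compact K'"
      unfolding K'_def by (intro compact_Un compact_UN assms(2) finite_Basis)
    show "\<delta> > 0" "K \<subseteq> K'"
      using r by (auto simp: \<delta>_def K'_def)
    show "x + s *\<^sub>R b \<in> K'" if "x \<in> K" "b \<in> Basis" "0 \<le> s" "s \<le> \<delta>" for x b s
      using that unfolding K'_def by force
    have "x + s *\<^sub>R b \<in> X" if "x \<in> K" "b \<in> Basis" "0 \<le> s" "s \<le> \<delta>" for x b s
    proof -
      have "x + s *\<^sub>R b \<in> ball x r"
        using that r by (auto simp: dist_norm \<delta>_def)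
      then have "x + s *\<^sub>R b \<in> \<Omega>"
        using r that by blast
      then show ?thesis
        using X assms(3) that by auto
    qed
    then show "K' \<subseteq> X"
      using assms(3) unfolding K'_def by auto
  qed
qed

lemma forward_domain_step:
  assumes "forward_domain X" "x \<in> X"
  obtains \<delta> where "\<delta> > 0" "\<And>b s. b \<in> Basis \<Longrightarrow> 0 \<le> s \<Longrightarrow> s \<le> \<delta> \<Longrightarrow> x + s *\<^sub>R b \<in> X"
proof -
  have "compact {x}" "{x} \<subseteq> X" using assms(2) by auto
  from forward_domain_thicken[OF assms(1) this] obtain K' \<delta> where K': "K' \<subseteq> X" "\<delta> > 0"
    "\<And>x' b s. x' \<in> {x} \<Longrightarrow> b \<in> Basis \<Longrightarrow> 0 \<le> s \<Longrightarrow> s \<le> \<delta> \<Longrightarrow> x' + s *\<^sub>R b \<in> K'"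
    by metis
  show thesis
    by (rule that[OF K'(2)]) (use K' in blast)
qed

section \<open>Partial derivatives within a set, and smoothness\<close>

lemma has_real_derivative_partial_on:
  assumes "f differentiable (at (x + s0 *\<^sub>R b) within X)" "s0 \<in> S" "\<And>s. s \<in> S \<Longrightarrow> x + s *\<^sub>R b \<in> X"
  shows "((\<lambda>s. f (x + s *\<^sub>R b)) has_real_derivative partial_on X b f (x + s0 *\<^sub>R b)) (at s0 within S)"
proof -
  let ?D = "frechet_derivative f (at (x + s0 *\<^sub>R b) within X)"
  have D: "(f has_derivative ?D) (at (x + s0 *\<^sub>R b) within X)"
    using assms(1) frechet_derivative_works by blast
  have "((\<lambda>s. x + s *\<^sub>R b) has_derivative (\<lambda>h. h *\<^sub>R b)) (at s0 within S)"
    by (auto intro!: derivative_eq_intros)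
  then have "((\<lambda>s. f (x + s *\<^sub>R b)) has_derivative (\<lambda>h. ?D (h *\<^sub>R b))) (at s0 within S)"
    by (rule has_derivative_in_compose) (rule has_derivative_subset[OF D], use assms(3) in auto)
  moreover have "?D (h *\<^sub>R b) = h * ?D b" for h
    using has_derivative_bounded_linear[OF D] by (simp add: linear_simps)
  ultimately show ?thesis
    unfolding has_field_derivative_def partial_on_def by (simp add: mult.commute[of _ "?D b"])
qed

text \<open>\<open>frechet_derivative\<close> is a choice, but forward steps stay inside
  \<open>X\<close> and a one-sided derivative on an interval is unique, so one difference quotient
  determines it. All computation rules below rest on this.\<close>

lemma partial_on_unique:
  assumes X: "forward_domain X" and "x \<in> X" "b \<in> Basis" "f differentiable (at x within X)"
    and "\<delta> > 0" and D: "((\<lambda>s. f (x + s *\<^sub>R b)) has_real_derivative D) (at 0 within {0..\<delta>})"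
  shows "partial_on X b f x = D"
proof -
  obtain \<delta>' where K': "\<delta>' > 0" "\<And>b s. b \<in> Basis \<Longrightarrow> 0 \<le> s \<Longrightarrow> s \<le> \<delta>' \<Longrightarrow> x + s *\<^sub>R b \<in> X"
    using forward_domain_step[OF X assms(2)] by blast
  define \<eta> where "\<eta> = min \<delta> \<delta>'"
  have "((\<lambda>s. f (x + s *\<^sub>R b)) has_real_derivative partial_on X b f (x + 0 *\<^sub>R b)) (at 0 within {0..\<eta>})"
    using assms K' by (intro has_real_derivative_partial_on) (auto simp: \<eta>_def)
  moreover have "((\<lambda>s. f (x + s *\<^sub>R b)) has_real_derivative D) (at 0 within {0..\<eta>})"
    by (rule DERIV_subset[OF D]) (auto simp: \<eta>_def)
  moreover have "at 0 within {0..\<eta>} \<noteq> bot"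
    using assms(5) K'(1) by (simp add: \<eta>_def at_within_Icc_at_right)
  ultimately show ?thesis
    using has_field_derivative_unique[of "\<lambda>s. f (x + s *\<^sub>R b)" _ 0 "{0..\<eta>}" D] by simp
qed

lemma partial_on_cong:
  assumes "x \<in> X" "\<And>y. y \<in> X \<Longrightarrow> f y = g y"
  shows "partial_on X b f x = partial_on X b g x"
proof -
  have "(f has_derivative D) (at x within X) \<longleftrightarrow> (g has_derivative D) (at x within X)" for D
    using has_derivative_transform[OF assms(1), of f g D] has_derivative_transform[OF assms(1), of g f D] assms(2)
    by metis
  then show ?thesis
    unfolding partial_on_def frechet_derivative_def by simp
qed

lemma differentiable_on_transform:
  assumes "f differentiable_on X" "\<And>y. y \<in> X \<Longrightarrow> g y = f y"
  shows "g differentiable_on X"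
  unfolding differentiable_on_def
proof
  fix x assume x: "x \<in> X"
  then obtain D where "(f has_derivative D) (at x within X)"
    using assms(1) unfolding differentiable_on_def differentiable_def by blast
  then have "(g has_derivative D) (at x within X)"
    using has_derivative_transform[of x X g f D] x assms(2) by simp
  then show "g differentiable (at x within X)"
    unfolding differentiable_def by blast
qed

lemma multi_partial_on_Nil [simp]: "multi_partial_on X [] f = f"
  by (simp add: multi_partial_on_def)

lemma multi_partial_on_Cons:
  "multi_partial_on X (b # bs) f = partial_on X b (multi_partial_on X bs f)"
  by (simp add: multi_partial_on_def)

lemma multi_partial_on_append:
  "multi_partial_on X (as @ bs) f = multi_partial_on X as (multi_partial_on X bs f)"
  by (simp add: multi_partial_on_def)

lemma multi_indices_Nil [simp]: "[] \<in> multi_indices"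
  and multi_indices_Cons [simp]: "b # bs \<in> multi_indices \<longleftrightarrow> b \<in> Basis \<and> bs \<in> multi_indices"
  and multi_indices_append [simp]:
    "as @ bs \<in> multi_indices \<longleftrightarrow> as \<in> multi_indices \<and> bs \<in> multi_indices"
  by (auto simp: multi_indices_def)

lemma multi_partial_on_cong:
  assumes "x \<in> X" "\<And>y. y \<in> X \<Longrightarrow> f y = g y"
  shows "multi_partial_on X bs f x = multi_partial_on X bs g x"
  using assms(1)
  by (induction bs arbitrary: x) (auto simp: multi_partial_on_Cons assms(2) intro!: partial_on_cong)

lemma smooth_onD:
  "smooth_on X f \<Longrightarrow> bs \<in> multi_indices \<Longrightarrow> multi_partial_on X bs f differentiable_on X"
  by (simp add: smooth_on_def)

lemma smooth_on_multi_partial_on: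
  "smooth_on X f \<Longrightarrow> bs \<in> multi_indices \<Longrightarrow> smooth_on X (multi_partial_on X bs f)"
  unfolding smooth_on_def by (metis multi_indices_append multi_partial_on_append)

lemma smooth_on_partial_on:
  "smooth_on X f \<Longrightarrow> b \<in> Basis \<Longrightarrow> smooth_on X (partial_on X b f)"
  using smooth_on_multi_partial_on[of X f "[b]"] by (simp add: multi_partial_on_Cons)

lemma smooth_on_imp_differentiable_on: "smooth_on X f \<Longrightarrow> f differentiable_on X"
  using smooth_onD[of X f "[]"] by simp

lemma smooth_on_imp_differentiable_at:
  "smooth_on X f \<Longrightarrow> x \<in> X \<Longrightarrow> f differentiable (at x within X)"
  using smooth_on_imp_differentiable_on[of X f] by (simp add: differentiable_on_def)

lemma smooth_on_cong:
  assumes "\<And>y. y \<in> X \<Longrightarrow> f y = g y" "smooth_on X f"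
  shows "smooth_on X g"
  unfolding smooth_on_def
proof
  fix bs :: "'a list" assume "bs \<in> multi_indices"
  then show "multi_partial_on X bs g differentiable_on X"
    by (rule differentiable_on_transform[OF smooth_onD[OF assms(2)]])
      (auto intro: multi_partial_on_cong simp: assms(1))
qed

lemma partial_on_linear:
  assumes X: "forward_domain X" and "x \<in> X" "b \<in> Basis"
    and "f differentiable (at x within X)" "g differentiable (at x within X)"
  shows "partial_on X b (\<lambda>y. \<alpha> * f y + \<beta> * g y) x = \<alpha> * partial_on X b f x + \<beta> * partial_on X b g x"
proof -
  obtain \<delta> where K': "\<delta> > 0" "\<And>b s. b \<in> Basis \<Longrightarrow> 0 \<le> s \<Longrightarrow> s \<le> \<delta> \<Longrightarrow> x + s *\<^sub>R b \<in> X"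
    using forward_domain_step[OF X assms(2)] by blast
  have D: "((\<lambda>s. h (x + s *\<^sub>R b)) has_real_derivative partial_on X b h x) (at 0 within {0..\<delta>})"
    if "h differentiable (at x within X)" for h
    using has_real_derivative_partial_on[of h x 0 b X "{0..\<delta>}"] that assms(3) K' by auto
  show ?thesis
    by (rule partial_on_unique[OF X assms(2,3) _ K'(1)])
      (use assms(4,5) D in \<open>auto intro!: derivative_eq_intros\<close>)
qed

lemma multi_partial_on_linear:
  assumes X: "forward_domain X" and "bs \<in> multi_indices" "smooth_on X f" "smooth_on X g" "x \<in> X"
  shows "multi_partial_on X bs (\<lambda>y. \<alpha> * f y + \<beta> * g y) x =
    \<alpha> * multi_partial_on X bs f x + \<beta> * multi_partial_on X bs g x"
  using assms(2,5)
proof (induction bs arbitrary: x)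
  case (Cons b bs)
  have "multi_partial_on X (b # bs) (\<lambda>y. \<alpha> * f y + \<beta> * g y) x =
      partial_on X b (\<lambda>y. \<alpha> * multi_partial_on X bs f y + \<beta> * multi_partial_on X bs g y) x"
    unfolding multi_partial_on_Cons using Cons by (intro partial_on_cong) auto
  also have "\<dots> = \<alpha> * multi_partial_on X (b # bs) f x + \<beta> * multi_partial_on X (b # bs) g x"
    unfolding multi_partial_on_Cons using Cons.prems assms
    by (intro partial_on_linear X)
      (auto intro!: smooth_on_imp_differentiable_at smooth_on_multi_partial_on)
  finally show ?case .
qed simp

lemma smooth_on_linear:
  assumes X: "forward_domain X" and "smooth_on X f" "smooth_on X g"
  shows "smooth_on X (\<lambda>y. \<alpha> * f y + \<beta> * g y)"
  unfolding smooth_on_def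
proof
  fix bs :: "'a list" assume bs: "bs \<in> multi_indices"
  have "(\<lambda>y. \<alpha> * multi_partial_on X bs f y + \<beta> * multi_partial_on X bs g y) differentiable_on X"
    using assms bs by (auto intro!: derivative_intros smooth_onD)
  then show "multi_partial_on X bs (\<lambda>y. \<alpha> * f y + \<beta> * g y) differentiable_on X"
    by (rule differentiable_on_transform) (rule multi_partial_on_linear[OF assms(1) bs assms(2,3)])
qed

lemma multi_partial_on_zero:
  assumes "forward_domain X" "bs \<in> multi_indices" "x \<in> X"
  shows "multi_partial_on X bs (\<lambda>_. 0) x = 0"
  using assms(2,3)
proof (induction bs arbitrary: x)
  case (Cons b bs)
  have "multi_partial_on X (b # bs) (\<lambda>_. 0) x = partial_on X b (\<lambda>_. 0) x"
    unfolding multi_partial_on_Cons using Cons by (intro partial_on_cong) auto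
  also have "\<dots> = 0"
    by (rule partial_on_unique[of _ _ _ _ 1]) (use Cons assms(1) in auto)
  finally show ?case .
qed simp

lemma smooth_on_zero:
  assumes "forward_domain X"
  shows "smooth_on X (\<lambda>_. 0)"
  unfolding smooth_on_def
proof
  fix bs :: "'a list" assume "bs \<in> multi_indices"
  then show "multi_partial_on X bs (\<lambda>_. 0) differentiable_on X"
    by (intro differentiable_on_transform[OF differentiable_on_const]) (rule multi_partial_on_zero[OF assms])
qed

lemma multi_partial_on_diff:
  assumes "forward_domain X" and "bs \<in> multi_indices" "smooth_on X f" "smooth_on X g" "x \<in> X"
  shows "multi_partial_on X bs (\<lambda>y. f y - g y) x = multi_partial_on X bs f x - multi_partial_on X bs g x"
  using multi_partial_on_linear[OF assms, of 1 "-1"] by simp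

lemma smooth_on_diff:
  assumes "forward_domain X" and "smooth_on X f" "smooth_on X g"
  shows "smooth_on X (\<lambda>y. f y - g y)"
  using smooth_on_linear[OF assms, of 1 "-1"] by simp

lemma at_within_openin:
  assumes "openin (top_of_set X) W" "x \<in> W"
  shows "at x within W = at x within X"
proof -
  obtain T where T: "open T" "W = X \<inter> T"
    using assms(1) unfolding openin_open by blast
  show ?thesis
    by (rule at_within_nhd[of x T]) (use T assms(2) in auto)
qed

text \<open>At a point of a relatively open subset both sets define the same filter of approach, so
  derivatives do not depend on the set used; induction carries this to all orders.\<close>

lemma multi_partial_on_openin:
  assumes "openin (top_of_set X) W" "x \<in> W"
  shows "multi_partial_on W bs f x = multi_partial_on X bs f x"
  using assms(2)
proof (induction bs arbitrary: x)
  case (Cons b bs)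
  have "multi_partial_on W (b # bs) f x = partial_on W b (multi_partial_on X bs f) x"
    unfolding multi_partial_on_Cons using Cons by (intro partial_on_cong) auto
  then show ?case
    using at_within_openin[OF assms(1) Cons.prems] by (simp add: multi_partial_on_Cons partial_on_def)
qed simp

lemma smooth_on_openin:
  assumes "openin (top_of_set X) W" "smooth_on X f"
  shows "smooth_on W f"
  unfolding smooth_on_def
proof
  fix bs :: "'a list" assume "bs \<in> multi_indices"
  then have "multi_partial_on X bs f differentiable_on W"
    using assms by (meson differentiable_on_subset openin_imp_subset smooth_onD)
  then show "multi_partial_on W bs f differentiable_on W"
    by (rule differentiable_on_transform) (rule multi_partial_on_openin[OF assms(1)])
qed

section \<open>Bounds on values alone as the parameter tends to 0\<close>

definition negligible_on :: "'a set \<Rightarrow> (real \<Rightarrow> 'a \<Rightarrow> real) \<Rightarrow> bool" where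
  "negligible_on K f \<longleftrightarrow> (\<forall>q\<ge>0. \<exists>M. \<forall>\<^sub>F e in at_right 0. \<forall>x\<in>K. \<bar>f e x\<bar> \<le> M * e powr q)"

definition moderate_on :: "'a set \<Rightarrow> (real \<Rightarrow> 'a \<Rightarrow> real) \<Rightarrow> bool" where
  "moderate_on K f \<longleftrightarrow> (\<exists>p\<ge>0. \<exists>M. \<forall>\<^sub>F e in at_right 0. \<forall>x\<in>K. \<bar>f e x\<bar> \<le> M * e powr (- p))"

lemma eventually_small: "a > 0 \<Longrightarrow> \<forall>\<^sub>F e :: real in at_right 0. 0 < e \<and> e < a"
  by (auto simp: eventually_at_right intro!: exI[of _ a])

lemma eventually_bound_abs:
  fixes f :: "real \<Rightarrow> 'a \<Rightarrow> real"
  assumes "\<forall>\<^sub>F e in at_right 0. \<forall>x\<in>K. \<bar>f e x\<bar> \<le> M * e powr r"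
  shows "\<forall>\<^sub>F e in at_right 0. \<forall>x\<in>K. \<bar>f e x\<bar> \<le> \<bar>M\<bar> * e powr r"
  using assms
proof eventually_elim
  case (elim e)
  have "M * e powr r \<le> \<bar>M\<bar> * e powr r"
    by (intro mult_right_mono) auto
  then show ?case
    using elim by force
qed

lemma negligible_onD:
  assumes "negligible_on K f" "q \<ge> 0"
  obtains M where "M \<ge> 0" "\<forall>\<^sub>F e in at_right 0. \<forall>x\<in>K. \<bar>f e x\<bar> \<le> M * e powr q"
  using assms that[OF abs_ge_zero eventually_bound_abs] unfolding negligible_on_def by blast

lemma moderate_onD:
  assumes "moderate_on K f"
  obtains p M where "p \<ge> 0" "M \<ge> 0" "\<forall>\<^sub>F e in at_right 0. \<forall>x\<in>K. \<bar>f e x\<bar> \<le> M * e powr (- p)"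
  using assms that[OF _ abs_ge_zero eventually_bound_abs] unfolding moderate_on_def by blast

text \<open>A domination principle that allows the dominating values to be taken at other points.
  Closure under differences and independence of parameters outside (0,1] are instances.\<close>

lemma negligible_on_bound2:
  assumes f: "negligible_on K f" and g: "negligible_on L g"
    and h: "\<forall>\<^sub>F e in at_right 0. \<forall>x\<in>J. \<exists>y\<in>K. \<exists>z\<in>L. \<bar>h e x\<bar> \<le> A * (\<bar>f e y\<bar> + \<bar>g e z\<bar>)"
    and "A \<ge> 0"
  shows "negligible_on J h"
  unfolding negligible_on_def
proof (intro allI impI)
  fix q :: real assume q: "q \<ge> 0"
  obtain M where M: "M \<ge> 0" "\<forall>\<^sub>F e in at_right 0. \<forall>x\<in>K. \<bar>f e x\<bar> \<le> M * e powr q"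
    using negligible_onD[OF f q] .
  obtain N where N: "N \<ge> 0" "\<forall>\<^sub>F e in at_right 0. \<forall>x\<in>L. \<bar>g e x\<bar> \<le> N * e powr q"
    using negligible_onD[OF g q] .
  have "\<forall>\<^sub>F e in at_right 0. \<forall>x\<in>J. \<bar>h e x\<bar> \<le> (A * (M + N)) * e powr q"
    using M(2) N(2) h
  proof eventually_elim
    case (elim e)
    show ?case
    proof
      fix x assume "x \<in> J"
      then obtain y z where yz: "y \<in> K" "z \<in> L" "\<bar>h e x\<bar> \<le> A * (\<bar>f e y\<bar> + \<bar>g e z\<bar>)"
        using bspec[OF elim(3) \<open>x \<in> J\<close>] by blast
      have "A * (\<bar>f e y\<bar> + \<bar>g e z\<bar>) \<le> A * (M * e powr q + N * e powr q)"
        using bspec[OF elim(1) yz(1)] bspec[OF elim(2) yz(2)]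
        by (intro mult_left_mono add_mono assms(4))
      then show "\<bar>h e x\<bar> \<le> (A * (M + N)) * e powr q"
        using yz(3) by (simp add: algebra_simps)
    qed
  qed
  then show "\<exists>M. \<forall>\<^sub>F e in at_right 0. \<forall>x\<in>J. \<bar>h e x\<bar> \<le> M * e powr q"
    by (rule exI)
qed

lemma negligible_on_diff:
  assumes "negligible_on K f" "negligible_on K g"
  shows "negligible_on K (\<lambda>e x. f e x - g e x)"
proof (rule negligible_on_bound2[OF assms, of _ _ 1])
  show "\<forall>\<^sub>F e in at_right 0. \<forall>x\<in>K. \<exists>y\<in>K. \<exists>z\<in>K. \<bar>f e x - g e x\<bar> \<le> 1 * (\<bar>f e y\<bar> + \<bar>g e z\<bar>)"
  proof (intro always_eventually allI ballI)
    fix e x assume "x \<in> K"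
    then show "\<exists>y\<in>K. \<exists>z\<in>K. \<bar>f e x - g e x\<bar> \<le> 1 * (\<bar>f e y\<bar> + \<bar>g e z\<bar>)"
      using abs_triangle_ineq4[of "f e x" "g e x"] by (intro bexI[of _ x]) auto
  qed
qed simp

lemma negligible_on_zero: "negligible_on K (\<lambda>e x. 0)"
  unfolding negligible_on_def by (intro allI impI exI[of _ 0]) simp

lemma negligible_on_cong:
  assumes "\<And>e x. e \<in> {0<..1} \<Longrightarrow> x \<in> K \<Longrightarrow> f e x = g e x"
  shows "negligible_on K f \<longleftrightarrow> negligible_on K g"
proof -
  have *: "negligible_on K g" if "negligible_on K f" "\<And>e x. e \<in> {0<..1} \<Longrightarrow> x \<in> K \<Longrightarrow> f e x = g e x"
    for f g :: "real \<Rightarrow> 'a \<Rightarrow> real"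
  proof (rule negligible_on_bound2[OF that(1) that(1), of _ _ 1])
    show "\<forall>\<^sub>F e in at_right 0. \<forall>x\<in>K. \<exists>y\<in>K. \<exists>z\<in>K. \<bar>g e x\<bar> \<le> 1 * (\<bar>f e y\<bar> + \<bar>f e z\<bar>)"
      using eventually_small[of 1, simplified]
    proof eventually_elim
      case (elim e)
      show ?case
      proof
        fix x assume "x \<in> K"
        then show "\<exists>y\<in>K. \<exists>z\<in>K. \<bar>g e x\<bar> \<le> 1 * (\<bar>f e y\<bar> + \<bar>f e z\<bar>)"
          using that(2)[of e x] elim by (intro bexI[of _ x]) auto
      qed
    qed
  qed simp
  show ?thesis
    using *[of f g] *[of g f] assms by metis
qed

lemma negligible_on_mult_moderate:
  assumes f: "negligible_on K f" and g: "moderate_on K g"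
  shows "negligible_on K (\<lambda>e x. f e x * g e x)"
  unfolding negligible_on_def
proof (intro allI impI)
  fix q :: real assume q: "q \<ge> 0"
  obtain p N where N: "p \<ge> 0" "N \<ge> 0" "\<forall>\<^sub>F e in at_right 0. \<forall>x\<in>K. \<bar>g e x\<bar> \<le> N * e powr (- p)"
    using moderate_onD[OF g] .
  obtain M where M: "M \<ge> 0" "\<forall>\<^sub>F e in at_right 0. \<forall>x\<in>K. \<bar>f e x\<bar> \<le> M * e powr (q + p)"
    using negligible_onD[OF f, of "q + p"] q N(1) by auto
  have "\<forall>\<^sub>F e in at_right 0. \<forall>x\<in>K. \<bar>f e x * g e x\<bar> \<le> (M * N) * e powr q"
    using M(2) N(3) eventually_small[of 1, simplified]
  proof eventually_elim
    case (elim e)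
    show ?case
    proof
      fix x assume "x \<in> K"
      then have "\<bar>f e x\<bar> * \<bar>g e x\<bar> \<le> (M * e powr (q + p)) * (N * e powr (- p))"
        using elim M(1) N(2) by (intro mult_mono) auto
      also have "\<dots> = (M * N) * e powr q"
        by (simp add: powr_add[symmetric] algebra_simps)
      finally show "\<bar>f e x * g e x\<bar> \<le> (M * N) * e powr q"
        by (simp add: abs_mult)
    qed
  qed
  then show "\<exists>M. \<forall>\<^sub>F e in at_right 0. \<forall>x\<in>K. \<bar>f e x * g e x\<bar> \<le> M * e powr q"
    by (rule exI)
qed

lemma moderate_on_cong:
  assumes "\<And>e x. e \<in> {0<..1} \<Longrightarrow> x \<in> K \<Longrightarrow> f e x = g e x" "moderate_on K f"
  shows "moderate_on K g"
proof -
  obtain p M where p: "p \<ge> 0" "M \<ge> 0" "\<forall>\<^sub>F e in at_right 0. \<forall>x\<in>K. \<bar>f e x\<bar> \<le> M * e powr (- p)"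
    using moderate_onD[OF assms(2)] .
  from p(3) eventually_small[of 1, simplified]
  have "\<forall>\<^sub>F e in at_right 0. \<forall>x\<in>K. \<bar>g e x\<bar> \<le> M * e powr (- p)"
    by eventually_elim (use assms(1) in auto)
  then show ?thesis
    unfolding moderate_on_def by (intro exI[of _ p] exI[of _ M] conjI p(1))
qed

lemma moderate_on_diff:
  assumes "moderate_on K f" "moderate_on K g"
  shows "moderate_on K (\<lambda>e x. f e x - g e x)"
proof -
  obtain p M where p: "p \<ge> 0" "M \<ge> 0" "\<forall>\<^sub>F e in at_right 0. \<forall>x\<in>K. \<bar>f e x\<bar> \<le> M * e powr (- p)"
    using moderate_onD[OF assms(1)] .
  obtain p' M' where p': "p' \<ge> 0" "M' \<ge> 0" "\<forall>\<^sub>F e in at_right 0. \<forall>x\<in>K. \<bar>g e x\<bar> \<le> M' * e powr (- p')"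
    using moderate_onD[OF assms(2)] .
  from p(3) p'(3) eventually_small[of 1, simplified]
  have "\<forall>\<^sub>F e in at_right 0. \<forall>x\<in>K. \<bar>f e x - g e x\<bar> \<le> (M + M') * e powr (- (p + p'))"
  proof eventually_elim
    case (elim e)
    show ?case
    proof
      fix x assume x: "x \<in> K"
      have "e powr (- p) \<le> e powr (- (p + p'))" "e powr (- p') \<le> e powr (- (p + p'))"
        using elim p(1) p'(1) by (auto intro!: powr_mono')
      then have "M * e powr (- p) \<le> M * e powr (- (p + p'))"
        "M' * e powr (- p') \<le> M' * e powr (- (p + p'))"
        using p(2) p'(2) by (auto intro: mult_left_mono)
      moreover have "\<bar>f e x\<bar> \<le> M * e powr (- p)" "\<bar>g e x\<bar> \<le> M' * e powr (- p')"
        using elim x by auto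
      ultimately show "\<bar>f e x - g e x\<bar> \<le> (M + M') * e powr (- (p + p'))"
        unfolding distrib_right by linarith
    qed
  qed
  then show ?thesis
    unfolding moderate_on_def
    by (intro exI[of _ "p + p'"] exI[of _ "M + M'"] conjI add_nonneg_nonneg p(1) p'(1))
qed

lemma negligible_on_imp_moderate_on: "negligible_on K f \<Longrightarrow> moderate_on K f"
  unfolding negligible_on_def moderate_on_def
  by (rule exI[of _ 0], drule spec[of _ 0]) (simp only: minus_zero order_refl simp_thms)

lemma moderate_iff:
  "u \<in> moderate X \<longleftrightarrow> smooth_family X u \<and>
     (\<forall>K bs. compact K \<longrightarrow> K \<subseteq> X \<longrightarrow> bs \<in> multi_indices \<longrightarrow>
        moderate_on K (\<lambda>e. multi_partial_on X bs (u e)))"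
  unfolding moderate_def moderate_on_def sup_bigo_def mem_Collect_eq by blast

lemma negligible_families_iff:
  "u \<in> negligible_families X \<longleftrightarrow> smooth_family X u \<and>
     (\<forall>K bs. compact K \<longrightarrow> K \<subseteq> X \<longrightarrow> bs \<in> multi_indices \<longrightarrow>
        negligible_on K (\<lambda>e. multi_partial_on X bs (u e)))"
  unfolding negligible_families_def negligible_on_def sup_bigo_def mem_Collect_eq by blast

lemma moderate_on_mult:
  assumes "moderate_on K f" "moderate_on K g"
  shows "moderate_on K (\<lambda>e x. f e x * g e x)"
proof -
  obtain p M where p: "p \<ge> 0" "M \<ge> 0" "\<forall>\<^sub>F e in at_right 0. \<forall>x\<in>K. \<bar>f e x\<bar> \<le> M * e powr (- p)"
    using moderate_onD[OF assms(1)] .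
  obtain p' M' where p': "p' \<ge> 0" "M' \<ge> 0" "\<forall>\<^sub>F e in at_right 0. \<forall>x\<in>K. \<bar>g e x\<bar> \<le> M' * e powr (- p')"
    using moderate_onD[OF assms(2)] .
  from p(3) p'(3)
  have "\<forall>\<^sub>F e in at_right 0. \<forall>x\<in>K. \<bar>f e x * g e x\<bar> \<le> (M * M') * e powr (- (p + p'))"
  proof eventually_elim
    case (elim e)
    show ?case
    proof
      fix x assume x: "x \<in> K"
      have "\<bar>f e x\<bar> * \<bar>g e x\<bar> \<le> (M * e powr (- p)) * (M' * e powr (- p'))"
        using bspec[OF elim(1) x] bspec[OF elim(2) x] p(2) by (intro mult_mono) auto
      also have "\<dots> = (M * M') * (e powr (- p) * e powr (- p'))"
        by (simp only: mult_ac)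
      also have "\<dots> = (M * M') * e powr (- (p + p'))"
        by (simp only: powr_add[symmetric] minus_add_distrib)
      finally show "\<bar>f e x * g e x\<bar> \<le> (M * M') * e powr (- (p + p'))"
        by (simp add: abs_mult)
    qed
  qed
  then show ?thesis
    unfolding moderate_on_def
    by (intro exI[of _ "p + p'"] exI[of _ "M * M'"] conjI add_nonneg_nonneg p(1) p'(1))
qed

section \<open>Interpolation: moderate families with negligible values\<close>

text \<open>Landau's inequality with a free step \<open>h\<close>.\<close>

lemma partial_on_bound_step:
  assumes "smooth_on X f" "b \<in> Basis" "h > 0"
    and X: "\<And>s. 0 \<le> s \<Longrightarrow> s \<le> h \<Longrightarrow> x + s *\<^sub>R b \<in> X"
    and A: "\<bar>f x\<bar> \<le> A" "\<bar>f (x + h *\<^sub>R b)\<bar> \<le> A"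
    and B: "\<And>s. 0 \<le> s \<Longrightarrow> s \<le> h \<Longrightarrow> \<bar>partial_on X b (partial_on X b f) (x + s *\<^sub>R b)\<bar> \<le> B"
  shows "\<bar>partial_on X b f x\<bar> \<le> 2 * A / h + h * B"
proof -
  define g g' g'' where "g s = f (x + s *\<^sub>R b)" "g' s = partial_on X b f (x + s *\<^sub>R b)"
    "g'' s = partial_on X b (partial_on X b f) (x + s *\<^sub>R b)" for s
  have g: "(g has_real_derivative g' s) (at s within {0..h})" if "s \<in> {0..h}" for s
    unfolding g_g'_g''_def
    by (rule has_real_derivative_partial_on)
      (use that X assms(1) in \<open>auto intro!: smooth_on_imp_differentiable_at\<close>)
  have g': "(g' has_real_derivative g'' s) (at s within {0..h})" if "s \<in> {0..h}" for s
    unfolding g_g'_g''_def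
    by (rule has_real_derivative_partial_on)
      (use that X assms(1,2) in \<open>auto intro!: smooth_on_imp_differentiable_at smooth_on_partial_on\<close>)
  have B0: "B \<ge> 0"
    using B[of 0] assms(3) by (meson abs_ge_zero order_refl order_trans less_imp_le)
  have g'_diff: "\<bar>g' s - g' 0\<bar> \<le> B * h" if "s \<in> {0..h}" for s
  proof -
    have "norm (g' s - g' 0) \<le> B * norm (s - 0)"
      by (rule field_differentiable_bound[OF _ g']) (use that B in \<open>auto simp: g_g'_g''_def\<close>)
    also have "\<dots> \<le> B * h"
      using that B0 by (intro mult_left_mono) auto
    finally show ?thesis by simp
  qed
  have "norm ((g h - h * g' 0) - (g 0 - 0 * g' 0)) \<le> (B * h) * norm (h - 0)"
  proof (rule field_differentiable_bound)
    show "((\<lambda>s. g s - s * g' 0) has_real_derivative (g' s - g' 0)) (at s within {0..h})"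
      if "s \<in> {0..h}" for s
      using g[OF that] by (auto intro!: derivative_eq_intros)
  qed (use g'_diff assms(3) in auto)
  then have "\<bar>g h - h * g' 0 - g 0\<bar> \<le> B * h * h"
    using assms(3) by simp
  moreover have "\<bar>g h\<bar> \<le> A" "\<bar>g 0\<bar> \<le> A"
    using A by (auto simp: g_g'_g''_def)
  ultimately have "\<bar>h * g' 0\<bar> \<le> 2 * A + B * h * h"
    by linarith
  then have "\<bar>g' 0\<bar> * h \<le> 2 * A + B * h * h"
    using assms(3) by (simp add: abs_mult mult.commute)
  then have "\<bar>g' 0\<bar> \<le> (2 * A + B * h * h) / h"
    using assms(3) by (simp add: pos_le_divide_eq)
  then show ?thesis
    using assms(3) by (simp add: g_g'_g''_def add_divide_distrib mult.commute)
qed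

text \<open>A negligible value survives division by any power of \<open>e\<close>, so the step in
  Landau's inequality may be taken as small as the moderate second derivative requires.\<close>

lemma negligible_on_partial_on:
  assumes "b \<in> Basis" "smooth_family X f" and "\<delta> > 0"
    and K': "K' \<subseteq> X" "\<And>x s. x \<in> K \<Longrightarrow> 0 \<le> s \<Longrightarrow> s \<le> \<delta> \<Longrightarrow> x + s *\<^sub>R b \<in> K'"
    and f: "negligible_on K' f"
    and f'': "moderate_on K' (\<lambda>e. partial_on X b (partial_on X b (f e)))"
  shows "negligible_on K (\<lambda>e. partial_on X b (f e))"
  unfolding negligible_on_def
proof (intro allI impI)
  fix q :: real assume q: "q \<ge> 0"
  obtain p N where N: "p \<ge> 0" "N \<ge> 0"
    "\<forall>\<^sub>F e in at_right 0. \<forall>x\<in>K'. \<bar>partial_on X b (partial_on X b (f e)) x\<bar> \<le> N * e powr (- p)"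
    using moderate_onD[OF f''] .
  have "2 * q + p + 1 \<ge> 0" using q N(1) by simp
  then obtain M where M: "M \<ge> 0"
    "\<forall>\<^sub>F e in at_right 0. \<forall>x\<in>K'. \<bar>f e x\<bar> \<le> M * e powr (2 * q + p + 1)"
    using negligible_onD[OF f, of "2 * q + p + 1"] by blast
  have "\<forall>\<^sub>F e in at_right 0. \<forall>x\<in>K. \<bar>partial_on X b (f e) x\<bar> \<le> (2 * M + N) * e powr q"
    using M(2) N(3) eventually_small[of 1, simplified] eventually_small[OF \<open>\<delta> > 0\<close>]
  proof eventually_elim
    case (elim e)
    \<comment> \<open>The values are bounded at order \<open>2 * q + p + 1\<close>, so dividing by
      \<open>h\<close> leaves order \<open>q\<close>; multiplying the second derivative by
      \<open>h\<close> leaves order \<open>q + 1\<close>. The summand 1 in the exponent gives h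
      \<le> e, hence h \<le> \<delta> for small \<open>e\<close>.\<close>
    define h where "h = e powr (q + p + 1)"
    have h: "h > 0" "h \<le> \<delta>"
    proof -
      have "h \<le> e powr 1"
        using elim q N(1) unfolding h_def by (intro powr_mono') auto
      then show "h > 0" "h \<le> \<delta>"
        using elim by (auto simp: h_def)
    qed
    show ?case
    proof
      fix x assume x: "x \<in> K"
      have "\<bar>partial_on X b (f e) x\<bar> \<le> 2 * (M * e powr (2 * q + p + 1)) / h + h * (N * e powr (- p))"
      proof (rule partial_on_bound_step[OF _ assms(1) h(1)])
        show "smooth_on X (f e)"
          using assms(2) elim by (auto simp: smooth_family_def)
        show "x + s *\<^sub>R b \<in> X" if "0 \<le> s" "s \<le> h" for s
          using K' x that h by (meson order_trans subsetD)
        have "x + s *\<^sub>R b \<in> K'" if "0 \<le> s" "s \<le> h" for s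
          using K' x that h by (meson order_trans)
        note mem = this
        show "\<bar>f e x\<bar> \<le> M * e powr (2 * q + p + 1)"
          using elim(1) mem[of 0] h by auto
        show "\<bar>f e (x + h *\<^sub>R b)\<bar> \<le> M * e powr (2 * q + p + 1)"
          using elim(1) mem[of h] h by auto
        show "\<bar>partial_on X b (partial_on X b (f e)) (x + s *\<^sub>R b)\<bar> \<le> N * e powr - p"
          if "0 \<le> s" "s \<le> h" for s
          using elim(2) mem[OF that] by auto
      qed
      also have "2 * (M * e powr (2 * q + p + 1)) / h = 2 * M * e powr q"
      proof -
        have "e powr (2 * q + p + 1) = e powr q * h"
          unfolding h_def powr_add[symmetric] by (rule arg_cong[of _ _ "(powr) e"]) simp
        then show ?thesis using h(1) by simp
      qed
      also have "h * (N * e powr (- p)) = N * e powr (q + 1)"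
      proof -
        have "h * e powr (- p) = e powr (q + 1)"
          unfolding h_def powr_add[symmetric] by (rule arg_cong[of _ _ "(powr) e"]) simp
        then show ?thesis by (simp only: mult_ac)
      qed
      also have "\<dots> \<le> N * e powr q"
        using elim N(2) by (intro mult_left_mono powr_mono') auto
      finally show "\<bar>partial_on X b (f e) x\<bar> \<le> (2 * M + N) * e powr q"
        by (simp add: algebra_simps)
    qed
  qed
  then show "\<exists>M. \<forall>\<^sub>F e in at_right 0. \<forall>x\<in>K. \<bar>partial_on X b (f e) x\<bar> \<le> M * e powr q"
    by (rule exI)
qed

lemma moderateD:
  assumes "u \<in> moderate X"
  shows "smooth_family X u"
    and "compact K \<Longrightarrow> K \<subseteq> X \<Longrightarrow> bs \<in> multi_indices \<Longrightarrow> moderate_on K (\<lambda>e. multi_partial_on X bs (u e))"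
    and "compact K \<Longrightarrow> K \<subseteq> X \<Longrightarrow> moderate_on K u"
proof -
  show "smooth_family X u"
    using assms unfolding moderate_iff by simp
  show *: "moderate_on K (\<lambda>e. multi_partial_on X bs (u e))"
    if "compact K" "K \<subseteq> X" "bs \<in> multi_indices" for K bs
    using assms that unfolding moderate_iff by auto
  show "moderate_on K u" if "compact K" "K \<subseteq> X"
    using *[OF that, of "[]"] by simp
qed

lemma negligible_familiesD:
  assumes "u \<in> negligible_families X"
  shows "smooth_family X u"
    and "compact K \<Longrightarrow> K \<subseteq> X \<Longrightarrow> bs \<in> multi_indices \<Longrightarrow> negligible_on K (\<lambda>e. multi_partial_on X bs (u e))"
    and "compact K \<Longrightarrow> K \<subseteq> X \<Longrightarrow> negligible_on K u"
proof -
  show "smooth_family X u"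
    using assms unfolding negligible_families_iff by simp
  show *: "negligible_on K (\<lambda>e. multi_partial_on X bs (u e))"
    if "compact K" "K \<subseteq> X" "bs \<in> multi_indices" for K bs
    using assms that unfolding negligible_families_iff by auto
  show "negligible_on K u" if "compact K" "K \<subseteq> X"
    using *[OF that, of "[]"] by simp
qed

lemma moderate_partial_on:
  assumes "u \<in> moderate X" "b \<in> Basis"
  shows "(\<lambda>e. partial_on X b (u e)) \<in> moderate X"
  unfolding moderate_iff smooth_family_def
proof (intro conjI ballI allI impI)
  fix e :: real assume "e \<in> {0<..1}"
  then show "smooth_on X (partial_on X b (u e))"
    using moderateD(1)[OF assms(1)] assms(2) by (auto simp: smooth_family_def intro!: smooth_on_partial_on)
next
  fix K and bs :: "'a list" assume "compact K" "K \<subseteq> X" "bs \<in> multi_indices"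
  then show "moderate_on K (\<lambda>e. multi_partial_on X bs (partial_on X b (u e)))"
    using moderateD(2)[OF assms(1), of K "bs @ [b]"] assms(2)
    by (simp add: multi_partial_on_append multi_partial_on_Cons)
qed

lemma negligible_families_partial_on:
  assumes "u \<in> negligible_families X" "b \<in> Basis"
  shows "(\<lambda>e. partial_on X b (u e)) \<in> negligible_families X"
  unfolding negligible_families_iff smooth_family_def
proof (intro conjI ballI allI impI)
  fix e :: real assume "e \<in> {0<..1}"
  then show "smooth_on X (partial_on X b (u e))"
    using negligible_familiesD(1)[OF assms(1)] assms(2) by (auto simp: smooth_family_def intro!: smooth_on_partial_on)
next
  fix K and bs :: "'a list" assume "compact K" "K \<subseteq> X" "bs \<in> multi_indices"
  then show "negligible_on K (\<lambda>e. multi_partial_on X bs (partial_on X b (u e)))"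
    using negligible_familiesD(2)[OF assms(1), of K "bs @ [b]"] assms(2)
    by (simp add: multi_partial_on_append multi_partial_on_Cons)
qed

text \<open>The well-known characterisation of the ideal by values. Each induction step gains one
  derivative by interpolation and passes to a compact set enlarged by forward steps.\<close>

lemma moderate_negligible_on_imp_negligible:
  assumes X: "forward_domain X" and u: "u \<in> moderate X"
    and 0: "\<And>K. compact K \<Longrightarrow> K \<subseteq> X \<Longrightarrow> negligible_on K u"
  shows "u \<in> negligible_families X"
proof -
  have "negligible_on K (\<lambda>e. multi_partial_on X bs (u e))"
    if "bs \<in> multi_indices" "compact K" "K \<subseteq> X" for K bs
    using that
  proof (induction bs arbitrary: K)
    case Nil
    then show ?case using 0 by simp
  next
    case (Cons b bs)
    obtain K' \<delta> where K': "compact K'" "K' \<subseteq> X" "K \<subseteq> K'" "\<delta> > 0"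
      "\<And>x b s. x \<in> K \<Longrightarrow> b \<in> Basis \<Longrightarrow> 0 \<le> s \<Longrightarrow> s \<le> \<delta> \<Longrightarrow> x + s *\<^sub>R b \<in> K'"
      using forward_domain_thicken[OF X Cons.prems(2,3)] by metis
    have "negligible_on K (\<lambda>e. partial_on X b (multi_partial_on X bs (u e)))"
    proof (rule negligible_on_partial_on[OF _ _ K'(4) K'(2)])
      show "smooth_family X (\<lambda>e. multi_partial_on X bs (u e))"
        using moderateD(1)[OF u] Cons.prems by (auto simp: smooth_family_def intro!: smooth_on_multi_partial_on)
      show "moderate_on K' (\<lambda>e. partial_on X b (partial_on X b (multi_partial_on X bs (u e))))"
        using moderateD(2)[OF u K'(1,2), of "b # b # bs"] Cons.prems(1) by (simp add: multi_partial_on_Cons)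
    qed (use Cons K' in auto)
    then show ?case
      by (simp add: multi_partial_on_Cons)
  qed
  then show ?thesis
    unfolding negligible_families_iff using moderateD(1)[OF u] by blast
qed

lemma negligible_families_cong:
  assumes u: "u \<in> negligible_families X" and eq: "\<And>e x. e \<in> {0<..1} \<Longrightarrow> x \<in> X \<Longrightarrow> u e x = v e x"
  shows "v \<in> negligible_families X"
  unfolding negligible_families_iff smooth_family_def
proof (intro conjI ballI allI impI)
  fix e :: real assume "e \<in> {0<..1}"
  then show "smooth_on X (v e)"
    using smooth_on_cong[of X "u e" "v e"] negligible_familiesD(1)[OF u] eq by (simp add: smooth_family_def)
next
  fix K and bs :: "'a list" assume K: "compact K" "K \<subseteq> X" "bs \<in> multi_indices"
  have "multi_partial_on X bs (u e) x = multi_partial_on X bs (v e) x"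
    if "e \<in> {0<..1}" "x \<in> K" for e x
    using that K eq by (intro multi_partial_on_cong) auto
  then show "negligible_on K (\<lambda>e. multi_partial_on X bs (v e))"
    using negligible_familiesD(2)[OF u K]
      negligible_on_cong[of K "\<lambda>e. multi_partial_on X bs (u e)" "\<lambda>e. multi_partial_on X bs (v e)"] by simp
qed

lemma negligible_families_zero:
  assumes "forward_domain X"
  shows "(\<lambda>e x. 0) \<in> negligible_families X"
  unfolding negligible_families_iff smooth_family_def
proof (intro conjI ballI allI impI smooth_on_zero[OF assms])
  fix K and bs :: "'a list" assume K: "compact K" "K \<subseteq> X" "bs \<in> multi_indices"
  then show "negligible_on K (\<lambda>e. multi_partial_on X bs (\<lambda>x. 0))"
    using multi_partial_on_zero[OF assms K(3)] negligible_on_zero[of K]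
    by (subst negligible_on_cong[where g = "\<lambda>e x. 0"]) auto
qed

lemma negligible_families_diff:
  assumes X: "forward_domain X" and "u \<in> negligible_families X" "v \<in> negligible_families X"
  shows "(\<lambda>e x. u e x - v e x) \<in> negligible_families X"
  unfolding negligible_families_iff smooth_family_def
proof (intro conjI ballI allI impI)
  have sm: "smooth_on X (u e)" "smooth_on X (v e)" if "e \<in> {0<..1}" for e
    using negligible_familiesD(1)[OF assms(2)] negligible_familiesD(1)[OF assms(3)] that
    by (auto simp: smooth_family_def)
  show "smooth_on X (\<lambda>x. u e x - v e x)" if "e \<in> {0<..1}" for e
    using smooth_on_diff[OF X sm[OF that]] .
  fix K and bs :: "'a list" assume K: "compact K" "K \<subseteq> X" "bs \<in> multi_indices"
  have "negligible_on K (\<lambda>e x. multi_partial_on X bs (u e) x - multi_partial_on X bs (v e) x)"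
    by (intro negligible_on_diff negligible_familiesD(2)[OF assms(2) K] negligible_familiesD(2)[OF assms(3) K])
  then show "negligible_on K (\<lambda>e. multi_partial_on X bs (\<lambda>x. u e x - v e x))"
    using multi_partial_on_diff[OF X K(3) sm] K(2)
    by (subst negligible_on_cong[where g = "\<lambda>e x. multi_partial_on X bs (u e) x - multi_partial_on X bs (v e) x"]) auto
qed

lemma moderate_zero:
  assumes "forward_domain X"
  shows "(\<lambda>e x. 0) \<in> moderate X"
  using negligible_families_zero[OF assms] negligible_on_imp_moderate_on
  unfolding negligible_families_iff moderate_iff by blast

section \<open>The Colombeau relation and its classes\<close>

lemma colombeau_relI:
  "u \<in> moderate X \<Longrightarrow> v \<in> moderate X \<Longrightarrow> (\<lambda>e x. u e x - v e x) \<in> negligible_families X \<Longrightarrow>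
    (u, v) \<in> colombeau_rel X"
  by (simp add: colombeau_rel_def)

lemma colombeau_relD:
  assumes "(u, v) \<in> colombeau_rel X"
  shows "u \<in> moderate X" "v \<in> moderate X" "(\<lambda>e x. u e x - v e x) \<in> negligible_families X"
  using assms by (auto simp: colombeau_rel_def)

lemma colombeau_rel_refl:
  assumes "forward_domain X" "u \<in> moderate X"
  shows "(u, u) \<in> colombeau_rel X"
  using assms negligible_families_zero by (simp add: colombeau_rel_def)

lemma colombeau_rel_sym:
  assumes X: "forward_domain X" and "(u, v) \<in> colombeau_rel X"
  shows "(v, u) \<in> colombeau_rel X"
proof (rule colombeau_relI)
  show "(\<lambda>e x. v e x - u e x) \<in> negligible_families X"
    using negligible_families_diff[OF X negligible_families_zero[OF X] colombeau_relD(3)[OF assms(2)]]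
    by simp
qed (use colombeau_relD[OF assms(2)] in auto)

lemma colombeau_rel_trans:
  assumes X: "forward_domain X" and uv: "(u, v) \<in> colombeau_rel X" and vw: "(v, w) \<in> colombeau_rel X"
  shows "(u, w) \<in> colombeau_rel X"
proof (rule colombeau_relI)
  show "(\<lambda>e x. u e x - w e x) \<in> negligible_families X"
    using negligible_families_diff[OF X colombeau_relD(3)[OF uv] colombeau_relD(3)[OF colombeau_rel_sym[OF X vw]]]
    by simp
qed (use colombeau_relD[OF uv] colombeau_relD[OF vw] in auto)

lemma cg_class_iff: "v \<in> cg_class X u \<longleftrightarrow> (u, v) \<in> colombeau_rel X"
  by (simp add: cg_class_def)

lemma cg_class_eq:
  assumes "forward_domain X" "(u, v) \<in> colombeau_rel X"
  shows "cg_class X u = cg_class X v"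
proof (rule set_eqI)
  fix w
  show "w \<in> cg_class X u \<longleftrightarrow> w \<in> cg_class X v"
    using colombeau_rel_sym[OF assms] colombeau_rel_trans[OF assms(1), of v u w]
      colombeau_rel_trans[OF assms(1), of u v w] assms(2)
    unfolding cg_class_iff by blast
qed

lemma colombeau_rel_partial_on:
  assumes X: "forward_domain X" and b: "b \<in> Basis" and uv: "(u, v) \<in> colombeau_rel X"
  shows "(\<lambda>e. partial_on X b (u e), \<lambda>e. partial_on X b (v e)) \<in> colombeau_rel X"
proof (rule colombeau_relI)
  note uv' = colombeau_relD[OF uv]
  have "(\<lambda>e. partial_on X b (\<lambda>x. u e x - v e x)) \<in> negligible_families X"
    by (rule negligible_families_partial_on[OF uv'(3) b])
  moreover have "partial_on X b (\<lambda>x. u e x - v e x) x = partial_on X b (u e) x - partial_on X b (v e) x"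
    if "e \<in> {0<..1}" "x \<in> X" for e x
    using multi_partial_on_diff[OF X, of "[b]" "u e" "v e" x] that b moderateD(1)[OF uv'(1)] moderateD(1)[OF uv'(2)]
    by (simp add: multi_partial_on_Cons smooth_family_def)
  ultimately show "(\<lambda>e x. partial_on X b (u e) x - partial_on X b (v e) x) \<in> negligible_families X"
    by (rule negligible_families_cong)
qed (use colombeau_relD[OF uv] b in \<open>auto intro: moderate_partial_on\<close>)

lemma colombeau_rel_openin:
  assumes "openin (top_of_set X) W" "(u, v) \<in> colombeau_rel X"
  shows "(u, v) \<in> colombeau_rel W"
proof -
  have W: "W \<subseteq> X"
    using assms(1) by (rule openin_imp_subset)
  have sm: "smooth_family W w" if "smooth_family X w" for w
    using that smooth_on_openin[OF assms(1)] by (auto simp: smooth_family_def)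
  have mod: "w \<in> moderate W" if "w \<in> moderate X" for w
    unfolding moderate_iff
  proof (intro conjI allI impI sm moderateD(1)[OF that])
    fix K and bs :: "'a list" assume K: "compact K" "K \<subseteq> W" "bs \<in> multi_indices"
    have "moderate_on K (\<lambda>e. multi_partial_on X bs (w e))"
      using moderateD(2)[OF that K(1)] K W by blast
    then show "moderate_on K (\<lambda>e. multi_partial_on W bs (w e))"
      by (rule moderate_on_cong[rotated]) (use K in \<open>auto intro!: multi_partial_on_openin[OF assms(1), symmetric]\<close>)
  qed
  have neg: "w \<in> negligible_families W" if "w \<in> negligible_families X" for w
    unfolding negligible_families_iff
  proof (intro conjI allI impI sm negligible_familiesD(1)[OF that])
    fix K and bs :: "'a list" assume K: "compact K" "K \<subseteq> W" "bs \<in> multi_indices"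
    have "negligible_on K (\<lambda>e. multi_partial_on X bs (w e))"
      using negligible_familiesD(2)[OF that K(1)] K W by blast
    moreover have "multi_partial_on X bs (w e) x = multi_partial_on W bs (w e) x" if "x \<in> K" for e x
      using that K by (auto intro!: multi_partial_on_openin[OF assms(1), symmetric])
    ultimately show "negligible_on K (\<lambda>e. multi_partial_on W bs (w e))"
      using negligible_on_cong[of K "\<lambda>e. multi_partial_on X bs (w e)" "\<lambda>e. multi_partial_on W bs (w e)"] by simp
  qed
  show ?thesis
    using colombeau_relD[OF assms(2)] mod neg by (auto intro: colombeau_relI)
qed

lemma colombeauE:
  assumes "forward_domain X" "U \<in> colombeau X"
  obtains u where "u \<in> moderate X" "U = cg_class X u"
  using assms(2) unfolding colombeau_def cg_class_def by (auto elim: quotientE)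

lemma cg_class_in_colombeau: "u \<in> moderate X \<Longrightarrow> cg_class X u \<in> colombeau X"
  unfolding colombeau_def cg_class_def by (rule quotientI)

lemma cg_partial_class:
  assumes X: "forward_domain X" and b: "b \<in> Basis" and u: "u \<in> moderate X"
  shows "cg_partial X b (cg_class X u) = cg_class X (\<lambda>e. partial_on X b (u e))"
proof -
  have "cg_class X (\<lambda>e. partial_on X b (v e)) = cg_class X (\<lambda>e. partial_on X b (u e))"
    if "v \<in> cg_class X u" for v
    by (rule cg_class_eq[OF X, symmetric], rule colombeau_rel_partial_on[OF X b])
      (use that in \<open>simp add: cg_class_iff\<close>)
  moreover have "u \<in> cg_class X u"
    using colombeau_rel_refl[OF X u] by (simp add: cg_class_iff)
  ultimately show ?thesis
    unfolding cg_partial_def by blast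
qed

lemma cg_restrict_class:
  assumes X: "forward_domain X" and W: "openin (top_of_set X) W" and u: "u \<in> moderate X"
  shows "cg_restrict W (cg_class X u) = cg_class W u"
proof -
  have "cg_class W v = cg_class W u" if "v \<in> cg_class X u" for v
    by (rule cg_class_eq[OF forward_domain_openin[OF X W], symmetric], rule colombeau_rel_openin[OF W])
      (use that in \<open>simp add: cg_class_iff\<close>)
  moreover have "u \<in> cg_class X u"
    using colombeau_rel_refl[OF X u] by (simp add: cg_class_iff)
  ultimately show ?thesis
    unfolding cg_restrict_def by blast
qed

section \<open>Representatives of the Cauchy problem\<close>

lemma Basis_plane [simp]: "(1::real, 0::real) \<in> Basis" "(0::real, 1::real) \<in> Basis"
  by (auto simp: Basis_prod_def)

lemma half_plane_iff [simp]: "(t, x) \<in> half_plane \<longleftrightarrow> 0 \<le> t"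
  by (simp add: half_plane_def)

abbreviation Dt where "Dt \<equiv> partial_on half_plane (1, 0)"
abbreviation Dx where "Dx \<equiv> partial_on half_plane (0, 1)"

text \<open>The line t = 0 is the boundary of the half-plane, but the x-direction is tangential to
  it, so the trace is differentiable from both sides.\<close>

lemma smooth_on_trace:
  assumes "smooth_on half_plane f"
  shows "(\<lambda>x. f (0, x)) differentiable (at x)"
    and "partial_on UNIV 1 (\<lambda>x. f (0, x)) x = Dx f (0, x)"
proof -
  have f: "f differentiable (at (0, x) within half_plane)"
    by (rule smooth_on_imp_differentiable_at[OF assms]) simp
  then obtain D where D: "(f has_derivative D) (at (0, x) within half_plane)"
    unfolding differentiable_def by blast
  have "((\<lambda>x. (0, x)) has_derivative (\<lambda>h. (0, h))) (at x)"
    by (auto intro!: derivative_eq_intros)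
  then have "((\<lambda>x. f (0, x)) has_derivative (\<lambda>h. D (0, h))) (at x)"
    by (rule has_derivative_in_compose) (rule has_derivative_subset[OF D], auto)
  then show *: "(\<lambda>x. f (0, x)) differentiable (at x)"
    unfolding differentiable_def by blast
  have "((\<lambda>s. f ((0, x) + s *\<^sub>R (0, 1))) has_real_derivative
      Dx f ((0, x) + 0 *\<^sub>R (0, 1))) (at 0 within {0..1})"
    by (rule has_real_derivative_partial_on) (use f in auto)
  then show "partial_on UNIV 1 (\<lambda>x. f (0, x)) x = Dx f (0, x)"
    by (intro partial_on_unique[OF forward_domain_UNIV, where \<delta> = 1]) (use * in auto)
qed

lemma multi_partial_on_trace:
  assumes "smooth_on half_plane f" "bs \<in> multi_indices"
  shows "multi_partial_on UNIV bs (\<lambda>x. f (0, x)) x = multi_partial_on half_plane (map (Pair 0) bs) f (0, x)"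
  using assms(2)
proof (induction bs arbitrary: x)
  case (Cons b bs)
  have bs: "map (Pair 0) bs \<in> multi_indices"
    using Cons.prems by (auto simp: multi_indices_def Basis_prod_def)
  have "multi_partial_on UNIV (b # bs) (\<lambda>x. f (0, x)) x =
      partial_on UNIV b (\<lambda>x. multi_partial_on half_plane (map (Pair 0) bs) f (0, x)) x"
    unfolding multi_partial_on_Cons using Cons by (intro partial_on_cong) auto
  also have "\<dots> = multi_partial_on half_plane (map (Pair 0) (b # bs)) f (0, x)"
    using smooth_on_trace(2)[OF smooth_on_multi_partial_on[OF assms(1) bs]] Cons.prems
    by (simp add: multi_partial_on_Cons)
  finally show ?case .
qed simp

lemma smooth_on_UNIV_trace:
  assumes "smooth_on half_plane f"
  shows "smooth_on UNIV (\<lambda>x. f (0, x))"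
  unfolding smooth_on_def
proof
  fix bs :: "real list" assume bs: "bs \<in> multi_indices"
  then have bs': "map (Pair 0) bs \<in> multi_indices"
    by (auto simp: multi_indices_def Basis_prod_def)
  have "(\<lambda>x. multi_partial_on half_plane (map (Pair 0) bs) f (0, x)) differentiable_on UNIV"
    using smooth_on_trace(1)[OF smooth_on_multi_partial_on[OF assms bs']]
    by (simp add: differentiable_on_def)
  then show "multi_partial_on UNIV bs (\<lambda>x. f (0, x)) differentiable_on UNIV"
    by (rule differentiable_on_transform) (rule multi_partial_on_trace[OF assms bs])
qed

lemma moderate_on_vimage:
  assumes "moderate_on (h ` K) f"
  shows "moderate_on K (\<lambda>e x. f e (h x))"
  using assms unfolding moderate_on_def by simp

lemma negligible_on_vimage:
  assumes "negligible_on (h ` K) f"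
  shows "negligible_on K (\<lambda>e x. f e (h x))"
  using assms unfolding negligible_on_def by simp

lemma compact_trace: "compact K \<Longrightarrow> compact (Pair (0::real) ` K)" for K :: "real set"
  by (intro compact_continuous_image continuous_intros)

lemma moderate_trace:
  assumes "u \<in> moderate half_plane"
  shows "(\<lambda>e x. u e (0, x)) \<in> moderate UNIV"
  unfolding moderate_iff smooth_family_def
proof (intro conjI ballI allI impI)
  have sm: "smooth_on half_plane (u e)" if "e \<in> {0<..1}" for e
    using moderateD(1)[OF assms] that by (auto simp: smooth_family_def)
  show "smooth_on UNIV (\<lambda>x. u e (0, x))" if "e \<in> {0<..1}" for e
    by (rule smooth_on_UNIV_trace[OF sm[OF that]])
  fix K :: "real set" and bs :: "real list" assume K: "compact K" "bs \<in> multi_indices"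
  then have bs': "map (Pair 0) bs \<in> multi_indices"
    by (auto simp: multi_indices_def Basis_prod_def)
  have "moderate_on K (\<lambda>e x. multi_partial_on half_plane (map (Pair 0) bs) (u e) (0, x))"
    by (rule moderate_on_vimage) (rule moderateD(2)[OF assms compact_trace[OF K(1)] _ bs'], auto)
  then show "moderate_on K (\<lambda>e. multi_partial_on UNIV bs (\<lambda>x. u e (0, x)))"
    by (rule moderate_on_cong[rotated]) (rule multi_partial_on_trace[OF sm K(2), symmetric])
qed

lemma negligible_families_trace:
  assumes "u \<in> negligible_families half_plane"
  shows "(\<lambda>e x. u e (0, x)) \<in> negligible_families UNIV"
proof (rule moderate_negligible_on_imp_negligible[OF forward_domain_UNIV])
  show "(\<lambda>e x. u e (0, x)) \<in> moderate UNIV"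
    using assms negligible_on_imp_moderate_on
    by (intro moderate_trace) (auto simp: moderate_iff negligible_families_iff)
  show "negligible_on K (\<lambda>e x. u e (0, x))" if "compact K" for K
    by (rule negligible_on_vimage) (rule negligible_familiesD(3)[OF assms compact_trace[OF that]], auto)
qed

lemma cg_initial_class:
  assumes u: "u \<in> moderate half_plane"
  shows "cg_initial (cg_class half_plane u) = cg_class UNIV (\<lambda>e x. u e (0, x))"
proof -
  have "cg_class UNIV (\<lambda>e x. v e (0, x)) = cg_class UNIV (\<lambda>e x. u e (0, x))"
    if "v \<in> cg_class half_plane u" for v
  proof (rule cg_class_eq[OF forward_domain_UNIV, symmetric], rule colombeau_relI)
    have uv: "(u, v) \<in> colombeau_rel half_plane"
      using that by (simp add: cg_class_iff)
    show "(\<lambda>e x. u e (0, x)) \<in> moderate UNIV" "(\<lambda>e x. v e (0, x)) \<in> moderate UNIV"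
      using colombeau_relD[OF uv] moderate_trace by auto
    show "(\<lambda>e x. u e (0, x) - v e (0, x)) \<in> negligible_families UNIV"
      using negligible_families_trace[OF colombeau_relD(3)[OF uv]] .
  qed
  moreover have "u \<in> cg_class half_plane u"
    using colombeau_rel_refl[OF forward_domain_half_plane u] by (simp add: cg_class_iff)
  ultimately show ?thesis
    unfolding cg_initial_def by blast
qed

text \<open>Values of representatives suffice here, so products need not be shown to be moderate.\<close>

lemma cg_mult_negligible_on:
  assumes v: "v \<in> cg_mult X A B" and "compact K" "K \<subseteq> X"
    and A: "\<And>a. a \<in> A \<Longrightarrow> negligible_on K (\<lambda>e x. a0 e x - a e x)"
    and B: "\<And>b. b \<in> B \<Longrightarrow> negligible_on K (\<lambda>e x. b0 e x - b e x)"
    and mod: "moderate_on K a0" "moderate_on K b0"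
  shows "negligible_on K (\<lambda>e x. a0 e x * b0 e x - v e x)"
proof -
  obtain a b where ab: "a \<in> A" "b \<in> B" "((\<lambda>e x. a e x * b e x), v) \<in> colombeau_rel X"
    using v by (auto simp: cg_mult_def cg_class_iff)
  have v: "negligible_on K (\<lambda>e x. a e x * b e x - v e x)"
    using negligible_familiesD(3)[OF colombeau_relD(3)[OF ab(3)]] assms(2,3) by blast
  have "moderate_on K (\<lambda>e x. b0 e x - (b0 e x - b e x))"
    by (intro moderate_on_diff mod negligible_on_imp_moderate_on B ab)
  then have b: "moderate_on K b" by simp
  \<comment> \<open>This is \<open>(a * b - v) + (a0 - a) * b + (b0 - b) * a0\<close>, written with
    differences only to match \<open>negligible_on_diff\<close>.\<close>
  have "negligible_on K (\<lambda>e x. (a e x * b e x - v e x) -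
      ((0 - (a0 e x - a e x) * b e x) - (b0 e x - b e x) * a0 e x))"
    by (intro negligible_on_diff v negligible_on_zero negligible_on_mult_moderate A B ab b mod)
  moreover have "(a e x * b e x - v e x) - ((0 - (a0 e x - a e x) * b e x) - (b0 e x - b e x) * a0 e x) =
    a0 e x * b0 e x - v e x" for e x
    by (simp add: algebra_simps)
  ultimately show ?thesis by (simp only:)
qed

text \<open>Equality of classes yields one pair of representatives of the two sides with negligible
  difference; exchanging them for the derivatives of the given \<open>u\<close> and the given
  coefficient costs only negligible terms.\<close>

lemma wave_equation_representative:
  assumes C: "C = cg_class half_plane cc"
    and u: "u \<in> moderate half_plane" and U: "U = cg_class half_plane u"
    and eq: "cg_diff half_plane (D_t (D_t U)) (cg_mult half_plane (cg_mult half_plane C C) (D_x (D_x U)))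
           = cg_zero half_plane"
    and K: "compact K" "K \<subseteq> half_plane"
  shows "negligible_on K (\<lambda>e z. Dt (Dt (u e)) z -
    cc e z * cc e z * Dx (Dx (u e)) z)"
proof -
  define utt uxx where
    "utt = (\<lambda>e. Dt (Dt (u e)))" and
    "uxx = (\<lambda>e. Dx (Dx (u e)))"
  have mod: "utt \<in> moderate half_plane" "uxx \<in> moderate half_plane"
    unfolding utt_def uxx_def by (auto intro!: moderate_partial_on u)
  have Utt: "D_t (D_t U) = cg_class half_plane utt"
    unfolding U utt_def by (simp add: cg_partial_class forward_domain_half_plane u moderate_partial_on)
  have Uxx: "D_x (D_x U) = cg_class half_plane uxx"
    unfolding U uxx_def by (simp add: cg_partial_class forward_domain_half_plane u moderate_partial_on)
  have "(\<lambda>e x. 0) \<in> cg_zero half_plane"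
    unfolding cg_zero_def cg_class_iff
    by (intro colombeau_rel_refl forward_domain_half_plane moderate_zero)
  then obtain a b where ab: "a \<in> cg_class half_plane utt"
    "b \<in> cg_mult half_plane (cg_mult half_plane C C) (cg_class half_plane uxx)"
    "((\<lambda>e x. a e x - b e x), (\<lambda>e x. 0)) \<in> colombeau_rel half_plane"
    unfolding eq[symmetric] Utt Uxx by (auto simp: cg_diff_def cg_class_iff)
  \<comment> \<open>The coefficient is moderate because its class has an element:
    \<open>colombeau_rel\<close> relates moderate families only.\<close>
  obtain d where "d \<in> C"
    using ab(2) unfolding cg_mult_def by blast
  then have cc: "cc \<in> moderate half_plane"
    unfolding C cg_class_iff by (rule colombeau_relD(1))
  have near: "negligible_on K (\<lambda>e x. v e x - w e x)" if "w \<in> cg_class half_plane v" for v w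
    using that negligible_familiesD(3)[OF colombeau_relD(3)] K unfolding cg_class_iff by blast
  have "negligible_on K (\<lambda>e x. (cc e x * cc e x) * uxx e x - b e x)"
    using ab(2) K
  proof (rule cg_mult_negligible_on)
    show "negligible_on K (\<lambda>e x. cc e x * cc e x - m e x)" if "m \<in> cg_mult half_plane C C" for m
      using that K
      by (rule cg_mult_negligible_on) (use near moderateD(3)[OF cc K] in \<open>simp_all add: C\<close>)
  qed (use near moderateD(3)[OF cc K] moderateD(3)[OF mod(2) K] in \<open>auto intro: moderate_on_mult\<close>)
  from negligible_on_diff[OF this negligible_familiesD(3)[OF colombeau_relD(3)[OF ab(3)] K]]
  have "negligible_on K (\<lambda>e x. (utt e x - a e x) -
      (((cc e x * cc e x) * uxx e x - b e x) - (a e x - b e x - 0)))"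
    by (rule negligible_on_diff[OF near[OF ab(1)]])
  then show ?thesis
    by (simp add: utt_def uxx_def)
qed

lemma initial_value_representative:
  assumes u: "u \<in> moderate half_plane" and U: "cg_initial (cg_class half_plane u) = cg_class UNIV v"
  shows "(\<lambda>e x. u e (0, x) - v e x) \<in> negligible_families UNIV"
proof -
  have "(\<lambda>e x. u e (0, x)) \<in> cg_class UNIV (\<lambda>e x. u e (0, x))"
    using colombeau_rel_refl[OF forward_domain_UNIV moderate_trace[OF u]] by (simp only: cg_class_iff)
  then have "(v, \<lambda>e x. u e (0, x)) \<in> colombeau_rel UNIV"
    using U[unfolded cg_initial_class[OF u]] by (simp add: cg_class_iff[symmetric])
  then show ?thesis
    by (rule colombeau_relD(3)[OF colombeau_rel_sym[OF forward_domain_UNIV]])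
qed

text \<open>Negligible first derivatives make all derivatives of positive order negligible, in
  particular O(1). Hence the exponent of \<open>u\<close> itself serves every multi-index.\<close>

lemma colombeau_regularI:
  assumes W: "forward_domain W" and u: "u \<in> moderate W"
    and D: "\<And>b K. b \<in> Basis \<Longrightarrow> compact K \<Longrightarrow> K \<subseteq> W \<Longrightarrow> negligible_on K (\<lambda>e. partial_on W b (u e))"
  shows "cg_class W u \<in> colombeau_regular W"
proof -
  have "\<exists>p\<ge>0. \<forall>bs\<in>multi_indices. sup_bigo W u K bs (- p)" if K: "compact K" "K \<subseteq> W" for K
  proof -
    obtain p M where p: "p \<ge> 0" "M \<ge> 0" "\<forall>\<^sub>F e in at_right 0. \<forall>x\<in>K. \<bar>u e x\<bar> \<le> M * e powr (- p)"
      using moderate_onD[OF moderateD(3)[OF u K]] .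
    have "sup_bigo W u K bs (- p)" if bs: "bs \<in> multi_indices" for bs
    proof (cases bs rule: rev_cases)
      case Nil
      then show ?thesis
        using p(3) by (auto simp: sup_bigo_def)
    next
      \<comment> \<open>\<open>foldr\<close> applies the last entry of the list first, so splitting
        it off exposes a first derivative of \<open>u\<close>.\<close>
      case (snoc bs' b)
      have "(\<lambda>e. partial_on W b (u e)) \<in> negligible_families W"
        by (rule moderate_negligible_on_imp_negligible[OF W])
          (use bs snoc in \<open>auto intro: moderate_partial_on[OF u] D\<close>)
      then have "negligible_on K (\<lambda>e. multi_partial_on W bs (u e))"
        using negligible_familiesD(2)[of _ W K bs'] K bs snoc
        by (simp add: multi_partial_on_append multi_partial_on_Cons)
      from negligible_onD[OF this order_refl] obtain M where M: "M \<ge> 0"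
        "\<forall>\<^sub>F e in at_right 0. \<forall>x\<in>K. \<bar>multi_partial_on W bs (u e) x\<bar> \<le> M * e powr 0" .
      have "\<forall>\<^sub>F e in at_right 0. \<forall>x\<in>K. \<bar>multi_partial_on W bs (u e) x\<bar> \<le> M * e powr (- p)"
        using M(2) eventually_small[of 1, simplified]
      proof eventually_elim
        case (elim e)
        have "M * e powr 0 \<le> M * e powr (- p)"
          using elim p(1) M(1) by (intro mult_left_mono powr_mono') auto
        then show ?case
          using elim(1) by force
      qed
      then show ?thesis
        unfolding sup_bigo_def by (rule exI)
    qed
    then show ?thesis
      using p(1) by blast
  qed
  moreover have "u \<in> cg_class W u"
    using colombeau_rel_refl[OF W u] by (simp add: cg_class_iff)
  ultimately show ?thesis
    unfolding colombeau_regular_def using cg_class_in_colombeau[OF u] by blast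
qed

text \<open>The exponent found for one representative serves \<open>u\<close> as well, because all
  derivatives of a negligible difference are O(1).\<close>

lemma colombeau_regularD:
  assumes W: "forward_domain W" and reg: "cg_class W u \<in> colombeau_regular W"
    and K: "compact K" "K \<subseteq> W"
  obtains p where "p \<ge> 0" "\<forall>bs\<in>multi_indices. \<exists>M\<ge>0. \<forall>\<^sub>F e in at_right 0.
    \<forall>x\<in>K. \<bar>multi_partial_on W bs (u e) x\<bar> \<le> M * e powr (- p)"
proof -
  obtain v where v: "v \<in> cg_class W u"
    and reg': "\<forall>K. compact K \<and> K \<subseteq> W \<longrightarrow> (\<exists>p\<ge>0. \<forall>bs\<in>multi_indices. sup_bigo W v K bs (- p))"
    using reg unfolding colombeau_regular_def by blast
  obtain p where p: "p \<ge> 0" "\<forall>bs\<in>multi_indices. sup_bigo W v K bs (- p)"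
    using reg' K by blast
  note uv = colombeau_relD[OF v[unfolded cg_class_iff]]
  have sm: "smooth_on W (u e)" "smooth_on W (v e)" if "e \<in> {0<..1}" for e
    using moderateD(1)[OF uv(1)] moderateD(1)[OF uv(2)] that by (auto simp: smooth_family_def)
  show thesis
  proof (rule that[OF p(1)], rule ballI)
    fix bs :: "'a list" assume bs: "bs \<in> multi_indices"
    obtain M where M: "\<forall>\<^sub>F e in at_right 0. \<forall>x\<in>K. \<bar>multi_partial_on W bs (v e) x\<bar> \<le> M * e powr (- p)"
      using bspec[OF p(2) bs] unfolding sup_bigo_def by blast
    obtain N where N: "N \<ge> 0"
      "\<forall>\<^sub>F e in at_right 0. \<forall>x\<in>K. \<bar>multi_partial_on W bs (\<lambda>x. u e x - v e x) x\<bar> \<le> N * e powr 0"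
      using negligible_onD[OF negligible_familiesD(2)[OF uv(3) K bs] order_refl] .
    have "\<forall>\<^sub>F e in at_right 0. \<forall>x\<in>K. \<bar>multi_partial_on W bs (u e) x\<bar> \<le> (\<bar>M\<bar> + N) * e powr (- p)"
      using M N(2) eventually_small[of 1, simplified]
    proof eventually_elim
      case (elim e)
      show ?case
      proof
        fix x assume x: "x \<in> K"
        have "N * e powr 0 \<le> N * e powr (- p)"
          using elim p(1) N(1) by (intro mult_left_mono powr_mono') auto
        moreover have "M * e powr (- p) \<le> \<bar>M\<bar> * e powr (- p)"
          by (intro mult_right_mono) auto
        moreover have "multi_partial_on W bs (\<lambda>x. u e x - v e x) x =
            multi_partial_on W bs (u e) x - multi_partial_on W bs (v e) x"
          by (rule multi_partial_on_diff[OF W bs sm]) (use elim x K in auto)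
        moreover note bspec[OF elim(1) x] bspec[OF elim(2) x]
        ultimately show "\<bar>multi_partial_on W bs (u e) x\<bar> \<le> (\<bar>M\<bar> + N) * e powr (- p)"
          unfolding distrib_right by linarith
      qed
    qed
    then show "\<exists>M\<ge>0. \<forall>\<^sub>F e in at_right 0. \<forall>x\<in>K. \<bar>multi_partial_on W bs (u e) x\<bar> \<le> M * e powr (- p)"
      using N(1) by (intro exI[of _ "\<bar>M\<bar> + N"] conjI) simp_all
  qed
qed

section \<open>Riemann invariants\<close>

lemma smooth_on_half_plane_dt:
  assumes "smooth_on half_plane f" "0 \<le> t"
  shows "((\<lambda>t. f (t, x)) has_real_derivative Dt f (t, x)) (at t within {0..})"
  using has_real_derivative_partial_on[of f "(0, x)" t "(1, 0)" half_plane "{0..}"]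
    smooth_on_imp_differentiable_at[OF assms(1), of "(t, x)"] assms(2) by simp

lemma smooth_on_half_plane_dx:
  assumes "smooth_on half_plane f" "0 \<le> t"
  shows "((\<lambda>x. f (t, x)) has_real_derivative Dx f (t, x)) (at x)"
  using has_real_derivative_partial_on[of f "(t, 0)" x "(0, 1)" half_plane UNIV]
    smooth_on_imp_differentiable_at[OF assms(1), of "(t, x)"] assms(2) by simp

lemma smooth_on_half_plane_chain:
  assumes "smooth_on half_plane f" "0 < t" "(X has_real_derivative X') (at t)"
  shows "((\<lambda>t. f (t, X t)) has_real_derivative
    Dt f (t, X t) + X' * Dx f (t, X t)) (at t)"
proof -
  let ?D = "frechet_derivative f (at (t, X t) within half_plane)"
  have "at (t, X t) within half_plane = at (t, X t) within UNIV"
    by (rule at_within_nhd[of _ "{0<..} \<times> UNIV"])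
      (use assms(2) in \<open>auto simp: half_plane_def intro: open_Times\<close>)
  moreover have "(f has_derivative ?D) (at (t, X t) within half_plane)"
    using smooth_on_imp_differentiable_at[OF assms(1), of "(t, X t)"] assms(2) frechet_derivative_works
    by auto
  ultimately have D: "(f has_derivative ?D) (at (t, X t))"
    by simp
  have "((\<lambda>t. (t, X t)) has_derivative (\<lambda>h. (h, X' * h))) (at t)"
    using assms(3) by (auto intro!: derivative_eq_intros simp: has_field_derivative_def)
  from has_derivative_compose[OF this D]
  have "((\<lambda>t. f (t, X t)) has_derivative (\<lambda>h. ?D (h, X' * h))) (at t)" .
  moreover have "?D (h, X' * h) = (?D (1, 0) + X' * ?D (0, 1)) * h" for h
  proof -
    have "(h, X' * h) = h *\<^sub>R (1, 0) + (X' * h) *\<^sub>R (0, 1)"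
      by simp
    then have "?D (h, X' * h) = ?D (h *\<^sub>R (1, 0) + (X' * h) *\<^sub>R (0, 1))"
      by (rule arg_cong)
    also have "\<dots> = h * ?D (1, 0) + (X' * h) * ?D (0, 1)"
      using linear_add[OF has_derivative_linear[OF D]] linear_scale[OF has_derivative_linear[OF D]]
      by (simp only: real_scaleR_def)
    finally show ?thesis
      by (simp add: algebra_simps)
  qed
  ultimately show ?thesis
    unfolding has_field_derivative_def partial_on_def by simp
qed

lemma smooth_on_continuous_on: "smooth_on X f \<Longrightarrow> continuous_on X f"
  by (intro differentiable_imp_continuous_on smooth_on_imp_differentiable_on)

text \<open>Symmetry up to the boundary t = 0: write \<open>u (t, x) - u (t, x0)\<close> as an
  integral of \<open>ux\<close>, differentiate under the integral in t, then differentiate in x at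
  \<open>x0\<close>. One-sided derivatives suffice for uniqueness at both places.\<close>

lemma mixed_partials_half_plane:
  assumes u: "smooth_on half_plane u" and t0: "0 \<le> t0"
  shows "Dx (Dt u) (t0, x0) =
    Dt (Dx u) (t0, x0)"
proof -
  define ut ux uxt where "ut = Dt u" "ux = Dx u"
    "uxt = Dt ux"
  have sm: "smooth_on half_plane ut" "smooth_on half_plane ux" "smooth_on half_plane uxt"
    unfolding ut_ux_uxt_def by (auto intro!: smooth_on_partial_on u)
  note cont [continuous_intros] = smooth_on_continuous_on[OF sm(2)] smooth_on_continuous_on[OF sm(3)]
  have ux_cont: "continuous_on S (\<lambda>y. ux (t, y))" "continuous_on S (\<lambda>y. uxt (t, y))" if "0 \<le> t" for t S
    by (rule continuous_on_compose2[OF cont(1)] continuous_on_compose2[OF cont(2)],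
        auto intro!: continuous_intros simp: that)+
  have diff: "ut (t0, x) - ut (t0, x0) = integral {x0..x} (\<lambda>y. uxt (t0, y))" if "x0 \<le> x" for x
  proof -
    have ftc: "u (t, x) - u (t, x0) = integral {x0..x} (\<lambda>y. ux (t, y))" if "0 \<le> t" for t
    proof -
      have "((\<lambda>y. ux (t, y)) has_integral (u (t, x) - u (t, x0))) {x0..x}"
      proof (rule fundamental_theorem_of_calculus[OF \<open>x0 \<le> x\<close>])
        fix y assume "y \<in> {x0..x}"
        show "((\<lambda>x. u (t, x)) has_vector_derivative ux (t, y)) (at y within {x0..x})"
          using smooth_on_half_plane_dx[OF u that, of y] unfolding ut_ux_uxt_def
          by (auto simp: has_real_derivative_iff_has_vector_derivative intro: has_vector_derivative_at_within)
      qed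
      then show ?thesis by (simp add: integral_unique)
    qed
    have D: "((\<lambda>t. u (t, x) - u (t, x0)) has_real_derivative (ut (t0, x) - ut (t0, x0))) (at t0 within {0..})"
      unfolding ut_ux_uxt_def by (intro DERIV_diff smooth_on_half_plane_dt u t0)
    have "((\<lambda>t. integral {x0..x} (\<lambda>y. ux (t, y))) has_real_derivative (ut (t0, x) - ut (t0, x0)))
        (at t0 within {0..})"
      by (rule has_field_derivative_transform_within[OF D zero_less_one]) (use t0 ftc in auto)
    moreover have "((\<lambda>t. integral (cbox x0 x) (\<lambda>y. ux (t, y))) has_field_derivative
        integral (cbox x0 x) (\<lambda>y. uxt (t0, y))) (at t0 within {0..})"
    proof (rule leibniz_rule_field_derivative[where fx = "\<lambda>t y. uxt (t, y)"])
      show "((\<lambda>t. ux (t, y)) has_real_derivative uxt (t, y)) (at t within {0..})" if "t \<in> {0..}" for t y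
        unfolding ut_ux_uxt_def(3) using that by (intro smooth_on_half_plane_dt sm) auto
      show "(\<lambda>y. ux (t, y)) integrable_on cbox x0 x" if "t \<in> {0..}" for t
        using that by (intro integrable_continuous ux_cont) auto
      show "continuous_on ({0..} \<times> cbox x0 x) (\<lambda>(t, y). uxt (t, y))"
        using continuous_on_subset[OF smooth_on_continuous_on[OF sm(3)], of "{0..} \<times> cbox x0 x"]
        by (auto simp: half_plane_def case_prod_unfold)
    qed (use t0 in auto)
    moreover have "at t0 within {0..} \<noteq> bot"
      using t0 by (cases "t0 = 0") (auto simp: at_within_Ici_at_right at_within_interior[of t0 "{0..}"])
    ultimately show ?thesis
      using has_field_derivative_unique by (metis cbox_interval)
  qed
  have "((\<lambda>x. integral {x0..x} (\<lambda>y. uxt (t0, y))) has_real_derivative uxt (t0, x0)) (at x0 within {x0..x0+1})"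
    by (rule integral_has_real_derivative) (auto intro: ux_cont t0)
  moreover have "((\<lambda>x. integral {x0..x} (\<lambda>y. uxt (t0, y))) has_real_derivative
      Dx ut (t0, x0)) (at x0 within {x0..x0+1})"
  proof (rule has_field_derivative_transform_within[OF _ zero_less_one])
    show "((\<lambda>x. ut (t0, x) - ut (t0, x0)) has_real_derivative Dx ut (t0, x0))
        (at x0 within {x0..x0+1})"
      using smooth_on_half_plane_dx[OF sm(1) t0, of x0]
      by (auto intro!: derivative_eq_intros intro: has_field_derivative_at_within)
  qed (auto simp: diff)
  moreover have "at x0 within {x0..x0+1} \<noteq> bot"
    by (simp add: at_within_Icc_at_right)
  ultimately show ?thesis
    unfolding ut_ux_uxt_def using has_field_derivative_unique by blast
qed

text \<open>One value of the regularisation parameter is frozen here. \<open>cm\<close> bounds the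
  propagation speed and thus the cones of dependence; \<delta> bounds the residual on the strip and
  is kept explicit so that later it can be any power of the parameter.\<close>

locale wave_strip =
  fixes u :: "real \<times> real \<Rightarrow> real" and c c' :: "real \<Rightarrow> real" and cm T R \<delta> :: real
  assumes smooth: "smooth_on half_plane u"
    and c_deriv: "(c has_real_derivative c' t) (at t)"
    and c_pos: "c t > 0" and c_le: "c t \<le> cm"
    and \<delta>_pos: "\<delta> > 0"
    and source: "0 \<le> t \<Longrightarrow> t \<le> T \<Longrightarrow> \<bar>x\<bar> \<le> R \<Longrightarrow>
      \<bar>Dt (Dt u) (t, x) -
        c t * c t * Dx (Dx u) (t, x)\<bar> \<le> \<delta>"
begin

abbreviation "ut \<equiv> Dt u"
abbreviation "ux \<equiv> Dx u"
abbreviation "utt \<equiv> Dt ut"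
abbreviation "uxx \<equiv> Dx ux"

text \<open>The Riemann invariants: for \<open>s = 1\<close> the right-moving and for \<open>s = -1\<close> the left-moving one.\<close>

definition w :: "real \<Rightarrow> real \<Rightarrow> real \<Rightarrow> real" where
  "w s t x = ut (t, x) - s * c t * ux (t, x)"

lemma smooth_ut: "smooth_on half_plane ut" and smooth_ux: "smooth_on half_plane ux"
  by (auto intro!: smooth_on_partial_on smooth)

lemma smooth_utt: "smooth_on half_plane utt" and smooth_uxx: "smooth_on half_plane uxx"
  by (auto intro!: smooth_on_partial_on smooth)

lemma cm_pos: "cm > 0"
  using c_pos c_le less_le_trans by blast

lemma ut_eq: "ut (t, x) = (w 1 t x + w (-1) t x) / 2"
  by (simp add: w_def)

lemma ux_eq: "ux (t, x) = (w (-1) t x - w 1 t x) / (2 * c t)"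
  using c_pos[of t] by (simp add: w_def)

lemma continuous_on_c: "continuous_on S c"
  by (intro DERIV_continuous_on) (rule has_field_derivative_at_within[OF c_deriv])

lemma continuous_on_w:
  assumes "continuous_on S f" "continuous_on S g" "\<And>p. p \<in> S \<Longrightarrow> 0 \<le> f p"
  shows "continuous_on S (\<lambda>p. w s (f p) (g p))"
proof -
  have "continuous_on S (\<lambda>p. v (f p, g p))" if "smooth_on half_plane v" for v
    by (rule continuous_on_compose2[OF smooth_on_continuous_on[OF that]])
      (use assms in \<open>auto intro!: continuous_intros\<close>)
  moreover have "continuous_on S (\<lambda>p. c (f p))"
    by (rule continuous_on_compose2[OF continuous_on_c assms(1)]) (rule subset_UNIV)
  ultimately show ?thesis
    unfolding w_def using smooth_ut smooth_ux by (intro continuous_intros) auto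
qed

text \<open>Since s * s = 1, applying \<partial>t + s c \<partial>x to ut - s c ux cancels the mixed
  derivatives. What remains is the residual of the wave equation and the coupling term from the
  derivative of c.\<close>

lemma w_characteristic_deriv:
  assumes "s = 1 \<or> s = -1" "0 < t" "(X has_real_derivative s * c t) (at t)"
  shows "((\<lambda>t. w s t (X t)) has_real_derivative
    utt (t, X t) - c t * c t * uxx (t, X t) - s * c' t * ux (t, X t)) (at t)"
proof -
  have "s * s = 1"
    using assms(1) by auto
  note D = smooth_on_half_plane_chain[OF smooth_ut assms(2,3)] smooth_on_half_plane_chain[OF smooth_ux assms(2,3)]
  have mixed: "Dx ut (t, X t) = Dt ux (t, X t)"
    using assms(2) by (intro mixed_partials_half_plane smooth) simp
  have *: "utt (t, X t) + s * c t * m - ((s * c t) * (m + s * c t * uxx (t, X t)) + s * c' t * ux (t, X t)) =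
    utt (t, X t) - (s * s) * (c t * c t) * uxx (t, X t) - s * c' t * ux (t, X t)" for m
    by (simp add: algebra_simps)
  show ?thesis
    unfolding w_def using *[of "Dt ux (t, X t)"] \<open>s * s = 1\<close>
    by (auto intro!: derivative_eq_intros D c_deriv simp: mixed mult.commute)
qed

text \<open>A comparison principle: any \<open>B\<close> that grows at least as fast as source plus
  coupling majorises the change of the invariant along its characteristic.\<close>

lemma w_characteristic_bound:
  assumes s: "s = 1 \<or> s = -1" and t: "0 \<le> t0" "t0 \<le> t1" "t1 \<le> T"
    and X: "\<And>t. t0 < t \<Longrightarrow> t < t1 \<Longrightarrow> (X has_real_derivative s * c t) (at t)"
      "continuous_on {t0..t1} X" "\<And>t. t0 \<le> t \<Longrightarrow> t \<le> t1 \<Longrightarrow> \<bar>X t\<bar> \<le> R"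
    and B: "continuous_on {t0..t1} B" "\<And>t. t0 < t \<Longrightarrow> t < t1 \<Longrightarrow> (B has_real_derivative B' t) (at t)"
      "\<And>t. t0 < t \<Longrightarrow> t < t1 \<Longrightarrow> \<delta> + \<bar>c' t\<bar> * \<bar>ux (t, X t)\<bar> \<le> B' t"
  shows "\<bar>w s t1 (X t1) - w s t0 (X t0)\<bar> \<le> B t1 - B t0"
proof (cases "t0 = t1")
  case False
  have "norm (w s t1 (X t1) - w s t0 (X t0)) \<le> B t1 - B t0"
  proof (rule differentiable_bound_general[of t0 t1 "\<lambda>t. w s t (X t)" B])
    show "t0 < t1" using t False by simp
    show "continuous_on {t0..t1} (\<lambda>t. w s t (X t))"
      using t by (intro continuous_on_w X continuous_intros) auto
    show "((\<lambda>t. w s t (X t)) has_vector_derivative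
        utt (t, X t) - c t * c t * uxx (t, X t) - s * c' t * ux (t, X t)) (at t)" if "t0 < t" "t < t1" for t
      unfolding has_real_derivative_iff_has_vector_derivative[symmetric]
      using that t by (intro w_characteristic_deriv s X) auto
    show "(B has_vector_derivative B' t) (at t)" if "t0 < t" "t < t1" for t
      unfolding has_real_derivative_iff_has_vector_derivative[symmetric] by (rule B(2)[OF that])
    show "norm (utt (t, X t) - c t * c t * uxx (t, X t) - s * c' t * ux (t, X t)) \<le> B' t"
      if "t0 < t" "t < t1" for t
    proof -
      have "\<bar>utt (t, X t) - c t * c t * uxx (t, X t)\<bar> \<le> \<delta>"
        using that t X(3)[of t] by (intro source) auto
      moreover have "\<bar>s * c' t * ux (t, X t)\<bar> = \<bar>c' t\<bar> * \<bar>ux (t, X t)\<bar>"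
        using s by (auto simp: abs_mult)
      ultimately show ?thesis
        using B(3)[OF that] by (simp only: real_norm_def)
    qed
  qed (rule B(1))
  then show ?thesis by simp
qed simp

text \<open>Where the speed is constant the two invariants decouple, and only the source changes
  them.\<close>

lemma w_transport:
  assumes s: "s = 1 \<or> s = -1" and t: "0 \<le> t0" "t0 \<le> t1" "t1 \<le> T"
    and k: "\<And>t. t0 \<le> t \<Longrightarrow> t \<le> t1 \<Longrightarrow> c t = k"
    and x: "\<bar>x\<bar> + cm * (t1 - t0) \<le> R"
  shows "\<bar>w s t1 x - w s t0 (x - s * k * (t1 - t0))\<bar> \<le> \<delta> * (t1 - t0)"
proof -
  have c': "c' t = 0" if "t0 < t" "t < t1" for t
  proof -
    have "((\<lambda>_. k) has_real_derivative c' t) (at t)"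
      by (rule has_field_derivative_transform_within_open[OF c_deriv, of "{t0<..<t1}"]) (use that k in auto)
    then show ?thesis
      using DERIV_const DERIV_unique by blast
  qed
  have "\<bar>w s t1 (x + s * k * (t1 - t1)) - w s t0 (x + s * k * (t0 - t1))\<bar> \<le> \<delta> * t1 - \<delta> * t0"
  proof (rule w_characteristic_bound[OF s t])
    show "((\<lambda>t. x + s * k * (t - t1)) has_real_derivative s * c t) (at t)" if "t0 < t" "t < t1" for t
      using that k[of t] by (auto intro!: derivative_eq_intros)
    show "\<bar>x + s * k * (t - t1)\<bar> \<le> R" if "t0 \<le> t" "t \<le> t1" for t
    proof -
      have "\<bar>s * k * (t - t1)\<bar> = k * (t1 - t)"
        using s c_pos[of t] k[OF that] that by (auto simp: abs_mult)
      also have "\<dots> \<le> cm * (t1 - t0)"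
        using c_le[of t] c_pos[of t] k[OF that] that by (intro mult_mono) auto
      finally show ?thesis
        using x by linarith
    qed
  qed (auto intro!: continuous_intros derivative_eq_intros simp: c')
  then show ?thesis
    by (simp add: algebra_simps)
qed

lemma c_antiderivative:
  obtains \<Gamma> where "\<And>t. 0 \<le> t \<Longrightarrow> (\<Gamma> has_real_derivative c t) (at t)"
proof
  fix t :: real assume "0 \<le> t"
  \<comment> \<open>Starting the integral at -1 makes every t \<ge> 0 an interior point, so the
    derivative is two-sided.\<close>
  have "((\<lambda>t. integral {-1..t} c) has_real_derivative c t) (at t within {-1..t+1})"
    using \<open>0 \<le> t\<close> by (intro integral_has_real_derivative[OF continuous_on_c]) simp
  then show "((\<lambda>t. integral {-1..t} c) has_real_derivative c t) (at t)"
    using \<open>0 \<le> t\<close> at_within_Icc_at[of "-1" t "t + 1"] by simp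
qed

text \<open>
  The quantity \<open>(\<delta>0 + \<delta>) * exp ((A + 1) * (t - t0))\<close> grows strictly faster than the Riemann
  invariants can along characteristics as long as they stay below it.
\<close>

lemma w_cone_bound:
  assumes s: "s = 1 \<or> s = -1" and t: "0 \<le> t0" "t0 \<le> t1" "t1 \<le> T"
    and A: "A \<ge> 0" "\<And>t. t0 < t \<Longrightarrow> t < t1 \<Longrightarrow> \<bar>c' t\<bar> \<le> A * c t"
    and x: "\<bar>x\<bar> + cm * (t1 - t0) \<le> R" and "\<delta>0 \<ge> 0"
    and base: "\<And>s y. s = 1 \<or> s = -1 \<Longrightarrow> \<bar>y - x\<bar> \<le> cm * (t1 - t0) \<Longrightarrow> \<bar>w s t0 y\<bar> \<le> \<delta>0"
  shows "\<bar>w s t1 x\<bar> \<le> (\<delta>0 + \<delta>) * exp ((A + 1) * (t1 - t0))"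
proof (rule ccontr)
  define B where "B t = (\<delta>0 + \<delta>) * exp ((A + 1) * (t - t0))" for t
  \<comment> \<open>The backward cone of \<open>(t1, x)\<close> with the maximal speed
    \<open>cm\<close>; it contains every backward characteristic that starts in it, down to time
    \<open>t0\<close>.\<close>
  define D where "D = {p. t0 \<le> fst p \<and> fst p \<le> t1 \<and> \<bar>snd p - x\<bar> \<le> cm * (t1 - fst p)}"
  \<comment> \<open>First-violation argument: the points of the cone where an invariant reaches the
    barrier form a compact set. At its earliest point the characteristic traced backwards runs
    strictly below the barrier in both invariants.\<close>
  define bad where "bad = (\<Union>s\<in>{1, -1}. {p \<in> D. B (fst p) \<le> \<bar>w s (fst p) (snd p)\<bar>})"
  assume "\<not> \<bar>w s t1 x\<bar> \<le> (\<delta>0 + \<delta>) * exp ((A + 1) * (t1 - t0))"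
  then have "(t1, x) \<in> bad"
    using s t by (auto simp: bad_def D_def B_def)
  have "closed D"
    unfolding D_def by (intro closed_Collect_conj closed_Collect_le continuous_intros)
  moreover have "bounded D"
  proof (rule bounded_subset)
    show "bounded ({t0..t1} \<times> {x - cm * (t1 - t0)..x + cm * (t1 - t0)})"
      by (intro bounded_Times bounded_closed_interval)
    have "\<bar>y - x\<bar> \<le> cm * (t1 - t0)" if "t0 \<le> t" "t \<le> t1" "\<bar>y - x\<bar> \<le> cm * (t1 - t)" for t y
    proof -
      have "cm * (t1 - t) \<le> cm * (t1 - t0)"
        using that cm_pos by (intro mult_left_mono) auto
      then show ?thesis using that by linarith
    qed
    then show "D \<subseteq> {t0..t1} \<times> {x - cm * (t1 - t0)..x + cm * (t1 - t0)}"
      unfolding D_def by (fastforce simp: abs_le_iff)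
  qed
  ultimately have "compact D"
    by (simp add: compact_eq_bounded_closed)
  have "compact {p \<in> D. B (fst p) \<le> \<bar>w s (fst p) (snd p)\<bar>}" for s
  proof -
    have "closed {p \<in> D. B (fst p) \<le> \<bar>w s (fst p) (snd p)\<bar>}"
      by (intro continuous_on_closed_Collect_le \<open>closed D\<close> continuous_on_rabs continuous_on_w)
        (use t(1) in \<open>auto simp: B_def D_def intro!: continuous_intros\<close>)
    then show ?thesis
      using compact_Int_closed[OF \<open>compact D\<close>, of "{p \<in> D. B (fst p) \<le> \<bar>w s (fst p) (snd p)\<bar>}"]
      by (simp add: Int_absorb1 subset_iff)
  qed
  then have "compact bad"
    unfolding bad_def by (intro compact_UN) auto
  then have "\<exists>p\<in>bad. \<forall>q\<in>bad. fst p \<le> fst q"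
    using \<open>(t1, x) \<in> bad\<close> by (intro continuous_attains_inf continuous_intros) auto
  then obtain p where p: "p \<in> bad" "\<And>q. q \<in> bad \<Longrightarrow> fst p \<le> fst q"
    by blast
  define ts xs where "ts = fst p" "xs = snd p"
  obtain s where s: "s = 1 \<or> s = -1" and pD: "p \<in> D" and big: "B ts \<le> \<bar>w s ts xs\<bar>"
    using p(1) unfolding bad_def ts_xs_def by auto
  have xs: "t0 \<le> ts" "ts \<le> t1" "\<bar>xs - x\<bar> \<le> cm * (t1 - ts)"
    using pD by (auto simp: D_def ts_xs_def)
  have below: "\<bar>w s \<tau> y\<bar> < B \<tau>" if "(\<tau>, y) \<in> D" "\<tau> < ts" "s = 1 \<or> s = -1" for s \<tau> y
  proof (rule ccontr)
    assume "\<not> \<bar>w s \<tau> y\<bar> < B \<tau>"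
    then have "(\<tau>, y) \<in> bad"
      using that unfolding bad_def by auto
    from p(2)[OF this] show False
      using that by (simp add: ts_xs_def)
  qed
  obtain \<Gamma> where \<Gamma>: "\<And>t. 0 \<le> t \<Longrightarrow> (\<Gamma> has_real_derivative c t) (at t)"
    using c_antiderivative by blast
  define X where "X \<tau> = xs - s * (\<Gamma> ts - \<Gamma> \<tau>)" for \<tau>
  have X_D: "\<bar>X \<tau> - x\<bar> \<le> cm * (t1 - \<tau>)" if "t0 \<le> \<tau>" "\<tau> \<le> ts" for \<tau>
  proof -
    have "norm (\<Gamma> ts - \<Gamma> \<tau>) \<le> cm * norm (ts - \<tau>)"
    proof (rule field_differentiable_bound[of "{t0..ts}"])
      show "(\<Gamma> has_real_derivative c z) (at z within {t0..ts})" if "z \<in> {t0..ts}" for z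
        using that t(1) by (intro has_field_derivative_at_within[OF \<Gamma>]) auto
      show "norm (c z) \<le> cm" for z
        using c_pos[of z] c_le[of z] by simp
    qed (use that in auto)
    then have "\<bar>s * (\<Gamma> ts - \<Gamma> \<tau>)\<bar> \<le> cm * (ts - \<tau>)"
      using s that by (auto simp: abs_mult)
    then show ?thesis
      using xs(3) unfolding X_def by (simp add: right_diff_distrib)
  qed
  have "\<bar>w s ts (X ts) - w s t0 (X t0)\<bar> \<le> B ts - B t0"
  proof (rule w_characteristic_bound[OF s t(1) xs(1)])
    show "ts \<le> T" using xs t by simp
    show "(X has_real_derivative s * c \<tau>) (at \<tau>)" if "t0 < \<tau>" "\<tau> < ts" for \<tau>
      unfolding X_def using that t(1) by (auto intro!: derivative_eq_intros \<Gamma>)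
    show "continuous_on {t0..ts} X"
      unfolding X_def using t(1)
      by (intro continuous_intros DERIV_continuous_on[OF has_field_derivative_at_within[OF \<Gamma>]]) auto
    show "\<bar>X \<tau>\<bar> \<le> R" if "t0 \<le> \<tau>" "\<tau> \<le> ts" for \<tau>
    proof -
      have "cm * (t1 - \<tau>) \<le> cm * (t1 - t0)"
        using that cm_pos by (intro mult_left_mono) auto
      then show ?thesis
        using X_D[OF that] x by linarith
    qed
    show "continuous_on {t0..ts} B"
      unfolding B_def by (intro continuous_intros)
    show "(B has_real_derivative (A + 1) * B \<tau>) (at \<tau>)" for \<tau>
      unfolding B_def by (auto intro!: derivative_eq_intros)
    \<comment> \<open>Below the barrier \<open>c * \<bar>ux\<bar> \<le> B\<close>, so
      \<open>A * B\<close> absorbs the coupling; the remaining \<open>B\<close> absorbs the source,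
      since \<delta> \<le> B.\<close>
    show "\<delta> + \<bar>c' \<tau>\<bar> * \<bar>ux (\<tau>, X \<tau>)\<bar> \<le> (A + 1) * B \<tau>" if "t0 < \<tau>" "\<tau> < ts" for \<tau>
    proof -
      have "(\<tau>, X \<tau>) \<in> D"
        using X_D[of \<tau>] that xs by (auto simp: D_def)
      then have "\<bar>w 1 \<tau> (X \<tau>)\<bar> < B \<tau>" "\<bar>w (-1) \<tau> (X \<tau>)\<bar> < B \<tau>"
        using below that by auto
      then have "\<bar>w (-1) \<tau> (X \<tau>) - w 1 \<tau> (X \<tau>)\<bar> \<le> 2 * B \<tau>"
        by linarith
      moreover have "c \<tau> * \<bar>ux (\<tau>, X \<tau>)\<bar> = \<bar>w (-1) \<tau> (X \<tau>) - w 1 \<tau> (X \<tau>)\<bar> / 2"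
        using c_pos[of \<tau>] by (simp add: ux_eq abs_mult)
      ultimately have *: "c \<tau> * \<bar>ux (\<tau>, X \<tau>)\<bar> \<le> B \<tau>"
        by simp
      have "\<bar>c' \<tau>\<bar> * \<bar>ux (\<tau>, X \<tau>)\<bar> \<le> (A * c \<tau>) * \<bar>ux (\<tau>, X \<tau>)\<bar>"
        using A(2)[of \<tau>] that xs by (intro mult_right_mono) auto
      also have "\<dots> \<le> A * B \<tau>"
        using mult_left_mono[OF * A(1)] by (simp add: mult.assoc)
      finally have "\<bar>c' \<tau>\<bar> * \<bar>ux (\<tau>, X \<tau>)\<bar> \<le> A * B \<tau>" .
      moreover have "\<delta> \<le> B \<tau>"
      proof -
        have "(\<delta>0 + \<delta>) * 1 \<le> B \<tau>"
          unfolding B_def using \<delta>_pos \<open>\<delta>0 \<ge> 0\<close> A(1) that by (intro mult_left_mono) auto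
        then show ?thesis using \<open>\<delta>0 \<ge> 0\<close> by simp
      qed
      ultimately show ?thesis
        by (simp add: algebra_simps)
    qed
  qed
  moreover have "\<bar>w s t0 (X t0)\<bar> \<le> \<delta>0"
    using X_D[of t0] xs by (intro base s) auto
  \<comment> \<open>The barrier starts above the data by the positive amount \<delta>; this makes
    the resulting inequality strict and contradicts the choice of the bad point.\<close>
  moreover have "B t0 = \<delta>0 + \<delta>"
    by (simp add: B_def)
  ultimately have "\<bar>w s ts xs\<bar> < B ts"
    using \<delta>_pos by (simp add: X_def)
  then show False
    using big by simp
qed

end

section \<open>The transition layer\<close>

lemma integral_diff_bound:
  fixes f g :: "real \<Rightarrow> real"
  assumes "0 \<le> r" "continuous_on {-r..r} f" "continuous_on {-r..r} g"
    and "\<And>y. \<bar>y\<bar> \<le> r \<Longrightarrow> \<bar>f y - g y\<bar> \<le> B"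
  shows "\<bar>integral {-r..r} f - integral {-r..r} g\<bar> \<le> 2 * r * B"
proof -
  have "norm (integral {-r..r} (\<lambda>y. f y - g y)) \<le> B * (r - (-r))"
    using assms by (intro integral_bound continuous_intros) auto
  moreover have "integral {-r..r} (\<lambda>y. f y - g y) = integral {-r..r} f - integral {-r..r} g"
    using assms by (intro integral_diff integrable_continuous_real)
  ultimately show ?thesis
    by (simp add: algebra_simps)
qed

text \<open>The third condition on \<open>e\<close> says \<open>2 * rad \<le> c0\<close> and keeps
  the tubes at c0 and -c0 apart. \<open>R\<close> leaves room for tubes up to time \<open>T\<close>
  together with their backward cones. Both invariants start near the same \<open>f0\<close>, because
  the initial value of \<open>u\<close> is zero and only the initial velocity contributes.\<close>

locale wave_layer = wave_strip +
  fixes c0 c1 e Ka :: real and f0 :: "real \<Rightarrow> real"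
  assumes eps: "0 < e" "e \<le> 1/2" "4 * (1 + 3 * cm) * e \<le> c0"
    and T: "T \<ge> 2" and R: "cm * (2 * T + 2) + c0 \<le> R"
    and c_left: "t \<le> 1 - e \<Longrightarrow> c t = c0" and c_right: "1 + e \<le> t \<Longrightarrow> c t = c1"
    and Ka: "Ka \<ge> 0" "\<bar>c' t\<bar> \<le> Ka / e * c t"
    and init: "s = 1 \<or> s = -1 \<Longrightarrow> \<bar>x\<bar> \<le> R \<Longrightarrow> \<bar>w s 0 x - f0 x\<bar> \<le> \<delta>"
    and f0_supp: "\<bar>x\<bar> > e \<Longrightarrow> f0 x = 0" and f0_cont: "continuous_on UNIV f0"
    and f0_int: "\<bar>z\<bar> + e \<le> r \<Longrightarrow> integral {-r..r} (\<lambda>y. f0 (z + y)) = 1"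
begin

text \<open>
  In the layer both invariants are at most \<open>Q * \<delta>\<close> at distance more than \<open>L * e\<close> from \<open>\<plusminus> c0\<close>. The tubes
  have radius \<open>rad\<close>, so that their ends are quiet.
\<close>

definition L :: real where "L = 1 + 3 * cm"
definition Q :: real where "Q = (2 + T) * exp (2 * Ka + 2)"
definition rad :: real where "rad = 2 * L * e"

lemma c0_pos: "c0 > 0" and c0_le: "c0 \<le> cm" and c1_pos: "c1 > 0" and c1_le: "c1 \<le> cm"
  using c_pos[of 0] c_le[of 0] c_left[of 0] c_pos[of 2] c_le[of 2] c_right[of 2] eps by auto

lemma rad: "0 < rad" "2 * rad \<le> c0" "rad = 2 * (L * e)" "e + 3 * (cm * e) = L * e" "e \<le> L * e" "0 < L * e"
  using eps cm_pos by (auto simp: rad_def L_def algebra_simps intro!: mult_pos_pos add_pos_pos)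

lemma Q: "2 + T \<le> Q" "0 < Q"
proof -
  have "(2 + T) * 1 \<le> (2 + T) * exp (2 * Ka + 2)"
    using T Ka(1) by (intro mult_left_mono) auto
  then show "2 + T \<le> Q" "0 < Q"
    using T by (auto simp: Q_def)
qed

lemma w_quiet_before:
  assumes s: "s = 1 \<or> s = -1" and t: "0 \<le> t" "t \<le> 1 - e" and x: "\<bar>x\<bar> + cm * t \<le> R"
    and far: "\<bar>x - s * c0 * t\<bar> > e"
  shows "\<bar>w s t x\<bar> \<le> (1 + T) * \<delta>"
proof -
  have "\<bar>w s t x - w s 0 (x - s * c0 * (t - 0))\<bar> \<le> \<delta> * (t - 0)"
    using t x T eps by (intro w_transport s) (auto simp: c_left)
  moreover have "\<delta> * t \<le> \<delta> * T"
    using t T eps \<delta>_pos by (intro mult_left_mono) auto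
  moreover have "\<bar>w s 0 (x - s * c0 * t)\<bar> \<le> \<delta>"
  proof -
    have "c0 * t \<le> cm * t"
      using c0_le t(1) by (rule mult_right_mono)
    moreover have "\<bar>s * c0 * t\<bar> = c0 * t"
      using s c0_pos t(1) by (auto simp: abs_mult)
    ultimately have "\<bar>x - s * c0 * t\<bar> \<le> R"
      using x by linarith
    then show ?thesis
      using init[OF s, of "x - s * c0 * t"] f0_supp[OF far] by simp
  qed
  ultimately show ?thesis
    by (simp add: algebra_simps)
qed

text \<open>Traced back to the start of the layer, the cone of such a point misses the supports of
  both incoming invariants, so the cone estimate starts from small data.\<close>

lemma w_quiet_layer:
  assumes s: "s = 1 \<or> s = -1" and t: "1 - e \<le> t" "t \<le> 1 + e" and x: "\<bar>x\<bar> + cm * t \<le> R"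
    and far: "\<bar>\<bar>x\<bar> - c0\<bar> > L * e"
  shows "\<bar>w s t x\<bar> \<le> Q * \<delta>"
proof -
  \<comment> \<open>Origin of \<open>L * e = e + 3 * (cm * e)\<close>: \<open>e\<close> is the
    support radius of the data, one \<open>cm * e\<close> covers the offset \<open>c0 * e\<close> of
    the ray from c0 at time 1 - e, and two more are the width of the cone over the layer.\<close>
  have time: "cm * (t - (1 - e)) \<le> 2 * (cm * e)"
    using t cm_pos mult_left_mono[of "t - (1 - e)" "2 * e" cm] by (simp add: mult_ac)
  have "\<bar>w s t x\<bar> \<le> ((1 + T) * \<delta> + \<delta>) * exp ((Ka / e + 1) * (t - (1 - e)))"
  proof (rule w_cone_bound[OF s])
    show "\<bar>w s (1 - e) y\<bar> \<le> (1 + T) * \<delta>" if s: "s = 1 \<or> s = -1" and y: "\<bar>y - x\<bar> \<le> cm * (t - (1 - e))" for s y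
    proof (rule w_quiet_before[OF s])
      have "cm * (t - (1 - e)) + cm * (1 - e) = cm * t"
        by (simp add: algebra_simps)
      then show "\<bar>y\<bar> + cm * (1 - e) \<le> R"
        using x y by linarith
      have "c0 * e \<le> cm * e"
        using c0_le eps(1) by simp
      moreover have "\<bar>\<bar>y\<bar> - c0\<bar> > e + cm * e"
      proof -
        have "\<bar>\<bar>x\<bar> - \<bar>y\<bar>\<bar> \<le> 2 * (cm * e)"
          using y time by linarith
        then show ?thesis
          using far rad(4) by linarith
      qed
      ultimately have "\<bar>\<bar>y\<bar> - (c0 - c0 * e)\<bar> > e"
        using c0_pos eps(1) mult_pos_pos[of c0 e] by linarith
      moreover have "\<bar>s * c0 * (1 - e)\<bar> = c0 - c0 * e"
        using s c0_pos eps by (auto simp: abs_mult algebra_simps)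
      ultimately show "\<bar>y - s * c0 * (1 - e)\<bar> > e"
        by linarith
    qed (use eps in auto)
    have "cm * (1 - e) \<ge> 0"
      using eps cm_pos by simp
    then show "\<bar>x\<bar> + cm * (t - (1 - e)) \<le> R"
      using x by (simp add: algebra_simps)
  qed (use eps t T Ka \<delta>_pos in auto)
  \<comment> \<open>The growth rate is of order 1/e, but it acts for a time of at most 2e.\<close>
  also have "\<dots> \<le> ((1 + T) * \<delta> + \<delta>) * exp (2 * Ka + 2)"
  proof (rule mult_left_mono)
    have "(Ka / e + 1) * (t - (1 - e)) \<le> (Ka / e + 1) * (2 * e)"
      using t eps Ka(1) by (intro mult_left_mono) auto
    also have "\<dots> = 2 * Ka + 2 * e"
      using eps by (simp add: field_simps)
    finally show "exp ((Ka / e + 1) * (t - (1 - e))) \<le> exp (2 * Ka + 2)"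
      using eps by simp
  qed (use T \<delta>_pos in auto)
  also have "\<dots> = Q * \<delta>"
    by (simp add: Q_def algebra_simps)
  finally show ?thesis .
qed

text \<open>Both places c0 and -c0 emit waves of the family \<open>s\<close>, one transmitted and
  one reflected. Measuring the foot of the characteristic at the end of the layer by its absolute
  value treats both at once.\<close>

lemma w_quiet_after:
  assumes s: "s = 1 \<or> s = -1" and t: "1 + e \<le> t" "t \<le> T" and x: "\<bar>x\<bar> + cm * t \<le> R"
    and far: "\<bar>\<bar>x - s * c1 * (t - 1 - e)\<bar> - c0\<bar> > L * e"
  shows "\<bar>w s t x\<bar> \<le> 2 * Q * \<delta>"
proof -
  define y where "y = x - s * c1 * (t - 1 - e)"
  have cm: "cm * (t - (1 + e)) + cm * (1 + e) = cm * t" "0 \<le> cm * (1 + e)"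
    using cm_pos eps by (auto simp: algebra_simps)
  have "\<bar>w s t x - w s (1 + e) (x - s * c1 * (t - (1 + e)))\<bar> \<le> \<delta> * (t - (1 + e))"
    using t x T eps cm by (intro w_transport s) (auto simp: c_right)
  moreover have "\<delta> * (t - (1 + e)) \<le> \<delta> * T"
    using t T eps \<delta>_pos by (intro mult_left_mono) auto
  moreover have "\<bar>w s (1 + e) y\<bar> \<le> Q * \<delta>"
  proof (rule w_quiet_layer[OF s])
    have "c1 * (t - (1 + e)) \<le> cm * (t - (1 + e))"
      using c1_le t(1) by (intro mult_right_mono) auto
    moreover have "\<bar>s * c1 * (t - 1 - e)\<bar> = c1 * (t - (1 + e))"
      using s c1_pos t(1) by (auto simp: abs_mult diff_diff_eq)
    ultimately show "\<bar>y\<bar> + cm * (1 + e) \<le> R"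
      using x cm unfolding y_def by linarith
  qed (use eps far in \<open>auto simp: y_def\<close>)
  moreover have "T * \<delta> \<le> Q * \<delta>"
    using Q \<delta>_pos by simp
  ultimately show ?thesis
    by (simp add: y_def algebra_simps)
qed

section \<open>Mass of the invariants in a tube and its passage through the layer\<close>

definition J :: "real \<Rightarrow> real \<Rightarrow> real \<Rightarrow> real" where
  "J s t z = integral {-rad..rad} (\<lambda>y. w s t (z + y))"

lemma J_transport:
  assumes s: "s = 1 \<or> s = -1" and t: "0 \<le> t0" "t0 \<le> t1" "t1 \<le> T"
    and k: "\<And>t. t0 \<le> t \<Longrightarrow> t \<le> t1 \<Longrightarrow> c t = k"
    and z: "\<bar>z\<bar> + rad + cm * (t1 - t0) \<le> R"
  shows "\<bar>J s t1 z - J s t0 (z - s * k * (t1 - t0))\<bar> \<le> cm * T * \<delta>"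
proof -
  have "\<bar>J s t1 z - J s t0 (z - s * k * (t1 - t0))\<bar> \<le> 2 * rad * (\<delta> * (t1 - t0))"
    unfolding J_def
  proof (rule integral_diff_bound)
    show "\<bar>w s t1 (z + y) - w s t0 (z - s * k * (t1 - t0) + y)\<bar> \<le> \<delta> * (t1 - t0)" if "\<bar>y\<bar> \<le> rad" for y
      using w_transport[OF s t k, of "z + y"] z that by (simp add: algebra_simps)
  qed (use t rad(1) in \<open>auto intro!: continuous_on_w continuous_intros\<close>)
  also have "\<dots> \<le> cm * (\<delta> * T)"
    using rad t c0_le c0_pos \<delta>_pos cm_pos by (intro mult_mono mult_left_mono) auto
  finally show ?thesis
    by (simp add: mult_ac)
qed

text \<open>The centre runs ahead of the ray by \<open>s * c0 * e\<close>, so that at t = 1 - e it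
  sits exactly at \<open>s * c0\<close>, where the layer estimate is centred. The tube is wide
  enough to contain the whole pulse in spite of this shift.\<close>

lemma J_before:
  assumes s: "s = 1 \<or> s = -1" and t: "0 \<le> t" "t \<le> 1 - e"
  shows "\<bar>J s t (s * c0 * (t + e)) - 1\<bar> \<le> c0 * (1 + T) * \<delta>"
proof -
  have sc: "\<bar>s * c0 * r\<bar> = c0 * r" if "0 \<le> r" for r
    using s c0_pos that by (auto simp: abs_mult)
  have ct: "c0 * (t + e) \<le> cm * 1"
    using t eps c0_le cm_pos by (intro mult_mono) auto
  have cmt: "cm * t \<le> cm * 1"
    using t eps cm_pos by (intro mult_left_mono) auto
  have R': "4 * cm + c0 \<le> R"
    using R T mult_left_mono[of 4 "2 * T + 2" cm] cm_pos by linarith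
  have "\<bar>J s t (s * c0 * (t + e)) - integral {-rad..rad} (\<lambda>y. f0 (s * c0 * e + y))\<bar> \<le> 2 * rad * ((1 + T) * \<delta>)"
    unfolding J_def
  proof (rule integral_diff_bound)
    show "\<bar>w s t (s * c0 * (t + e) + y) - f0 (s * c0 * e + y)\<bar> \<le> (1 + T) * \<delta>" if y: "\<bar>y\<bar> \<le> rad" for y
    proof -
      have "\<bar>w s t (s * c0 * (t + e) + y) - w s 0 (s * c0 * (t + e) + y - s * c0 * (t - 0))\<bar> \<le> \<delta> * (t - 0)"
      proof (rule w_transport[OF s])
        have "\<bar>s * c0 * (t + e)\<bar> \<le> cm"
          using sc[of "t + e"] ct t eps by simp
        then show "\<bar>s * c0 * (t + e) + y\<bar> + cm * (t - 0) \<le> R"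
          using cmt R' y rad(2) c0_pos cm_pos unfolding diff_zero by linarith
      qed (use t T eps c_left in auto)
      moreover have "s * c0 * (t + e) + y - s * c0 * (t - 0) = s * c0 * e + y"
        by (simp add: algebra_simps)
      moreover have "\<bar>w s 0 (s * c0 * e + y) - f0 (s * c0 * e + y)\<bar> \<le> \<delta>"
      proof (rule init[OF s])
        have "c0 * e \<le> c0 * 1"
          using eps c0_pos by (intro mult_left_mono) auto
        then show "\<bar>s * c0 * e + y\<bar> \<le> R"
          using sc[of e] eps y rad(2) R' c0_le c0_pos by linarith
      qed
      moreover have "\<delta> * t \<le> \<delta> * T"
        using t T eps \<delta>_pos by (intro mult_left_mono) auto
      ultimately show ?thesis
        by (simp add: algebra_simps)
    qed
  qed (use t rad(1) in \<open>auto intro!: continuous_on_w continuous_intros continuous_on_compose2[OF f0_cont]\<close>)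
  also have "integral {-rad..rad} (\<lambda>y. f0 (s * c0 * e + y)) = 1"
  proof (rule f0_int)
    have "c0 * e \<le> cm * e"
      using c0_le eps(1) by simp
    then show "\<bar>s * c0 * e\<bar> + e \<le> rad"
      using sc[of e] eps rad cm_pos by (smt (verit) mult_pos_pos)
  qed
  also have "2 * rad * ((1 + T) * \<delta>) \<le> c0 * ((1 + T) * \<delta>)"
    using rad T \<delta>_pos by (intro mult_right_mono) auto
  finally show ?thesis
    by (simp add: mult_ac)
qed

text \<open>Up to the source, the time derivative of \<open>P\<close> is c^2 times the difference of
  \<open>ux\<close> between the tube ends, and that of \<open>V\<close> is the difference of
  \<open>ut\<close>. The ends are quiet throughout the layer, so both quantities are almost
  constant, and the derivative of c never enters.\<close>

lemma layer_momentum: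
  assumes \<rho>: "\<rho> = 1 \<or> \<rho> = -1"
  defines "z \<equiv> \<rho> * c0"
  defines "P t \<equiv> integral {-rad..rad} (\<lambda>y. ut (t, z + y))"
    and "V t \<equiv> u (t, z + rad) - u (t, z - rad)"
  shows "0 \<le> t \<Longrightarrow> J s t z = P t - s * c t * V t"
    and "\<bar>P (1 + e) - P (1 - e)\<bar> \<le> (2 * cm * Q + cm) * \<delta>"
    and "\<bar>V (1 + e) - V (1 - e)\<bar> \<le> 2 * Q * \<delta>"
proof -
  have z: "\<bar>z\<bar> = c0"
    using \<rho> c0_pos by (auto simp: z_def)
  have R': "6 * cm + c0 \<le> R"
    using R T mult_left_mono[of 6 "2 * T + 2" cm] cm_pos by linarith
  have "z = c0 \<or> z = - c0"
    using \<rho> by (auto simp: z_def)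
  then have far: "\<bar>\<bar>x\<bar> - c0\<bar> > L * e" if "x = z + rad \<or> x = z - rad" for x
    using that rad c0_pos by (elim disjE) linarith+
  have quiet: "\<bar>w s t x\<bar> \<le> Q * \<delta>"
    if "s = 1 \<or> s = -1" "1 - e \<le> t" "t \<le> 1 + e" "x = z + rad \<or> x = z - rad" for s t x
  proof (rule w_quiet_layer[OF that(1-3) _ far[OF that(4)]])
    have "cm * t \<le> cm * 2"
      using that eps cm_pos by (intro mult_left_mono) auto
    moreover have "\<bar>x\<bar> \<le> c0 + rad"
      using that(4) z rad(1) by (elim disjE) linarith+
    ultimately show "\<bar>x\<bar> + cm * t \<le> R"
      using rad(2) R' c0_le c0_pos by linarith
  qed
  have cont: "continuous_on S (\<lambda>y. v (t, z + y))" if "smooth_on half_plane v" "0 \<le> t" for S v t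
    by (rule continuous_on_compose2[OF smooth_on_continuous_on[OF that(1)]])
      (use that in \<open>auto intro!: continuous_intros\<close>)
  have ftc: "integral {-rad..rad} (\<lambda>y. Dx v (t, z + y)) = v (t, z + rad) - v (t, z - rad)"
    if "smooth_on half_plane v" "0 \<le> t" for v t
  proof -
    have "((\<lambda>y. Dx v (t, z + y)) has_integral (v (t, z + rad) - v (t, z + - rad))) {-rad..rad}"
    proof (rule fundamental_theorem_of_calculus)
      fix y
      have "((\<lambda>y. v (t, z + y)) has_real_derivative Dx v (t, z + y)) (at y)"
        using DERIV_shift[of "\<lambda>y. v (t, y)" _ y z] smooth_on_half_plane_dx[OF that, of "z + y"]
        by (simp add: add.commute)
      then show "((\<lambda>y. v (t, z + y)) has_vector_derivative Dx v (t, z + y))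
          (at y within {-rad..rad})"
        by (auto simp: has_real_derivative_iff_has_vector_derivative intro: has_vector_derivative_at_within)
    qed (use rad(1) in auto)
    then show ?thesis
      by (simp add: integral_unique)
  qed
  show "J s t z = P t - s * c t * V t" if "0 \<le> t"
  proof -
    have "J s t z = P t - integral {-rad..rad} (\<lambda>y. s * c t * ux (t, z + y))"
      unfolding J_def P_def w_def
      by (intro integral_diff integrable_continuous_real continuous_intros cont smooth_ut smooth_ux that)
    then show ?thesis
      using ftc[OF smooth that] by (simp add: V_def)
  qed
  have "norm (P (1 + e) - P (1 - e)) \<le> ((2 * cm * Q + cm) * \<delta>) * norm ((1 + e) - (1 - e))"
  proof (rule field_differentiable_bound[of "{1-e..1+e}"])
    fix t assume t: "t \<in> {1-e..1+e}"
    have "((\<lambda>t. integral (cbox (-rad) rad) (\<lambda>y. ut (t, z + y))) has_field_derivative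
        integral (cbox (-rad) rad) (\<lambda>y. utt (t, z + y))) (at t within {0..})"
    proof (rule leibniz_rule_field_derivative[where fx = "\<lambda>t y. utt (t, z + y)"])
      show "((\<lambda>t. ut (t, z + y)) has_real_derivative utt (t, z + y)) (at t within {0..})" if "t \<in> {0..}" for t y
        using that by (intro smooth_on_half_plane_dt smooth_ut) auto
      show "(\<lambda>y. ut (t, z + y)) integrable_on cbox (-rad) rad" if "t \<in> {0..}" for t
        using that by (intro integrable_continuous cont smooth_ut) auto
      have "continuous_on ({0..} \<times> cbox (-rad) rad) (\<lambda>p. utt (fst p, z + snd p))"
        by (rule continuous_on_compose2[OF smooth_on_continuous_on[OF smooth_utt]])
          (auto intro!: continuous_intros)
      then show "continuous_on ({0..} \<times> cbox (-rad) rad) (\<lambda>(t, y). utt (t, z + y))"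
        by (simp add: case_prod_unfold)
    qed (use t eps in auto)
    then show "(P has_field_derivative integral {-rad..rad} (\<lambda>y. utt (t, z + y))) (at t within {1-e..1+e})"
      unfolding P_def cbox_interval by (rule DERIV_subset) (use eps in auto)
    have t0: "0 \<le> t" "t \<le> T"
      using t eps T by auto
    have "\<bar>integral {-rad..rad} (\<lambda>y. utt (t, z + y)) - integral {-rad..rad} (\<lambda>y. c t * c t * uxx (t, z + y))\<bar>
        \<le> 2 * rad * \<delta>"
    proof (rule integral_diff_bound)
      show "\<bar>utt (t, z + y) - c t * c t * uxx (t, z + y)\<bar> \<le> \<delta>" if "\<bar>y\<bar> \<le> rad" for y
        using that z rad(2) R' c0_le c0_pos by (intro source t0) linarith
    qed (use rad(1) cont[OF smooth_utt t0(1)] cont[OF smooth_uxx t0(1)] in \<open>auto intro!: continuous_intros\<close>)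
    moreover have "2 * rad * \<delta> \<le> cm * \<delta>"
      using rad c0_le \<delta>_pos by (intro mult_right_mono) auto
    moreover have "integral {-rad..rad} (\<lambda>y. c t * c t * uxx (t, z + y)) =
        c t * (c t * ux (t, z + rad) - c t * ux (t, z - rad))"
      unfolding integral_mult_right ftc[OF smooth_ux t0(1)] by (simp add: algebra_simps)
    moreover have "\<bar>c t * (c t * ux (t, z + rad) - c t * ux (t, z - rad))\<bar> \<le> cm * (2 * Q * \<delta>)"
    proof -
      have "\<bar>c t * ux (t, x)\<bar> \<le> Q * \<delta>" if "x = z + rad \<or> x = z - rad" for x
      proof -
        have "c t * ux (t, x) = (w (-1) t x - w 1 t x) / 2"
          using c_pos[of t] by (simp add: ux_eq)
        then show ?thesis
          using quiet[of 1 t x] quiet[of "-1" t x] t that by auto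
      qed
      from this[of "z + rad"] this[of "z - rad"]
      have "\<bar>c t * ux (t, z + rad) - c t * ux (t, z - rad)\<bar> \<le> 2 * Q * \<delta>"
        by simp
      then show ?thesis
        unfolding abs_mult[of "c t"] using c_pos[of t] c_le[of t] cm_pos by (intro mult_mono) auto
    qed
    ultimately show "norm (integral {-rad..rad} (\<lambda>y. utt (t, z + y))) \<le> (2 * cm * Q + cm) * \<delta>"
      by (simp add: algebra_simps)
  qed (use eps in auto)
  also have "\<dots> \<le> ((2 * cm * Q + cm) * \<delta>) * 1"
    using eps cm_pos Q \<delta>_pos by (intro mult_left_mono) auto
  finally show "\<bar>P (1 + e) - P (1 - e)\<bar> \<le> (2 * cm * Q + cm) * \<delta>"
    by simp
  have "norm (V (1 + e) - V (1 - e)) \<le> (2 * Q * \<delta>) * norm ((1 + e) - (1 - e))"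
  proof (rule field_differentiable_bound[of "{1-e..1+e}"])
    fix t assume t: "t \<in> {1-e..1+e}"
    have "(V has_real_derivative (ut (t, z + rad) - ut (t, z - rad))) (at t within {0..})"
      unfolding V_def using t eps by (intro DERIV_diff smooth_on_half_plane_dt smooth) auto
    then show "(V has_real_derivative (ut (t, z + rad) - ut (t, z - rad))) (at t within {1-e..1+e})"
      by (rule DERIV_subset) (use eps in auto)
    have "\<bar>ut (t, x)\<bar> \<le> Q * \<delta>" if "x = z + rad \<or> x = z - rad" for x
      using quiet[of 1 t x] quiet[of "-1" t x] t that by (auto simp: ut_eq)
    from this[of "z + rad"] this[of "z - rad"]
    show "norm (ut (t, z + rad) - ut (t, z - rad)) \<le> 2 * Q * \<delta>"
      by simp
  qed (use eps in auto)
  also have "\<dots> \<le> (2 * Q * \<delta>) * 1"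
    using eps Q \<delta>_pos by (intro mult_left_mono) auto
  finally show "\<bar>V (1 + e) - V (1 - e)\<bar> \<le> 2 * Q * \<delta>"
    by simp
qed

text \<open>
  Transmission (\<open>s = \<rho>\<close>) and reflection (\<open>s = - \<rho>\<close>) of the wave arriving at \<open>\<rho> * c0\<close>: both the
  integral of \<open>\<partial>\<^sub>t u\<close> and the jump of \<open>u\<close> are preserved by the layer, while they determine
  the integrals of the two Riemann invariants through the local wave speed.
\<close>

lemma J_layer:
  assumes \<rho>: "\<rho> = 1 \<or> \<rho> = -1" and s: "s = 1 \<or> s = -1"
  shows "\<bar>J s (1 + e) (\<rho> * c0) - (1 + s * \<rho> * c1 / c0) / 2\<bar> \<le> 7 * cm * Q * \<delta>"
proof -
  define z where "z = \<rho> * c0"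
  define P where "P t = integral {-rad..rad} (\<lambda>y. ut (t, z + y))" for t
  define V where "V t = u (t, z + rad) - u (t, z - rad)" for t
  note mom = layer_momentum[OF \<rho>, folded z_def, folded P_def V_def]
  define Jp Jm where "Jp = J \<rho> (1 - e) z" "Jm = J (- \<rho>) (1 - e) z"
  have \<rho>2: "\<rho> * \<rho> = 1" "- \<rho> = 1 \<or> - \<rho> = -1"
    using \<rho> by auto
  have R': "6 * cm + c0 \<le> R"
    using R T mult_left_mono[of 6 "2 * T + 2" cm] cm_pos by linarith
  have Jp: "\<bar>Jp - 1\<bar> \<le> c0 * (1 + T) * \<delta>"
    using J_before[OF \<rho>, of "1 - e"] eps by (simp add: Jp_Jm_def z_def)
  \<comment> \<open>The invariant moving the other way is concentrated near
    \<open>- \<rho> * c0\<close>, on the opposite side, so its mass in this tube is small.\<close>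
  have Jm: "\<bar>Jm\<bar> \<le> c0 * (1 + T) * \<delta>"
  proof -
    have "\<bar>J (- \<rho>) (1 - e) z - integral {-rad..rad} (\<lambda>y. 0)\<bar> \<le> 2 * rad * ((1 + T) * \<delta>)"
      unfolding J_def
    proof (rule integral_diff_bound)
      fix y assume y: "\<bar>y\<bar> \<le> rad"
      have "\<bar>w (- \<rho>) (1 - e) (z + y)\<bar> \<le> (1 + T) * \<delta>"
      proof (rule w_quiet_before[OF \<rho>2(2)])
        have cme: "cm * (1 - e) \<le> cm * 1"
          using eps cm_pos by (intro mult_left_mono) auto
        have "\<bar>z\<bar> = c0"
          using \<rho> c0_pos by (auto simp: z_def)
        then show "\<bar>z + y\<bar> + cm * (1 - e) \<le> R"
          using y rad(2) R' c0_le c0_pos cme by linarith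
        have "c0 * e \<le> c0 * (1 / 2)"
          using eps c0_pos by (intro mult_left_mono) auto
        moreover have "z + y - - \<rho> * c0 * (1 - e) = \<rho> * (2 * c0 - c0 * e) + y"
          by (simp add: z_def algebra_simps)
        moreover have "\<bar>\<rho> * r\<bar> = \<bar>r\<bar>" for r
          using \<rho> by (auto simp: abs_mult)
        note this[of "2 * c0 - c0 * e"]
        ultimately show "e < \<bar>z + y - - \<rho> * c0 * (1 - e)\<bar>"
          using y rad c0_pos by linarith
      qed (use eps in auto)
      then show "\<bar>w (- \<rho>) (1 - e) (z + y) - 0\<bar> \<le> (1 + T) * \<delta>"
        by simp
    qed (use rad(1) eps in \<open>auto intro!: continuous_on_w continuous_intros\<close>)
    also have "\<dots> \<le> c0 * ((1 + T) * \<delta>)"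
      using rad T \<delta>_pos by (intro mult_right_mono) auto
    finally show ?thesis
      by (simp add: Jp_Jm_def mult_ac)
  qed
  define a b where "a = P (1 + e) - P (1 - e)" "b = V (1 + e) - V (1 - e)"
  have ab: "\<bar>a\<bar> \<le> (2 * cm * Q + cm) * \<delta>" "\<bar>b\<bar> \<le> 2 * Q * \<delta>"
    using mom(2,3) by (simp_all add: a_b_def)
  have c: "c (1 - e) = c0" "c (1 + e) = c1"
    using c_left c_right by auto
  have "Jp = P (1 - e) - \<rho> * c0 * V (1 - e)" "Jm = P (1 - e) + \<rho> * c0 * V (1 - e)"
    using mom(1)[of "1 - e"] eps by (simp_all add: Jp_Jm_def c)
  \<comment> \<open>With \<open>Jp\<close> close to 1 and \<open>Jm\<close> close to 0,
    \<open>P\<close> is close to 1/2 and \<open>V\<close> to \<open>- \<rho> / (2 * c0)\<close>.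
    Recombining them with the speed c1 gives the mass
    \<open>(1 + s * \<rho> * c1 / c0) / 2\<close>.\<close>
  then have PV: "P (1 - e) = (Jp + Jm) / 2" "V (1 - e) = \<rho> * (Jm - Jp) / (2 * c0)"
    using c0_pos \<rho> by (auto simp: field_simps)
  define k where "k = c1 / c0"
  have k: "k > 0" "k * c0 = c1"
    using c0_pos c1_pos by (auto simp: k_def)
  have 1: "J s (1 + e) z = P (1 - e) + a - (s * c1 * V (1 - e) + s * c1 * b)"
    using mom(1)[of "1 + e" s] eps by (simp add: c a_b_def algebra_simps)
  have 2: "s * c1 * V (1 - e) = (s * \<rho>) * k * (Jm - Jp) / 2"
    using c0_pos by (simp add: PV k_def mult_ac)
  have "J s (1 + e) z = (Jp + Jm) / 2 + a - ((s * \<rho>) * k * (Jm - Jp) / 2 + s * c1 * b)"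
    unfolding 1 2 PV(1) ..
  \<comment> \<open>An exact identity that separates the limit from the four errors
    \<open>Jp - 1\<close>, \<open>Jm\<close>, \<open>a\<close> and \<open>b\<close>.\<close>
  moreover have "(Jp + Jm) / 2 + a - (q * (Jm - Jp) / 2 + s * c1 * b) - (1 + q) / 2 =
      (Jp - 1 + Jm) / 2 + q * (Jp - 1 - Jm) / 2 + a - s * c1 * b" for q
    by (simp add: diff_divide_distrib add_divide_distrib algebra_simps)
  from this[of "(s * \<rho>) * k"]
  have "(Jp + Jm) / 2 + a - ((s * \<rho>) * k * (Jm - Jp) / 2 + s * c1 * b) - (1 + (s * \<rho>) * k) / 2 =
      (Jp - 1 + Jm) / 2 + (s * \<rho>) * (k * (Jp - 1 - Jm) / 2) + a - s * (c1 * b)"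
    by (simp only: mult.assoc times_divide_eq_right)
  ultimately have eq: "J s (1 + e) z - (1 + (s * \<rho>) * k) / 2 =
      (Jp - 1 + Jm) / 2 + (s * \<rho>) * (k * (Jp - 1 - Jm) / 2) + a - s * (c1 * b)"
    by simp
  have half: "\<bar>(p + q) / 2\<bar> \<le> r" "\<bar>(p - q) / 2\<bar> \<le> r" if "\<bar>p\<bar> \<le> r" "\<bar>q\<bar> \<le> r" for p q r :: real
    using that by (auto simp: abs_le_iff field_simps)
  have sgn: "\<bar>s * r\<bar> = \<bar>r\<bar>" "\<bar>(s * \<rho>) * r\<bar> = \<bar>r\<bar>" for r
    using s \<rho> by (auto simp: abs_mult)
  have "\<bar>J s (1 + e) z - (1 + (s * \<rho>) * k) / 2\<bar> \<le>
      \<bar>(Jp - 1 + Jm) / 2\<bar> + \<bar>k * (Jp - 1 - Jm) / 2\<bar> + \<bar>a\<bar> + \<bar>c1 * b\<bar>"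
  proof -
    have tri: "\<bar>p + q + r - t\<bar> \<le> \<bar>p\<bar> + \<bar>q\<bar> + \<bar>r\<bar> + \<bar>t\<bar>" for p q r t :: real
      by linarith
    show ?thesis
      unfolding eq using tri[of "(Jp - 1 + Jm) / 2" "(s * \<rho>) * (k * (Jp - 1 - Jm) / 2)" a "s * (c1 * b)"]
      unfolding sgn .
  qed
  moreover have "\<bar>(Jp - 1 + Jm) / 2\<bar> \<le> cm * (1 + T) * \<delta>"
  proof -
    have "c0 * (1 + T) * \<delta> \<le> cm * (1 + T) * \<delta>"
      using c0_le T \<delta>_pos by (intro mult_right_mono) auto
    then show ?thesis
      using half(1)[OF Jp Jm] by (rule order_trans[rotated])
  qed
  moreover have "\<bar>k * (Jp - 1 - Jm) / 2\<bar> \<le> cm * (1 + T) * \<delta>"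
  proof -
    have "\<bar>k * ((Jp - 1 - Jm) / 2)\<bar> \<le> k * (c0 * (1 + T) * \<delta>)"
      unfolding abs_mult using half(2)[OF Jp Jm] k(1) by (intro mult_mono) auto
    also have "\<dots> = c1 * (1 + T) * \<delta>"
      using k(2) by (metis mult.assoc)
    also have "\<dots> \<le> cm * (1 + T) * \<delta>"
      using c1_le T \<delta>_pos by (intro mult_right_mono) auto
    finally show ?thesis
      by simp
  qed
  moreover have "\<bar>c1 * b\<bar> \<le> cm * (2 * Q * \<delta>)"
    unfolding abs_mult using ab(2) c1_pos c1_le cm_pos by (intro mult_mono) auto
  moreover have "cm * (2 + T) * \<delta> \<le> cm * Q * \<delta>"
    using Q(1) cm_pos \<delta>_pos by (intro mult_right_mono mult_left_mono) auto
  moreover have "0 \<le> cm * \<delta>"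
    using cm_pos \<delta>_pos by simp
  moreover have "cm * (1 + T) * \<delta> = cm * \<delta> + cm * T * \<delta>" "cm * (2 * Q * \<delta>) = 2 * (cm * Q * \<delta>)"
    "cm * (2 + T) * \<delta> = 2 * (cm * \<delta>) + cm * T * \<delta>"
    "(2 * cm * Q + cm) * \<delta> = 2 * (cm * Q * \<delta>) + cm * \<delta>"
    "7 * cm * Q * \<delta> = 7 * (cm * Q * \<delta>)" "0 \<le> cm * Q * \<delta>"
    using cm_pos \<delta>_pos Q(2) by (simp_all add: algebra_simps)
  ultimately have "\<bar>J s (1 + e) z - (1 + (s * \<rho>) * k) / 2\<bar> \<le> 7 * cm * Q * \<delta>"
    using ab(1) by linarith
  then show ?thesis
    by (simp add: z_def k_def)
qed

lemma J_after:
  assumes \<rho>: "\<rho> = 1 \<or> \<rho> = -1" and s: "s = 1 \<or> s = -1" and t: "1 + e \<le> t" "t \<le> T"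
  shows "\<bar>J s t (\<rho> * c0 + s * c1 * (t - 1 - e)) - (1 + s * \<rho> * c1 / c0) / 2\<bar> \<le> 8 * cm * Q * \<delta>"
proof -
  define z where "z = \<rho> * c0 + s * c1 * (t - 1 - e)"
  have "\<bar>J s t z - J s (1 + e) (z - s * c1 * (t - (1 + e)))\<bar> \<le> cm * T * \<delta>"
  proof (rule J_transport[OF s])
    have "\<bar>\<rho> * c0\<bar> = c0" "\<bar>s * c1 * (t - 1 - e)\<bar> = c1 * (t - (1 + e))"
      using s \<rho> c0_pos c1_pos t(1) by (auto simp: abs_mult diff_diff_eq)
    moreover have "c1 * (t - (1 + e)) \<le> cm * T" "cm * (t - (1 + e)) \<le> cm * T"
      using c1_le cm_pos t T eps by (intro mult_mono; simp)+
    moreover have "cm * (2 * T + 2) = cm * T + cm * T + 2 * cm"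
      by (simp add: algebra_simps)
    ultimately show "\<bar>z\<bar> + rad + cm * (t - (1 + e)) \<le> R"
      using R rad(2) c0_le c0_pos unfolding z_def by linarith
  qed (use t eps c_right in auto)
  moreover have "z - s * c1 * (t - (1 + e)) = \<rho> * c0"
    by (simp add: z_def algebra_simps)
  moreover have "cm * T * \<delta> \<le> cm * Q * \<delta>"
    using Q(1) cm_pos \<delta>_pos by (intro mult_right_mono mult_left_mono) auto
  ultimately show ?thesis
    using J_layer[OF \<rho> s] unfolding z_def[symmetric] by (simp add: abs_le_iff)
qed

end

section \<open>Mollifiers and peaks\<close>

lemma integral_eq_LINT_if_supported:
  fixes h :: "real \<Rightarrow> real"
  assumes "(LINT x|lborel. h x) = 1" "\<And>y. \<bar>y\<bar> > r \<Longrightarrow> h y = 0"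
  shows "integral {-r..r} h = 1"
proof -
  \<comment> \<open>The Lebesgue integral of a non-integrable function is 0 by convention, so the
    value 1 forces integrability.\<close>
  have "integrable lborel h"
    using assms(1) not_integrable_integral_eq[of lborel h] by fastforce
  then have "(h has_integral 1) UNIV"
    using has_integral_integral_lborel[of h] assms(1) by simp
  moreover have "h = (\<lambda>x. if x \<in> {-r..r} then h x else 0)"
    using assms(2) by (auto simp: fun_eq_iff abs_real_def)
  ultimately have "((\<lambda>x. if x \<in> {-r..r} then h x else 0) has_integral 1) UNIV"
    by simp
  then have "(h has_integral 1) {-r..r}"
    by (simp only: has_integral_restrict_UNIV)
  then show ?thesis
    by (rule integral_unique)
qed

locale mollifier =
  fixes \<phi> :: "real \<Rightarrow> real"
  assumes adm: "admissible_mollifier \<phi>"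
begin

lemma cont: "continuous_on S \<phi>"
  using adm continuous_on_subset[OF smooth_on_continuous_on[of UNIV \<phi>]]
  by (auto simp: admissible_mollifier_def)

text \<open>The support condition gives the open exterior of [-1, 1]; continuity adds the end
  points, and the value at -1 is the starting point of the monotonicity argument for
  \<open>nonneg\<close>.\<close>

lemma eq_0: "\<phi> x = 0" if "\<bar>x\<bar> \<ge> 1"
proof -
  have out: "\<phi> y = 0" if "\<bar>y\<bar> > 1" for y
  proof (rule ccontr)
    assume "\<phi> y \<noteq> 0"
    then have "y \<in> closure {x. \<phi> x \<noteq> 0}"
      using closure_subset[of "{x. \<phi> x \<noteq> 0}"] by auto
    moreover have "closure {x. \<phi> x \<noteq> 0} \<subseteq> {-1..1}"
      using adm by (simp add: admissible_mollifier_def)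
    ultimately have "y \<in> {-1..1}"
      by blast
    then show False
      using that by auto
  qed
  have closed: "closed {x. \<phi> x = 0}"
    by (intro closed_Collect_eq cont continuous_on_const)
  have "closure {1<..} \<subseteq> {x. \<phi> x = 0}"
    by (rule closure_minimal[OF _ closed]) (use out in auto)
  moreover have "closure {..<-1} \<subseteq> {x. \<phi> x = 0}"
    by (rule closure_minimal[OF _ closed]) (use out in auto)
  ultimately show ?thesis
    using that by (auto simp: abs_real_def split: if_splits)
qed

text \<open>On [-1, 0] the mollifier increases from the value 0, and evenness covers the other half.
  Nonnegativity makes \<open>cdf\<close> monotone, hence keeps the regularised speed between c0 and
  c1.\<close>

lemma nonneg: "\<phi> x \<ge> 0"
proof -
  have neg: "\<phi> y \<ge> 0" if "-1 \<le> y" "y \<le> 0" for y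
  proof -
    have "\<phi> (-1) \<le> \<phi> y"
    proof (rule DERIV_nonneg_imp_nondecreasing[OF that(1)])
      fix x assume "-1 \<le> x" "x \<le> y"
      moreover have "\<phi> differentiable at x"
        using adm smooth_on_imp_differentiable_at[of UNIV \<phi> x] by (simp add: admissible_mollifier_def)
      then have "(\<phi> has_real_derivative deriv \<phi> x) (at x)"
        by (metis DERIV_imp_deriv real_differentiable_def)
      ultimately show "\<exists>d. (\<phi> has_real_derivative d) (at x) \<and> 0 \<le> d"
        using adm that by (auto simp: admissible_mollifier_def intro!: exI[of _ "deriv \<phi> x"])
    qed
    then show ?thesis
      by (simp add: eq_0)
  qed
  show ?thesis
  proof (cases "\<bar>x\<bar> \<ge> 1")
    case False
    have "\<phi> (- \<bar>x\<bar>) = \<phi> x"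
      using adm by (auto simp: abs_real_def admissible_mollifier_def)
    then show ?thesis
      using neg[of "- \<bar>x\<bar>"] False by auto
  qed (simp add: eq_0)
qed

lemma LINT: "(LINT x|lborel. \<phi> x) = 1"
  using adm by (simp add: admissible_mollifier_def)

lemma bounded: obtains B where "B \<ge> 0" "\<And>x. \<phi> x \<le> B"
proof -
  have "compact (\<phi> ` {-1..1})"
    by (intro compact_continuous_image cont compact_Icc)
  then obtain B where B: "\<forall>y \<in> \<phi> ` {-1..1}. norm y \<le> B"
    using compact_imp_bounded bounded_iff by blast
  have B': "\<phi> x \<le> \<bar>B\<bar>" for x
  proof (cases "\<bar>x\<bar> \<ge> 1")
    case False
    then have "x \<in> {-1..1}"
      by auto
    then have "norm (\<phi> x) \<le> B"
      using B by blast
    then show ?thesis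
      by simp
  qed (simp add: eq_0)
  show thesis
    by (rule that[OF abs_ge_zero B'])
qed

lemma scaled_eq_0:
  assumes "e > 0" "\<bar>x\<bar> > e"
  shows "scaled \<phi> e x = 0"
proof -
  have "\<bar>x / e\<bar> \<ge> 1"
    using assms by simp
  then show ?thesis
    by (simp add: scaled_def eq_0)
qed

lemma continuous_on_scaled: "continuous_on S (scaled \<phi> e)"
proof -
  have "continuous_on S (\<lambda>x. \<phi> (x * inverse e) * inverse e)"
    by (intro continuous_intros continuous_on_compose2[OF cont[of UNIV]]) auto
  then show ?thesis
    by (simp add: scaled_def[abs_def] divide_inverse)
qed

lemma integral_scaled:
  assumes "e > 0" "\<bar>z\<bar> + e \<le> r"
  shows "integral {-r..r} (\<lambda>y. scaled \<phi> e (z + y)) = 1"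
proof (rule integral_eq_LINT_if_supported)
  show "(LINT y|lborel. scaled \<phi> e (z + y)) = 1"
    using lborel_integral_real_affine[of e "\<lambda>y. scaled \<phi> e (z + y)" "- z"] assms(1) LINT
    by (simp add: scaled_def)
  show "scaled \<phi> e (z + y) = 0" if "\<bar>y\<bar> > r" for y
    using that assms by (intro scaled_eq_0) auto
qed

definition cdf :: "real \<Rightarrow> real" where
  "cdf \<tau> = (LINT s|lborel. heaviside (\<tau> - s) * \<phi> s)"

lemma cdf_left: "\<tau> \<le> -1 \<Longrightarrow> cdf \<tau> = 0"
proof -
  assume "\<tau> \<le> -1"
  then have "heaviside (\<tau> - s) * \<phi> s = 0" for s
    using eq_0[of s] by (cases "s \<le> \<tau>") (auto simp: heaviside_def)
  then show ?thesis
    unfolding cdf_def by (simp only: Bochner_Integration.integral_zero)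
qed

lemma cdf_right: "1 \<le> \<tau> \<Longrightarrow> cdf \<tau> = 1"
proof -
  assume "1 \<le> \<tau>"
  then have "heaviside (\<tau> - s) * \<phi> s = \<phi> s" for s
    using eq_0[of s] by (cases "s \<le> \<tau>") (auto simp: heaviside_def)
  then show ?thesis
    unfolding cdf_def by (simp only: LINT)
qed

lemma cdf_eq_integral:
  assumes "b \<le> -1"
  shows "cdf \<tau> = integral {b..\<tau>} \<phi>"
proof -
  have "heaviside (\<tau> - s) * \<phi> s = indicator {b..\<tau>} s *\<^sub>R \<phi> s" for s
    using eq_0[of s] assms by (auto simp: heaviside_def indicator_def)
  then have "cdf \<tau> = (LINT s:{b..\<tau>}|lborel. \<phi> s)"
    unfolding cdf_def set_lebesgue_integral_def by (simp only:)
  also have "\<dots> = integral {b..\<tau>} \<phi>"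
    by (intro set_borel_integral_eq_integral borel_integrable_atLeastAtMost' cont)
  finally show ?thesis .
qed

lemma cdf_deriv: "(cdf has_real_derivative \<phi> \<tau>) (at \<tau>)"
proof -
  \<comment> \<open>A lower limit below both -1 and \<open>\<tau>\<close> makes
    \<open>\<tau>\<close> an interior point and catches the whole support.\<close>
  define b where "b = min (-1) \<tau> - 1"
  have "((\<lambda>\<tau>. integral {b..\<tau>} \<phi>) has_real_derivative \<phi> \<tau>) (at \<tau> within {b..\<tau> + 1})"
    by (intro integral_has_real_derivative cont) (auto simp: b_def)
  then have "((\<lambda>\<tau>. integral {b..\<tau>} \<phi>) has_real_derivative \<phi> \<tau>) (at \<tau>)"
    using at_within_Icc_at[of b \<tau> "\<tau> + 1"] by (simp add: b_def)
  moreover have "cdf = (\<lambda>\<tau>. integral {b..\<tau>} \<phi>)"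
    by (intro ext cdf_eq_integral) (simp add: b_def)
  ultimately show ?thesis
    by simp
qed

lemma cdf_bounds: "0 \<le> cdf \<tau>" "cdf \<tau> \<le> 1"
proof -
  have mono: "cdf x \<le> cdf y" if "x \<le> y" for x y
    using that by (rule DERIV_nonneg_imp_nondecreasing) (use cdf_deriv nonneg in blast)
  show "0 \<le> cdf \<tau>"
    using mono[of "min \<tau> (-1)" \<tau>] by (simp add: cdf_left)
  show "cdf \<tau> \<le> 1"
    using mono[of \<tau> "max \<tau> 1"] by (simp add: cdf_right)
qed

lemma convol_eq_cdf:
  assumes "e > 0"
  shows "convol (jump_coeff c0 c1) (scaled \<phi> e) t = c0 + (c1 - c0) * cdf ((t - 1) / e)"
proof -
  have "heaviside (t - 1 - e * s) = heaviside ((t - 1) / e - s)" for s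
    using assms by (simp add: heaviside_def field_simps)
  then show ?thesis
    using convol_jump_coeff[OF adm assms, of c0 c1 t] by (simp add: cdf_def)
qed

end

section \<open>Peaks and finite differences\<close>

text \<open>
  The \<open>m\<close>-th backward difference of \<open>F 0\<close> with step \<open>h\<close> is at most \<open>h ^ m * A\<close>, and all its terms
  other than \<open>F 0 x\<close> are bounded by \<open>b\<close>.
\<close>

lemma bound_from_backward_differences:
  fixes F :: "nat \<Rightarrow> real \<Rightarrow> real"
  assumes "h > 0" "\<And>k y. (F k has_real_derivative F (Suc k) y) (at y)"
    and "\<And>y. x - m * h \<le> y \<Longrightarrow> y \<le> x \<Longrightarrow> \<bar>F m y\<bar> \<le> A"
    and "\<And>i. 1 \<le> i \<Longrightarrow> i \<le> m \<Longrightarrow> \<bar>F 0 (x - real i * h)\<bar> \<le> b" and "b \<ge> 0"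
  shows "\<bar>F 0 x\<bar> \<le> h ^ m * A + 3 ^ m * b"
  using assms
proof (induction m arbitrary: F A b)
  case 0
  then show ?case by simp
next
  case (Suc m)
  \<comment> \<open>The induction hypothesis is applied to the backward difference at the same
    point: its derivative bound is \<open>A * h\<close> and its values at the earlier nodes are at
    most \<open>2 * b\<close>. Adding \<open>F 0 (x - h)\<close> back gives the factor 2 * 3^m + 1
    \<le> 3^(m+1).\<close>
  define G where "G k y = F k y - F k (y - h)" for k y
  have "\<bar>G 0 x\<bar> \<le> h ^ m * (A * h) + 3 ^ m * (2 * b)"
  proof (rule Suc.IH[OF Suc.prems(1)])
    show "(G k has_real_derivative G (Suc k) y) (at y)" for k y
    proof -
      have "((\<lambda>y. F k (y - h)) has_real_derivative F (Suc k) (y - h)) (at y)"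
        using DERIV_shift[of "F k" "F (Suc k) (y - h)" y "- h"] Suc.prems(2)[of k "y - h"] by simp
      then show ?thesis
        unfolding G_def by (intro DERIV_diff Suc.prems(2))
    qed
    show "\<bar>G m y\<bar> \<le> A * h" if "x - real m * h \<le> y" "y \<le> x" for y
    proof -
      have "norm (F m y - F m (y - h)) \<le> A * norm (y - (y - h))"
      proof (rule field_differentiable_bound[of "{y - h..y}" "F m" "F (Suc m)"])
        show "(F m has_real_derivative F (Suc m) z) (at z within {y - h..y})" for z
          by (rule has_field_derivative_at_within[OF Suc.prems(2)])
        show "norm (F (Suc m) z) \<le> A" if z: "z \<in> {y - h..y}" for z
          using Suc.prems(3)[of z] z \<open>x - real m * h \<le> y\<close> \<open>y \<le> x\<close> by (auto simp: algebra_simps)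
      qed (use Suc.prems(1) in auto)
      then show ?thesis
        using Suc.prems(1) by (simp add: G_def)
    qed
    show "\<bar>G 0 (x - real i * h)\<bar> \<le> 2 * b" if "1 \<le> i" "i \<le> m" for i
    proof -
      have *: "x - real i * h - h = x - real (Suc i) * h"
        by (simp add: algebra_simps)
      show ?thesis
        using Suc.prems(4)[of i] Suc.prems(4)[of "Suc i"] that unfolding G_def * by linarith
    qed
  qed (use Suc.prems in auto)
  moreover have "\<bar>F 0 (x - h)\<bar> \<le> b"
    using Suc.prems(4)[of 1] by simp
  moreover have "1 * b \<le> 3 ^ m * b"
    using Suc.prems(5) by (intro mult_right_mono) auto
  ultimately show ?case
    unfolding G_def by (simp add: algebra_simps)
qed

text \<open>With step \<open>3 * (\<kappa> * e)\<close> every backward node of a point of the peak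
  lies outside the peak. Taking the order of the difference at least p bounds the height by a
  constant, and a bounded peak on a width of \<open>2 * \<kappa> * e\<close> has mass O(e).\<close>

lemma no_regular_peak:
  fixes F :: "real \<Rightarrow> nat \<Rightarrow> real \<Rightarrow> real" and z :: "real \<Rightarrow> real"
  assumes F: "\<forall>\<^sub>F e in at_right 0. \<forall>k y. (F e k has_real_derivative F e (Suc k) y) (at y)"
    and "\<kappa> > 0" "d > 0" "p \<ge> 0" "B \<ge> 0"
    and out: "\<forall>\<^sub>F e in at_right 0. \<forall>y. \<kappa> * e < \<bar>y\<bar> \<and> \<bar>y\<bar> \<le> d \<longrightarrow> \<bar>F e 0 (z e + y)\<bar> \<le> B * e"
    and mass: "\<forall>\<^sub>F e in at_right 0. \<bar>integral {-(\<kappa> * e)..\<kappa> * e} (\<lambda>y. F e 0 (z e + y)) - J\<bar> \<le> B * e"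
    and reg: "\<And>k. \<exists>M\<ge>0. \<forall>\<^sub>F e in at_right 0. \<forall>y. \<bar>y\<bar> \<le> d \<longrightarrow> \<bar>F e k (z e + y)\<bar> \<le> M * e powr (- p)"
  shows "J = 0"
proof -
  define m where "m = nat \<lceil>p\<rceil>"
  have m: "p \<le> real m"
    by (simp add: m_def real_nat_ceiling_ge)
  obtain M where M: "M \<ge> 0"
    "\<forall>\<^sub>F e in at_right 0. \<forall>y. \<bar>y\<bar> \<le> d \<longrightarrow> \<bar>F e m (z e + y)\<bar> \<le> M * e powr (- p)"
    using reg by blast
  define C where "C = 2 * \<kappa> * ((3 * \<kappa>) ^ m * M + 3 ^ m * B) + B"
  \<comment> \<open>For \<open>e\<close> below this threshold, \<open>m\<close> steps of length
    \<open>3 * (\<kappa> * e)\<close> from any point of the peak stay within distance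
    \<open>d\<close> of \<open>z e\<close>.\<close>
  have "d / ((3 * real m + 1) * \<kappa>) > 0"
    using assms(2,3) by simp
  from F out mass M(2) eventually_small[of 1, simplified] eventually_small[OF this]
  have "\<forall>\<^sub>F e in at_right 0. \<bar>J\<bar> \<le> C * e"
  proof eventually_elim
    case (elim e)
    have "0 < (3 * real m + 1) * \<kappa>"
      using assms(2) by simp
    then have e: "0 < e" "e < 1" "(3 * real m + 1) * \<kappa> * e < d"
      using elim(5,6) by (auto simp only: pos_less_divide_eq mult_ac)
    have ke: "0 < \<kappa> * e"
      using assms(2) e(1) by simp
    have peak: "\<bar>F e 0 (z e + y)\<bar> \<le> (3 * \<kappa>) ^ m * M + 3 ^ m * B" if y: "\<bar>y\<bar> \<le> \<kappa> * e" for y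
    proof -
      have i: "\<bar>y - real i * (3 * (\<kappa> * e))\<bar> \<le> d" if "i \<le> m" for i
      proof -
        have "real i * (3 * (\<kappa> * e)) \<le> real m * (3 * (\<kappa> * e))"
          using that ke by (intro mult_right_mono) auto
        moreover have "real m * (3 * (\<kappa> * e)) + \<kappa> * e < d"
          using e(3) by (simp add: algebra_simps)
        moreover have "0 \<le> real i * (3 * (\<kappa> * e))"
          using ke by simp
        ultimately show ?thesis
          using y by linarith
      qed
      have "\<bar>F e 0 (z e + y)\<bar> \<le> (3 * (\<kappa> * e)) ^ m * (M * e powr (- p)) + 3 ^ m * (B * e)"
      proof (rule bound_from_backward_differences[where F = "F e" and m = m])
        show "(F e k has_real_derivative F e (Suc k) y) (at y)" for k y
          using elim(1) by blast
        show "\<bar>F e m y'\<bar> \<le> M * e powr (- p)"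
          if "z e + y - real m * (3 * (\<kappa> * e)) \<le> y'" "y' \<le> z e + y" for y'
        proof -
          have "\<bar>y' - z e\<bar> \<le> d"
            using that i[of m] i[of 0] by auto
          then show ?thesis
            using spec[OF elim(4), of "y' - z e"] by simp
        qed
        show "\<bar>F e 0 (z e + y - real i * (3 * (\<kappa> * e)))\<bar> \<le> B * e" if "1 \<le> i" "i \<le> m" for i
        proof -
          have "1 * (3 * (\<kappa> * e)) \<le> real i * (3 * (\<kappa> * e))"
            using that ke by (intro mult_right_mono) auto
          then have "\<kappa> * e < \<bar>y - real i * (3 * (\<kappa> * e))\<bar>"
            using y ke by linarith
          then show ?thesis
            using spec[OF elim(2), of "y - real i * (3 * (\<kappa> * e))"] i[OF that(2)] by (simp add: algebra_simps)
        qed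
      qed (use ke assms(5) e in auto)
      also have "(3 * (\<kappa> * e)) ^ m * (M * e powr (- p)) = (3 * \<kappa>) ^ m * M * (e ^ m * e powr (- p))"
        by (simp add: power_mult_distrib mult_ac)
      also have "e ^ m * e powr (- p) \<le> 1"
      proof -
        have "e ^ m * e powr (- p) = e powr (real m + - p)"
          unfolding powr_add using e(1) by (simp add: powr_realpow)
        also have "\<dots> \<le> e powr 0"
          using m e by (intro powr_mono') auto
        finally show ?thesis
          using e(1) by simp
      qed
      also have "B * e \<le> B"
        using mult_left_mono[of e 1 B] e assms(5) by simp
      finally show ?thesis
        using M(1) assms(2) by (simp add: mult_left_mono)
    qed
    have "continuous_on {-(\<kappa> * e)..\<kappa> * e} (\<lambda>y. F e 0 (z e + y))"
    proof -
      have "continuous_on UNIV (F e 0)"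
        using elim(1) DERIV_isCont by (intro continuous_at_imp_continuous_on) blast
      then show ?thesis
        by (rule continuous_on_compose2) (auto intro!: continuous_intros)
    qed
    then have "norm (integral {-(\<kappa> * e)..\<kappa> * e} (\<lambda>y. F e 0 (z e + y))) \<le>
        ((3 * \<kappa>) ^ m * M + 3 ^ m * B) * (\<kappa> * e - - (\<kappa> * e))"
      by (intro integral_bound) (use peak ke in \<open>auto simp: abs_le_iff\<close>)
    then show ?case
      using elim(3) unfolding C_def by (simp add: algebra_simps abs_le_iff)
  qed
  moreover have "((\<lambda>e. C * e) \<longlongrightarrow> C * 0) (at_right 0)"
    by (intro tendsto_intros)
  ultimately have "\<bar>J\<bar> \<le> C * 0"
    by (intro tendsto_lowerbound[of "\<lambda>e. C * e"]) auto
  then show ?thesis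
    by simp
qed

section \<open>Regularity off the rays and irregularity on them\<close>

text \<open>The absolute value around \<open>c0 - c1 * (t - 1)\<close> is there because the
  reflected rays change sides at x = 0, at time 1 + c0 / c1.\<close>

definition rays :: "real \<Rightarrow> real \<Rightarrow> (real \<times> real) set" where
  "rays c0 c1 = {(t, x). 0 \<le> t \<and> t \<le> 1 \<and> \<bar>x\<bar> = c0 * t} \<union>
    {(t, x). 1 \<le> t \<and> (\<bar>x\<bar> = c0 + c1 * (t - 1) \<or> \<bar>x\<bar> = \<bar>c0 - c1 * (t - 1)\<bar>)}"

lemma closed_rays: "closed (rays c0 c1)"
  unfolding rays_def case_prod_unfold
  by (intro closed_Un closed_Collect_conj closed_Collect_disj closed_Collect_le closed_Collect_eq continuous_intros)

lemma rays_before: "s = 1 \<or> s = -1 \<Longrightarrow> c0 > 0 \<Longrightarrow> 0 \<le> t \<Longrightarrow> t \<le> 1 \<Longrightarrow> (t, s * c0 * t) \<in> rays c0 c1"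
  by (auto simp: rays_def abs_mult)

lemma rays_after:
  assumes "\<rho> = 1 \<or> \<rho> = -1" "s = 1 \<or> s = -1" "c0 > 0" "c1 > 0" "1 \<le> t"
  shows "(t, \<rho> * c0 + s * c1 * (t - 1)) \<in> rays c0 c1"
proof -
  have "0 \<le> c1 * (t - 1)"
    using assms by simp
  then have "\<bar>\<rho> * c0 + s * (c1 * (t - 1))\<bar> = c0 + c1 * (t - 1) \<or>
      \<bar>\<rho> * c0 + s * (c1 * (t - 1))\<bar> = \<bar>c0 - c1 * (t - 1)\<bar>"
    using assms(1-3) by (elim disjE; simp; linarith)
  then show ?thesis
    using assms(5) by (simp add: rays_def mult.assoc)
qed

lemma rays_cases:
  assumes "(t, x) \<in> rays c0 c1" "c0 > 0" "c1 > 0"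
  obtains (before) s where "s = 1 \<or> s = -1" "0 \<le> t" "t < 1" "x = s * c0 * t"
    | (after) \<rho> s where "\<rho> = 1 \<or> \<rho> = -1" "s = 1 \<or> s = -1" "1 \<le> t" "x = \<rho> * c0 + s * c1 * (t - 1)"
proof (cases "t < 1")
  case True
  then have "0 \<le> t" "\<bar>x\<bar> = c0 * t"
    using assms(1) by (auto simp: rays_def)
  then have "x = 1 * c0 * t \<or> x = -1 * c0 * t"
    by (auto simp: abs_real_def split: if_splits)
  then show thesis
    using before True \<open>0 \<le> t\<close> by blast
next
  case False
  then have "\<bar>x\<bar> = c0 + c1 * (t - 1) \<or> \<bar>x\<bar> = \<bar>c0 - c1 * (t - 1)\<bar>"
    using assms(1) by (auto simp: rays_def)
  then have "x = 1 * c0 + 1 * c1 * (t - 1) \<or> x = -1 * c0 + -1 * c1 * (t - 1) \<or>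
      x = 1 * c0 + -1 * c1 * (t - 1) \<or> x = -1 * c0 + 1 * c1 * (t - 1)"
    by (auto simp: abs_real_def split: if_splits)
  then show thesis
    using after False by (metis not_less)
qed

lemma dist_plane_le: "dist (t, x) (t', x') \<le> \<bar>t - t'\<bar> + \<bar>x - x'\<bar>" for t x t' x' :: real
  using sqrt_sum_squares_le_sum_abs[of "t - t'" "x - x'"] by (simp add: dist_Pair_Pair dist_real_def)

text \<open>The Cauchy problem restated as bounds on values of one representative. The zero initial
  value enters through its x-derivative, which is the form in which the Riemann invariants see
  it.\<close>

locale wave_problem = \<phi>: mollifier \<phi> + \<psi>: mollifier \<psi> for \<phi> \<psi> :: "real \<Rightarrow> real" +
  fixes c0 c1 :: real and u :: "real \<Rightarrow> real \<times> real \<Rightarrow> real"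
  assumes pos: "c0 > 0" "c1 > 0" and neq: "c0 \<noteq> c1"
    and mod: "u \<in> moderate half_plane"
    and equation: "compact K \<Longrightarrow> K \<subseteq> half_plane \<Longrightarrow>
      negligible_on K (\<lambda>e z. Dt (Dt (u e)) z -
        (c0 + (c1 - c0) * \<phi>.cdf ((fst z - 1) / e)) * (c0 + (c1 - c0) * \<phi>.cdf ((fst z - 1) / e)) *
          Dx (Dx (u e)) z)"
    and init_x: "compact K' \<Longrightarrow> negligible_on K' (\<lambda>e x. Dx (u e) (0, x))"
    and init_t: "compact K' \<Longrightarrow>
      negligible_on K' (\<lambda>e x. Dt (u e) (0, x) - scaled \<psi> e x)"
begin

definition ce :: "real \<Rightarrow> real \<Rightarrow> real" where
  "ce e t = c0 + (c1 - c0) * \<phi>.cdf ((t - 1) / e)"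

definition ce' :: "real \<Rightarrow> real \<Rightarrow> real" where
  "ce' e t = (c1 - c0) * (\<phi> ((t - 1) / e) / e)"

definition cm :: real where "cm = max c0 c1"

abbreviation "Ut e \<equiv> Dt (u e)"
abbreviation "Ux e \<equiv> Dx (u e)"

text \<open>The invariant \<open>w\<close> of \<open>wave_strip\<close> with the regularisation
  parameter made explicit, so that statements can range over \<open>e\<close>.\<close>

definition ww :: "real \<Rightarrow> real \<Rightarrow> real \<Rightarrow> real \<Rightarrow> real" where
  "ww e s t x = Ut e (t, x) - s * ce e t * Ux e (t, x)"

lemma cm: "c0 \<le> cm" "c1 \<le> cm" "0 < cm"
  using pos by (auto simp: cm_def)

lemma ce_bounds: "min c0 c1 \<le> ce e t" "ce e t \<le> cm"
proof -
  define p where "p = \<phi>.cdf ((t - 1) / e)"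
  have p: "0 \<le> p" "p \<le> 1"
    using \<phi>.cdf_bounds by (auto simp: p_def)
  have ce: "ce e t = (1 - p) * c0 + p * c1"
    by (simp add: ce_def p_def algebra_simps)
  show "min c0 c1 \<le> ce e t"
    unfolding ce using convex_bound_le[of "- c0" "- min c0 c1" "- c1" "1 - p" p] p by simp
  show "ce e t \<le> cm"
    unfolding ce cm_def using convex_bound_le[of c0 "max c0 c1" c1 "1 - p" p] p by simp
qed

lemma ce_pos: "0 < ce e t"
  using ce_bounds(1)[of e t] pos by simp

lemma ce_deriv: "e > 0 \<Longrightarrow> (ce e has_real_derivative ce' e t) (at t)"
proof -
  assume "e > 0"
  have "((\<lambda>t. \<phi>.cdf ((t - 1) / e)) has_real_derivative \<phi> ((t - 1) / e) * (1 / e)) (at t)"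
    by (rule DERIV_chain2[OF \<phi>.cdf_deriv]) (use \<open>e > 0\<close> in \<open>auto intro!: derivative_eq_intros\<close>)
  then have "((\<lambda>t. c0 + (c1 - c0) * \<phi>.cdf ((t - 1) / e)) has_real_derivative
      0 + (c1 - c0) * (\<phi> ((t - 1) / e) * (1 / e))) (at t)"
    by (intro DERIV_add DERIV_const DERIV_cmult)
  then show ?thesis
    by (simp add: ce_def[abs_def] ce'_def)
qed

lemma ce_left: "e > 0 \<Longrightarrow> t \<le> 1 - e \<Longrightarrow> ce e t = c0"
  using \<phi>.cdf_left[of "(t - 1) / e"] by (simp add: ce_def pos_divide_le_eq)

lemma ce_right: "e > 0 \<Longrightarrow> 1 + e \<le> t \<Longrightarrow> ce e t = c1"
  using \<phi>.cdf_right[of "(t - 1) / e"] by (simp add: ce_def pos_le_divide_eq)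

lemma ce'_bound: obtains Ka where "Ka \<ge> 0" "\<And>e t. e > 0 \<Longrightarrow> \<bar>ce' e t\<bar> \<le> Ka / e * ce e t"
proof -
  obtain B where B: "B \<ge> 0" "\<And>x. \<phi> x \<le> B"
    using \<phi>.bounded by blast
  define Ka where "Ka = \<bar>c1 - c0\<bar> * B / min c0 c1"
  have min: "min c0 c1 > 0"
    using pos by simp
  have "\<bar>ce' e t\<bar> \<le> Ka / e * ce e t" if "e > 0" for e t
  proof -
    have "\<bar>ce' e t\<bar> = \<bar>c1 - c0\<bar> * (\<phi> ((t - 1) / e) / e)"
      using that \<phi>.nonneg by (simp add: ce'_def abs_mult)
    also have "\<dots> \<le> \<bar>c1 - c0\<bar> * (B / e)"
      using that B by (intro mult_left_mono divide_right_mono) auto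
    also have "\<dots> = Ka / e * min c0 c1"
    proof -
      have "Ka * min c0 c1 = \<bar>c1 - c0\<bar> * B"
        unfolding Ka_def using min by (metis less_numeral_extra(3) nonzero_eq_divide_eq)
      then show ?thesis
        by (simp only: times_divide_eq_left times_divide_eq_right)
    qed
    also have "\<dots> \<le> Ka / e * ce e t"
      using that B min by (intro mult_left_mono ce_bounds) (simp add: Ka_def)
    finally show ?thesis .
  qed
  moreover have "Ka \<ge> 0"
    using B min by (simp add: Ka_def)
  ultimately show thesis
    using that by blast
qed

lemma smooth_u: "0 < e \<Longrightarrow> e < 1 \<Longrightarrow> smooth_on half_plane (u e)"
  using moderateD(1)[OF mod] by (simp add: smooth_family_def)

abbreviation layer :: "real \<Rightarrow> real \<Rightarrow> real \<Rightarrow> real \<Rightarrow> real \<Rightarrow> bool" where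
  "layer T R \<delta> Ka e \<equiv> wave_layer (u e) (ce e) (ce' e) cm T R \<delta> c0 c1 e Ka (scaled \<psi> e)"

text \<open>The bridge from asymptotics to fixed parameters: negligibility of order \<open>q\<close>
  makes the residual and the initial deviations at most \<open>M * e powr q\<close>, and the
  fixed-parameter estimates then apply to all small \<open>e\<close>.\<close>

lemma eventually_layer:
  assumes "T \<ge> 2" "cm * (2 * T + 2) + c0 \<le> R" "q \<ge> 0"
    and Ka: "Ka \<ge> 0" "\<And>e t. e > 0 \<Longrightarrow> \<bar>ce' e t\<bar> \<le> Ka / e * ce e t"
  shows "\<exists>M>0. \<forall>\<^sub>F e in at_right 0. layer T R (M * e powr q) Ka e"
proof -
  define K where "K = {0..T} \<times> {-R..R}"
  have K: "compact K" "K \<subseteq> half_plane"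
    by (auto simp: K_def half_plane_def intro!: compact_Times)
  obtain M1 where M1: "M1 \<ge> 0" "\<forall>\<^sub>F e in at_right 0. \<forall>z\<in>K. \<bar>Dt (Ut e) z -
        (c0 + (c1 - c0) * \<phi>.cdf ((fst z - 1) / e)) * (c0 + (c1 - c0) * \<phi>.cdf ((fst z - 1) / e)) *
          Dx (Ux e) z\<bar> \<le> M1 * e powr q"
    using negligible_onD[OF equation[OF K] assms(3)] .
  obtain M2 where M2: "M2 \<ge> 0" "\<forall>\<^sub>F e in at_right 0. \<forall>x\<in>{-R..R}. \<bar>Ux e (0, x)\<bar> \<le> M2 * e powr q"
    using negligible_onD[OF init_x[OF compact_Icc] assms(3)] .
  obtain M3 where M3: "M3 \<ge> 0"
    "\<forall>\<^sub>F e in at_right 0. \<forall>x\<in>{-R..R}. \<bar>Ut e (0, x) - scaled \<psi> e x\<bar> \<le> M3 * e powr q"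
    using negligible_onD[OF init_t[OF compact_Icc] assms(3)] .
  \<comment> \<open>\<open>cm * M2 + M3\<close> bounds the initial deviation of the invariants from
    \<open>scaled \<psi> e\<close>; the summand 1 makes the source bound strictly positive, as
    \<open>wave_strip\<close> demands.\<close>
  define M where "M = M1 + cm * M2 + M3 + 1"
  have M: "M > 0" "M1 \<le> M" "cm * M2 + M3 \<le> M"
    using M1(1) M2(1) M3(1) cm(3) by (auto simp: M_def add_nonneg_pos)
  have "c0 / (4 * (1 + 3 * cm)) > 0"
    using pos cm(3) by simp
  from M1(2) M2(2) M3(2) eventually_small[of "1/2", simplified] eventually_small[OF this]
  have "\<forall>\<^sub>F e in at_right 0. layer T R (M * e powr q) Ka e"
  proof eventually_elim
    case (elim e)
    have e: "0 < e" "e < 1 / 2"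
      using elim by auto
    have mono: "B * e powr q \<le> M * e powr q" if "B \<le> M" for B
      using that by (intro mult_right_mono) auto
    interpret wave_strip "u e" "ce e" "ce' e" cm T R "M * e powr q"
    proof
      show "\<bar>Dt (Ut e) (t, x) -
          ce e t * ce e t * Dx (Ux e) (t, x)\<bar> \<le> M * e powr q"
        if "0 \<le> t" "t \<le> T" "\<bar>x\<bar> \<le> R" for t x
        using bspec[OF elim(1), of "(t, x)"] that mono[OF M(2)] by (auto simp: K_def ce_def abs_le_iff)
    qed (use e M ce_deriv ce_pos ce_bounds smooth_u in auto)
    show ?case
    proof
      show "4 * (1 + 3 * cm) * e \<le> c0"
        using elim(5) cm(3) by (simp add: pos_less_divide_eq mult.commute)
      show "\<bar>w s 0 x - scaled \<psi> e x\<bar> \<le> M * e powr q" if s: "s = 1 \<or> s = -1" and x: "\<bar>x\<bar> \<le> R" for s x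
      proof -
        have x': "x \<in> {-R..R}"
          using x by auto
        have "\<bar>s * ce e 0 * Ux e (0, x)\<bar> = ce e 0 * \<bar>Ux e (0, x)\<bar>"
          using s ce_pos[of e 0] by (auto simp: abs_mult)
        also have "\<dots> \<le> cm * (M2 * e powr q)"
          using bspec[OF elim(2) x'] ce_bounds[of e 0] cm(3) by (intro mult_mono) auto
        finally have 1: "\<bar>s * ce e 0 * Ux e (0, x)\<bar> \<le> cm * (M2 * e powr q)" .
        have "\<bar>(Ut e (0, x) - scaled \<psi> e x) - s * ce e 0 * Ux e (0, x)\<bar> \<le> M3 * e powr q + cm * (M2 * e powr q)"
          using bspec[OF elim(3) x'] 1 by linarith
        also have "\<dots> = (cm * M2 + M3) * e powr q"
          by (simp add: algebra_simps)
        also have "\<dots> \<le> M * e powr q"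
          by (rule mono[OF M(3)])
        finally show ?thesis
          by (simp add: w_def algebra_simps)
      qed
    qed (use e assms Ka ce_left ce_right \<psi>.scaled_eq_0 \<psi>.continuous_on_scaled \<psi>.integral_scaled in auto)
  qed
  then show ?thesis
    using M(1) by blast
qed

text \<open>Merges the times before, in and after the layer under the largest of the three
  constants.\<close>

lemma layer_quiet:
  assumes "layer T R \<delta> Ka e" and s: "s = 1 \<or> s = -1" and t: "0 \<le> t" "t \<le> T" and x: "\<bar>x\<bar> + cm * t \<le> R"
    and "t \<le> 1 - e \<Longrightarrow> \<bar>x - s * c0 * t\<bar> > e"
    and "1 - e \<le> t \<Longrightarrow> t \<le> 1 + e \<Longrightarrow> \<bar>\<bar>x\<bar> - c0\<bar> > (1 + 3 * cm) * e"
    and "1 + e \<le> t \<Longrightarrow> \<bar>\<bar>x - s * c1 * (t - 1 - e)\<bar> - c0\<bar> > (1 + 3 * cm) * e"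
  shows "\<bar>ww e s t x\<bar> \<le> 2 * ((2 + T) * exp (2 * Ka + 2)) * \<delta>"
proof -
  interpret wave_layer "u e" "ce e" "ce' e" cm T R \<delta> c0 c1 e Ka "scaled \<psi> e"
    by (rule assms(1))
  have *: "(1 + T) * \<delta> \<le> 2 * Q * \<delta>" "Q * \<delta> \<le> 2 * Q * \<delta>"
    using Q T \<delta>_pos by (auto intro!: mult_right_mono)
  have "\<bar>w s t x\<bar> \<le> 2 * Q * \<delta>"
  proof -
    consider "t \<le> 1 - e" | "1 - e \<le> t" "t \<le> 1 + e" | "1 + e \<le> t"
      by linarith
    then show ?thesis
    proof cases
      case 1
      then show ?thesis
        using w_quiet_before[OF s t(1) 1 x assms(6)[OF 1]] * by linarith
    next
      case 2
      have "L * e < \<bar>\<bar>x\<bar> - c0\<bar>"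
        using assms(7)[OF 2] by (simp add: L_def)
      then show ?thesis
        using w_quiet_layer[OF s 2 x] * by linarith
    next
      case 3
      have "L * e < \<bar>\<bar>x - s * c1 * (t - 1 - e)\<bar> - c0\<bar>"
        using assms(8)[OF 3] by (simp add: L_def)
      then show ?thesis
        using w_quiet_after[OF s 3 t(2) x] by blast
    qed
  qed
  then show ?thesis
    by (simp add: w_def ww_def Q_def)
qed

lemma ut_ww: "Ut e (t, x) = (ww e 1 t x + ww e (-1) t x) / 2"
  by (simp add: ww_def)

lemma ux_ww: "s = 1 \<or> s = -1 \<Longrightarrow> Ux e (t, x) = (ww e (-s) t x - ww e s t x) / (2 * s * ce e t)"
  using ce_pos[of e t] by (auto simp: ww_def)

text \<open>The rays are closed, so a compact set off them keeps a fixed distance \<open>d\<close>;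
  for small \<open>e\<close> it therefore lies outside all tubes, whose width is O(e).\<close>

lemma negligible_off_rays:
  assumes K: "compact K" "K \<subseteq> half_plane - rays c0 c1" and b: "b \<in> Basis"
  shows "negligible_on K (\<lambda>e. partial_on half_plane b (u e))"
  unfolding negligible_on_def
proof (intro allI impI)
  fix q :: real assume q: "q \<ge> 0"
  obtain B where B: "\<And>z. z \<in> K \<Longrightarrow> norm z \<le> B"
    using compact_imp_bounded[OF K(1)] unfolding bounded_iff by blast
  obtain d where d: "d > 0" "\<And>z y. z \<in> K \<Longrightarrow> y \<in> rays c0 c1 \<Longrightarrow> d \<le> dist z y"
    using separate_compact_closed[OF K(1) closed_rays, of c0 c1] K(2) by blast
  obtain Ka where Ka: "Ka \<ge> 0" "\<And>e t. e > 0 \<Longrightarrow> \<bar>ce' e t\<bar> \<le> Ka / e * ce e t"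
    using ce'_bound by blast
  define T where "T = max 2 B"
  define R where "R = cm * (2 * T + 2) + c0 + \<bar>B\<bar>"
  define Qc where "Qc = 2 * ((2 + T) * exp (2 * Ka + 2))"
  obtain M where M: "M > 0" "\<forall>\<^sub>F e in at_right 0. layer T R (M * e powr q) Ka e"
    using eventually_layer[OF _ _ q Ka, of T R] by (auto simp: T_def R_def)
  \<comment> \<open>\<open>(3 + 4 * cm) * e < d\<close> covers all three regimes: they need
    \<open>e\<close> before the layer, \<open>(2 + 3 * cm) * e\<close> inside it, where the
    comparison points are (1, c0) and (1, -c0), and \<open>(1 + 4 * cm) * e\<close> after
    it.\<close>
  have "d / (3 + 4 * cm) > 0"
    using d(1) cm(3) by simp
  from M(2) eventually_small[OF this]
  have "\<forall>\<^sub>F e in at_right 0. \<forall>z\<in>K. \<bar>partial_on half_plane b (u e) z\<bar> \<le> ((1 + 1 / min c0 c1) * Qc * M) * e powr q"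
  proof eventually_elim
    case (elim e)
    have e: "0 < e" "(3 + 4 * cm) * e < d"
      using elim(2) cm(3) by (simp_all add: pos_less_divide_eq mult.commute)
    then have e': "3 * e + 4 * (cm * e) < d" "0 < cm * e"
      using cm(3) by (simp_all add: algebra_simps)
    show ?case
    proof
      fix z assume z: "z \<in> K"
      obtain t x where tx: "z = (t, x)"
        by (cases z)
      have t: "0 \<le> t" "\<bar>t\<bar> \<le> B" "\<bar>x\<bar> \<le> B"
        using z K(2) B[OF z] norm_fst_le[of t x] norm_snd_le[of x t] by (auto simp: tx)
      have far: "d \<le> \<bar>t - t'\<bar> + \<bar>x - x'\<bar>" if "(t', x') \<in> rays c0 c1" for t' x'
        using d(2)[OF z that] dist_plane_le[of t x t' x'] by (simp add: tx)
      have quiet: "\<bar>ww e s t x\<bar> \<le> Qc * (M * e powr q)" if s: "s = 1 \<or> s = -1" for s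
        unfolding Qc_def
      proof (rule layer_quiet[OF elim(1) s t(1)])
        show "t \<le> T"
          using t by (simp add: T_def)
        have "cm * t \<le> cm * (2 * T + 2)"
          using t cm(3) by (intro mult_left_mono) (auto simp: T_def)
        then show "\<bar>x\<bar> + cm * t \<le> R"
          using t pos by (simp add: R_def)
        show "\<bar>x - s * c0 * t\<bar> > e" if "t \<le> 1 - e"
          using far[OF rays_before[OF s pos(1) t(1)]] that e e' by simp
        show "\<bar>\<bar>x\<bar> - c0\<bar> > (1 + 3 * cm) * e" if "1 - e \<le> t" "t \<le> 1 + e"
        proof -
          have "d \<le> e + \<bar>x - c0\<bar>" "d \<le> e + \<bar>x + c0\<bar>"
            using far[OF rays_before[of 1, OF _ pos(1), of 1]] far[OF rays_before[of "-1", OF _ pos(1), of 1]] that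
            by auto
          then have "d - e \<le> \<bar>\<bar>x\<bar> - c0\<bar>"
            by linarith
          then show ?thesis
            using e e' by (simp add: algebra_simps)
        qed
        show "\<bar>\<bar>x - s * c1 * (t - 1 - e)\<bar> - c0\<bar> > (1 + 3 * cm) * e" if "1 + e \<le> t"
        proof -
          define y where "y = x - s * c1 * (t - 1)"
          have "d \<le> \<bar>y - c0\<bar>" "d \<le> \<bar>y + c0\<bar>"
            using far[OF rays_after[of 1, OF _ s pos, of t]] far[OF rays_after[of "-1", OF _ s pos, of t]] that e(1)
            by (auto simp: y_def algebra_simps)
          then have "d \<le> \<bar>\<bar>y\<bar> - c0\<bar>"
            by linarith
          moreover have "x - s * c1 * (t - 1 - e) = y + s * c1 * e"
            by (simp add: y_def algebra_simps)
          moreover have "\<bar>s * c1 * e\<bar> \<le> cm * e"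
            using s pos cm(2) e(1) by (auto simp: abs_mult)
          ultimately have "d - cm * e \<le> \<bar>\<bar>x - s * c1 * (t - 1 - e)\<bar> - c0\<bar>"
            by linarith
          then show ?thesis
            using e e' by (simp add: algebra_simps)
        qed
      qed
      define X where "X = Qc * (M * e powr q)"
      have q1: "\<bar>ww e 1 t x\<bar> \<le> X" and q2: "\<bar>ww e (-1) t x\<bar> \<le> X"
        using quiet[of 1] quiet[of "-1"] by (auto simp: X_def)
      then have X0: "0 \<le> X"
        by linarith
      have "\<bar>Ut e (t, x)\<bar> \<le> X"
        unfolding ut_ww using q1 q2 by (auto simp: abs_le_iff field_simps)
      moreover have "\<bar>Ux e (t, x)\<bar> \<le> X * (1 / min c0 c1)"
      proof -
        have "\<bar>(ww e (-1) t x - ww e 1 t x) / 2\<bar> \<le> X"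
          using q1 q2 by (auto simp: abs_le_iff field_simps)
        moreover have "1 / ce e t \<le> 1 / min c0 c1"
          using ce_bounds(1)[of e t] pos by (intro divide_left_mono) (auto intro: mult_pos_pos ce_pos)
        moreover have "Ux e (t, x) = (ww e (-1) t x - ww e 1 t x) / 2 * (1 / ce e t)"
          using ux_ww[of 1 e t x] by simp
        ultimately show ?thesis
          using ce_pos[of e t] X0 by (simp only: abs_mult) (intro mult_mono, auto)
      qed
      moreover have "0 \<le> X * (1 / min c0 c1)"
        using X0 pos by simp
      moreover have "b = (1, 0) \<or> b = (0, 1)"
        using b by (auto simp: Basis_prod_def)
      ultimately have "\<bar>partial_on half_plane b (u e) z\<bar> \<le> X + X * (1 / min c0 c1)"
        using X0 by (auto simp: tx)
      then show "\<bar>partial_on half_plane b (u e) z\<bar> \<le> ((1 + 1 / min c0 c1) * Qc * M) * e powr q"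
        by (simp add: X_def algebra_simps)
    qed
  qed
  then show "\<exists>M. \<forall>\<^sub>F e in at_right 0. \<forall>z\<in>K. \<bar>partial_on half_plane b (u e) z\<bar> \<le> M * e powr q"
    by (rule exI)
qed

section \<open>Irregularity on the rays\<close>

lemma continuous_on_ww: "smooth_on half_plane (u e) \<Longrightarrow> 0 \<le> t \<Longrightarrow> continuous_on S (\<lambda>y. ww e s t (z + y))"
  unfolding ww_def
  by (intro continuous_intros continuous_on_compose2[OF smooth_on_continuous_on[OF smooth_on_partial_on]])
    (auto intro!: continuous_intros)

text \<open>Only one invariant peaks in the window, so
  \<open>ux = (w (-s) - w s) / (2 * s * c)\<close> inherits its peak, with mass
  \<open>- J / (2 * s * kc)\<close>, and the x-derivatives of \<open>ux\<close> contradict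
  regularity unless this vanishes. The centre \<open>zf e\<close> may drift with \<open>e\<close>,
  but stays close to \<open>x\<close>.\<close>

lemma peak_not_regular:
  assumes W: "openin (top_of_set half_plane) W" "(t, x) \<in> W" and reg: "cg_class W u \<in> colombeau_regular W"
    and t: "t > 0" and s: "s = 1 \<or> s = -1" and "kc > 0" "d0 > 0" "\<kappa> > 0" "B \<ge> 0"
    and kc: "\<forall>\<^sub>F e in at_right 0. ce e t = kc"
    and zf: "\<And>e. e > 0 \<Longrightarrow> \<bar>zf e - x\<bar> \<le> cm * e"
    and out: "\<forall>\<^sub>F e in at_right 0. \<forall>y. \<kappa> * e < \<bar>y\<bar> \<and> \<bar>y\<bar> \<le> d0 \<longrightarrow> \<bar>ww e s t (zf e + y)\<bar> \<le> B * e"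
    and other: "\<forall>\<^sub>F e in at_right 0. \<forall>y. \<bar>y\<bar> \<le> d0 \<longrightarrow> \<bar>ww e (-s) t (zf e + y)\<bar> \<le> B * e"
    and mass: "\<forall>\<^sub>F e in at_right 0. \<bar>integral {-(\<kappa> * e)..\<kappa> * e} (\<lambda>y. ww e s t (zf e + y)) - J\<bar> \<le> B * e"
  shows "J = 0"
proof -
  have W': "W \<subseteq> half_plane" "forward_domain W"
    using openin_imp_subset[OF W(1)] forward_domain_openin[OF forward_domain_half_plane W(1)] by auto
  obtain Om where Om: "open Om" "W = half_plane \<inter> Om"
    using W(1) unfolding openin_open by blast
  then obtain r where r: "r > 0" "ball (t, x) r \<subseteq> Om"
    using W(2) open_contains_ball by blast
  define d where "d = min d0 (r / 4)"
  have d: "d > 0" "d \<le> d0" "4 * d \<le> r"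
    using assms r by (auto simp: d_def)
  \<comment> \<open>Half-length \<open>2 * d\<close>: one \<open>d\<close> for the window and one
    for the drift of its centre.\<close>
  define K where "K = {t} \<times> {x - 2 * d..x + 2 * d}"
  have "K \<subseteq> W"
  proof
    fix p assume "p \<in> K"
    then obtain y where y: "p = (t, y)" "\<bar>y - x\<bar> \<le> 2 * d"
      unfolding K_def by (auto simp: abs_le_iff)
    then have "dist (t, x) p < r"
      using d by (simp add: dist_Pair_Pair dist_real_def abs_minus_commute)
    then show "p \<in> W"
      using r Om(2) t y by auto
  qed
  have "compact K"
    unfolding K_def by (intro compact_Times) auto
  obtain p where p: "p \<ge> 0" "\<forall>bs\<in>multi_indices. \<exists>M\<ge>0. \<forall>\<^sub>F e in at_right 0.
      \<forall>x\<in>K. \<bar>multi_partial_on W bs (u e) x\<bar> \<le> M * e powr (- p)"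
    using colombeau_regularD[OF W'(2) reg \<open>compact K\<close> \<open>K \<subseteq> W\<close>] .
  \<comment> \<open>\<open>Suc k\<close>, because \<open>F e 0\<close> must already be the first
    x-derivative of \<open>u\<close>.\<close>
  define F where "F e k y = multi_partial_on half_plane (replicate (Suc k) (0, 1)) (u e) (t, y)" for e k y
  have rep: "replicate k (0, 1) \<in> (multi_indices :: (real \<times> real) list set)" for k
    by (induction k) auto
  have F0: "F e 0 y = (ww e (-s) t y - ww e s t y) * (1 / (2 * s * kc))" if "ce e t = kc" for e y
    using ux_ww[OF s, of e t y] that by (simp add: F_def multi_partial_on_Cons)
  have s_abs: "\<bar>1 / (2 * s * kc)\<bar> = 1 / (2 * kc)"
    using s \<open>kc > 0\<close> by (auto simp: abs_mult)
  \<comment> \<open>The off-peak bound contributes 2, from the two invariants; the mass error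
    contributes 1 from the peaked invariant and \<open>2 * \<kappa>\<close> from the other one over
    the tube.\<close>
  define B' where "B' = (2 + 2 * \<kappa>) * B * (1 / (2 * kc))"
  have B': "B' \<ge> 0" "2 * B * (1 / (2 * kc)) \<le> B'"
  proof -
    show "2 * B * (1 / (2 * kc)) \<le> B'"
      unfolding B'_def using \<open>kc > 0\<close> \<open>\<kappa> > 0\<close> \<open>B \<ge> 0\<close> by (intro mult_right_mono) auto
    show "B' \<ge> 0"
      unfolding B'_def using \<open>kc > 0\<close> \<open>\<kappa> > 0\<close> \<open>B \<ge> 0\<close> by (intro mult_nonneg_nonneg) auto
  qed
  have "d / \<kappa> > 0" "d / cm > 0"
    using d \<open>\<kappa> > 0\<close> cm(3) by auto
  note small = eventually_small[of 1, simplified] eventually_small[OF this(1)] eventually_small[OF this(2)]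
  have "- J * (1 / (2 * s * kc)) = 0"
  proof (rule no_regular_peak[where F = F and z = zf and B = B' and d = d and p = p and \<kappa> = \<kappa>])
    show "\<forall>\<^sub>F e in at_right 0. \<forall>k y. (F e k has_real_derivative F e (Suc k) y) (at y)"
      using small(1)
    proof eventually_elim
      case (elim e)
      show ?case
      proof (intro allI)
        fix k y
        have "smooth_on half_plane (multi_partial_on half_plane (replicate (Suc k) (0, 1)) (u e))"
          using elim by (intro smooth_on_multi_partial_on rep smooth_u) auto
        from smooth_on_half_plane_dx[OF this, of t y] t
        show "(F e k has_real_derivative F e (Suc k) y) (at y)"
          by (simp add: F_def[abs_def] multi_partial_on_Cons)
      qed
    qed
    show "\<forall>\<^sub>F e in at_right 0. \<forall>y. \<kappa> * e < \<bar>y\<bar> \<and> \<bar>y\<bar> \<le> d \<longrightarrow> \<bar>F e 0 (zf e + y)\<bar> \<le> B' * e"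
      using kc out other small(1)
    proof eventually_elim
      case (elim e)
      show ?case
      proof (intro allI impI)
        fix y assume y: "\<kappa> * e < \<bar>y\<bar> \<and> \<bar>y\<bar> \<le> d"
        have "\<bar>ww e (-s) t (zf e + y)\<bar> \<le> B * e" "\<bar>ww e s t (zf e + y)\<bar> \<le> B * e"
          using elim(2,3) y d by auto
        then have "\<bar>ww e (-s) t (zf e + y) - ww e s t (zf e + y)\<bar> \<le> 2 * B * e"
          by linarith
        then have "\<bar>F e 0 (zf e + y)\<bar> \<le> (2 * B * e) * (1 / (2 * kc))"
          unfolding F0[OF elim(1)] abs_mult s_abs using \<open>kc > 0\<close> by (intro mult_right_mono) auto
        also have "\<dots> = (2 * B * (1 / (2 * kc))) * e"
          by (simp only: mult_ac)
        also have "\<dots> \<le> B' * e"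
          using B' elim by (intro mult_right_mono) auto
        finally show "\<bar>F e 0 (zf e + y)\<bar> \<le> B' * e" .
      qed
    qed
    show "\<forall>\<^sub>F e in at_right 0. \<bar>integral {-(\<kappa> * e)..\<kappa> * e} (\<lambda>y. F e 0 (zf e + y)) - - J * (1 / (2 * s * kc))\<bar> \<le> B' * e"
      using kc other mass small(1,2)
    proof eventually_elim
      case (elim e)
      have e: "0 < e" "e < 1" "\<kappa> * e < d"
        using elim(4,5) \<open>\<kappa> > 0\<close> by (auto simp: pos_less_divide_eq mult.commute)
      define I where "I s = integral {-(\<kappa> * e)..\<kappa> * e} (\<lambda>y. ww e s t (zf e + y))" for s
      have cont: "continuous_on S (\<lambda>y. ww e s t (zf e + y))" for s S
        using t e by (intro continuous_on_ww smooth_u) auto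
      have "\<bar>I (-s) - integral {-(\<kappa> * e)..\<kappa> * e} (\<lambda>y. 0)\<bar> \<le> 2 * (\<kappa> * e) * (B * e)"
        unfolding I_def
        by (rule integral_diff_bound) (use e \<open>\<kappa> > 0\<close> elim(2) d in \<open>auto intro: cont\<close>)
      also have "\<dots> \<le> 2 * (\<kappa> * 1) * (B * e)"
        using e \<open>\<kappa> > 0\<close> \<open>B \<ge> 0\<close> by (intro mult_right_mono mult_left_mono) auto
      finally have "\<bar>I (-s)\<bar> \<le> 2 * \<kappa> * B * e"
        by simp
      moreover have "\<bar>I s - J\<bar> \<le> B * e"
        using elim(3) by (simp add: I_def)
      moreover have "0 \<le> B * e"
        using e \<open>B \<ge> 0\<close> by simp
      moreover have "(2 + 2 * \<kappa>) * B * e = 2 * (B * e) + 2 * \<kappa> * B * e"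
        by (simp add: algebra_simps)
      ultimately have bd: "\<bar>I (-s) - I s + J\<bar> \<le> (2 + 2 * \<kappa>) * B * e"
        by linarith
      have "integral {-(\<kappa> * e)..\<kappa> * e} (\<lambda>y. F e 0 (zf e + y)) = (I (-s) - I s) * (1 / (2 * s * kc))"
        unfolding F0[OF elim(1)] integral_mult_left I_def
        by (subst integral_diff) (auto intro!: integrable_continuous_real cont)
      then have "integral {-(\<kappa> * e)..\<kappa> * e} (\<lambda>y. F e 0 (zf e + y)) - - J * (1 / (2 * s * kc)) =
          (I (-s) - I s + J) * (1 / (2 * s * kc))"
        by (simp only: distrib_right minus_mult_left diff_minus_eq_add minus_minus)
      then have "\<bar>integral {-(\<kappa> * e)..\<kappa> * e} (\<lambda>y. F e 0 (zf e + y)) - - J * (1 / (2 * s * kc))\<bar> =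
          \<bar>I (-s) - I s + J\<bar> * (1 / (2 * kc))"
        by (simp only: abs_mult s_abs)
      also have "\<dots> \<le> ((2 + 2 * \<kappa>) * B * e) * (1 / (2 * kc))"
        using bd \<open>kc > 0\<close> by (intro mult_right_mono) auto
      also have "\<dots> = B' * e"
        unfolding B'_def by (simp only: mult_ac)
      finally show ?case .
    qed
    show "\<exists>M\<ge>0. \<forall>\<^sub>F e in at_right 0. \<forall>y. \<bar>y\<bar> \<le> d \<longrightarrow> \<bar>F e k (zf e + y)\<bar> \<le> M * e powr (- p)" for k
    proof -
      obtain M where M: "M \<ge> 0" "\<forall>\<^sub>F e in at_right 0.
          \<forall>z\<in>K. \<bar>multi_partial_on W (replicate (Suc k) (0, 1)) (u e) z\<bar> \<le> M * e powr (- p)"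
        using bspec[OF p(2) rep] by blast
      from M(2) small(3)
      have "\<forall>\<^sub>F e in at_right 0. \<forall>y. \<bar>y\<bar> \<le> d \<longrightarrow> \<bar>F e k (zf e + y)\<bar> \<le> M * e powr (- p)"
      proof eventually_elim
        case (elim e)
        have e: "0 < e" "cm * e < d"
          using elim(2) cm(3) by (auto simp: pos_less_divide_eq mult.commute)
        show ?case
        proof (intro allI impI)
          fix y assume "\<bar>y\<bar> \<le> d"
          then have "x - 2 * d \<le> zf e + y" "zf e + y \<le> x + 2 * d"
            using zf[OF e(1)] e(2) by linarith+
          then have "(t, zf e + y) \<in> K"
            by (simp add: K_def)
          with bspec[OF elim(1) this] \<open>K \<subseteq> W\<close>
          show "\<bar>F e k (zf e + y)\<bar> \<le> M * e powr (- p)"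
            using multi_partial_on_openin[OF W(1), of "(t, zf e + y)" "replicate (Suc k) (0, 1)" "u e"]
            unfolding F_def by auto
        qed
      qed
      then show ?thesis
        using M(1) by blast
    qed
  qed (use d \<open>\<kappa> > 0\<close> p(1) B' in auto)
  then show ?thesis
    using s \<open>kc > 0\<close> by auto
qed

text \<open>Chosen so that \<open>\<kappa> * e\<close> is the tube radius \<open>rad\<close> of
  \<open>wave_layer\<close>.\<close>

definition \<kappa> :: real where "\<kappa> = 2 * (1 + 3 * cm)"

lemma \<kappa>: "\<kappa> > 0" "e > 0 \<Longrightarrow> \<kappa> * e = 2 * ((1 + 3 * cm) * e)" "(1 + 3 * cm) * e = e + 3 * (cm * e)"
  using cm(3) by (auto simp: \<kappa>_def algebra_simps)

lemma layer_mass_before: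
  assumes "layer T R \<delta> Ka e" and s: "s = 1 \<or> s = -1" and t: "0 \<le> t" "t \<le> 1 - e"
  shows "\<bar>integral {-(\<kappa> * e)..\<kappa> * e} (\<lambda>y. ww e s t (s * c0 * (t + e) + y)) - 1\<bar> \<le> c0 * (1 + T) * \<delta>"
proof -
  interpret wave_layer "u e" "ce e" "ce' e" cm T R \<delta> c0 c1 e Ka "scaled \<psi> e"
    by (rule assms(1))
  have "rad = \<kappa> * e" "w s t x = ww e s t x" for x
    by (simp_all add: rad_def L_def \<kappa>_def w_def ww_def)
  then show ?thesis
    using J_before[OF s t] by (simp add: J_def)
qed

lemma layer_mass_after:
  assumes "layer T R \<delta> Ka e" and \<rho>: "\<rho> = 1 \<or> \<rho> = -1" and s: "s = 1 \<or> s = -1" and t: "1 + e \<le> t" "t \<le> T"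
  shows "\<bar>integral {-(\<kappa> * e)..\<kappa> * e} (\<lambda>y. ww e s t (\<rho> * c0 + s * c1 * (t - 1 - e) + y)) -
    (1 + s * \<rho> * c1 / c0) / 2\<bar> \<le> 8 * cm * ((2 + T) * exp (2 * Ka + 2)) * \<delta>"
proof -
  interpret wave_layer "u e" "ce e" "ce' e" cm T R \<delta> c0 c1 e Ka "scaled \<psi> e"
    by (rule assms(1))
  have "rad = \<kappa> * e" "w s t x = ww e s t x" for x
    by (simp_all add: rad_def L_def \<kappa>_def w_def ww_def)
  then show ?thesis
    using J_after[OF \<rho> s t] by (simp add: J_def Q_def)
qed

lemma not_regular_before:
  assumes W: "openin (top_of_set half_plane) W" "(t, s * c0 * t) \<in> W" and reg: "cg_class W u \<in> colombeau_regular W"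
    and s: "s = 1 \<or> s = -1" and t: "0 < t" "t < 1"
  shows False
proof -
  obtain Ka where Ka: "Ka \<ge> 0" "\<And>e t. e > 0 \<Longrightarrow> \<bar>ce' e t\<bar> \<le> Ka / e * ce e t"
    using ce'_bound by blast
  define T :: real where "T = 2"
  \<comment> \<open>Half the distance between the two rays at time \<open>t\<close>; the opposite
    ray stays outside the window.\<close>
  define d0 where "d0 = c0 * t"
  define R where "R = cm * (2 * T + 2) + c0 + (2 * d0 + cm)"
  define Qc where "Qc = 2 * ((2 + T) * exp (2 * Ka + 2))"
  have d0: "d0 > 0" "\<bar>s * c0 * t\<bar> = d0"
    using s t pos by (auto simp: d0_def abs_mult)
  \<comment> \<open>Order 1 is what \<open>peak_not_regular\<close> asks for: errors of size
    O(e).\<close>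
  obtain M where M: "M > 0" "\<forall>\<^sub>F e in at_right 0. layer T R (M * e powr 1) Ka e"
    using eventually_layer[OF _ _ _ Ka, of T R 1] d0 cm(3) by (auto simp: T_def R_def)
  define B where "B = Qc * M + c0 * (1 + T) * M"
  have B: "Qc * M \<le> B" "c0 * (1 + T) * M \<le> B" "0 \<le> B"
    using M(1) pos by (auto simp: B_def Qc_def T_def)
  define zf where "zf e = s * c0 * (t + e)" for e
  have s_abs: "\<bar>s * r\<bar> = \<bar>r\<bar>" for r
    using s by (auto simp: abs_mult)
  have zf: "\<bar>zf e - s * c0 * t\<bar> \<le> cm * e" if "e > 0" for e
  proof -
    have "zf e - s * c0 * t = s * (c0 * e)"
      by (simp add: zf_def algebra_simps)
    then show ?thesis
      using s_abs[of "c0 * e"] that pos cm(1) by simp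
  qed
  have quiet: "\<bar>ww e s' t (zf e + y)\<bar> \<le> B * e"
    if e: "layer T R (M * e powr 1) Ka e" "0 < e" "e < 1 - t" and y: "\<bar>y\<bar> \<le> d0"
      and s': "s' = 1 \<or> s' = -1" and far: "\<bar>zf e + y - s' * c0 * t\<bar> > e" for e y s'
  proof -
    have "\<bar>ww e s' t (zf e + y)\<bar> \<le> Qc * (M * e powr 1)"
      unfolding Qc_def
    proof (rule layer_quiet[OF e(1) s' _ _ _ far])
      have "cm * e \<le> cm * 1" "cm * t \<le> cm * (2 * T + 2)"
        using e t cm(3) by (auto simp: T_def intro!: mult_left_mono)
      then show "\<bar>zf e + y\<bar> + cm * t \<le> R"
        using zf[OF e(2)] d0(2) y pos unfolding R_def by linarith
    qed (use t e in \<open>auto simp: T_def\<close>)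
    also have "\<dots> = Qc * M * e"
      using e(2) by simp
    also have "\<dots> \<le> B * e"
      using B(1) e(2) by (intro mult_right_mono) auto
    finally show ?thesis .
  qed
  have "1 - t > 0"
    using t by simp
  note ev = M(2) eventually_small[OF this] eventually_small[OF d0(1)]
  have "(1::real) = 0"
  proof (rule peak_not_regular[OF W reg t(1) s pos(1) d0(1) \<kappa>(1) B(3), where zf = zf])
    show "\<forall>\<^sub>F e in at_right 0. ce e t = c0"
      using ev(2) by eventually_elim (simp add: ce_left)
    show "\<forall>\<^sub>F e in at_right 0. \<forall>y. \<kappa> * e < \<bar>y\<bar> \<and> \<bar>y\<bar> \<le> d0 \<longrightarrow> \<bar>ww e s t (zf e + y)\<bar> \<le> B * e"
      using ev
    proof eventually_elim
      case (elim e)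
      show ?case
      proof (intro allI impI)
        fix y assume y: "\<kappa> * e < \<bar>y\<bar> \<and> \<bar>y\<bar> \<le> d0"
        have "e < \<bar>zf e + y - s * c0 * t\<bar>"
          using zf[of e] y \<kappa>(2)[of e] \<kappa>(3)[of e] elim cm(3) mult_pos_pos[of cm e] by linarith
        then show "\<bar>ww e s t (zf e + y)\<bar> \<le> B * e"
          using elim y s by (intro quiet) auto
      qed
    qed
    show "\<forall>\<^sub>F e in at_right 0. \<forall>y. \<bar>y\<bar> \<le> d0 \<longrightarrow> \<bar>ww e (-s) t (zf e + y)\<bar> \<le> B * e"
      using ev
    proof eventually_elim
      case (elim e)
      show ?case
      proof (intro allI impI)
        fix y assume y: "\<bar>y\<bar> \<le> d0"
        have "zf e + y - (-s) * c0 * t = s * (2 * d0 + c0 * e) + y"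
          by (simp add: zf_def d0_def algebra_simps)
        moreover have "0 < c0 * e"
          using pos elim by simp
        ultimately have "e < \<bar>zf e + y - (-s) * c0 * t\<bar>"
          using s_abs[of "2 * d0 + c0 * e"] y elim by linarith
        then show "\<bar>ww e (-s) t (zf e + y)\<bar> \<le> B * e"
          using elim y s by (intro quiet) auto
      qed
    qed
    show "\<forall>\<^sub>F e in at_right 0. \<bar>integral {-(\<kappa> * e)..\<kappa> * e} (\<lambda>y. ww e s t (zf e + y)) - 1\<bar> \<le> B * e"
      using ev(1,2)
    proof eventually_elim
      case (elim e)
      have "\<bar>integral {-(\<kappa> * e)..\<kappa> * e} (\<lambda>y. ww e s t (zf e + y)) - 1\<bar> \<le> c0 * (1 + T) * (M * e powr 1)"
        unfolding zf_def using t elim by (intro layer_mass_before[OF elim(1) s]) auto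
      also have "\<dots> = c0 * (1 + T) * M * e"
        using elim by simp
      also have "\<dots> \<le> B * e"
        using B(2) elim by (intro mult_right_mono) auto
      finally show ?case .
    qed
  qed (rule zf)
  then show False
    by simp
qed

text \<open>The mass \<open>(1 + s * \<rho> * c1 / c0) / 2\<close> is positive for the transmitted
  wave, s = \<rho>, and nonzero for the reflected one because c0 \<noteq> c1. The condition on
  \<open>t\<close> excludes the point where the two reflected rays cross, since there both
  invariants peak.\<close>

lemma not_regular_after:
  assumes W: "openin (top_of_set half_plane) W" "(t, \<rho> * c0 + s * c1 * (t - 1)) \<in> W"
    and reg: "cg_class W u \<in> colombeau_regular W"
    and \<rho>: "\<rho> = 1 \<or> \<rho> = -1" and s: "s = 1 \<or> s = -1" and t: "1 < t" "c1 * (t - 1) \<noteq> c0"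
  shows False
proof -
  obtain Ka where Ka: "Ka \<ge> 0" "\<And>e t. e > 0 \<Longrightarrow> \<bar>ce' e t\<bar> \<le> Ka / e * ce e t"
    using ce'_bound by blast
  define x where "x = \<rho> * c0 + s * c1 * (t - 1)"
  \<comment> \<open>\<open>A\<close> is the foot at time 1 of the characteristic of the opposite
    family through \<open>(t, x)\<close>, and \<open>\<eta>\<close> is the distance of
    \<open>\<bar>A\<bar>\<close> from c0. This family carries waves only from c0 and -c0, so it is
    quiet near \<open>(t, x)\<close> when \<open>\<eta>\<close> is positive.\<close>
  define A where "A = \<rho> * c0 + 2 * s * c1 * (t - 1)"
  define \<eta> where "\<eta> = \<bar>\<bar>A\<bar> - c0\<bar>"
  have "c1 * (t - 1) > 0"
    using pos t by simp
  then have \<eta>: "\<eta> > 0"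
    using \<rho> s t(2) pos unfolding \<eta>_def A_def by (elim disjE) (simp; linarith)+
  define T where "T = t + 1"
  \<comment> \<open>\<open>c0\<close> keeps \<open>\<rho> * c0 + y\<close> from changing sign, so
    its absolute value differs from c0 by exactly \<open>\<bar>y\<bar>\<close>;
    \<open>\<eta> / 2\<close> leaves half of the gap for shifts of order \<open>e\<close>.\<close>
  define d0 where "d0 = min c0 (\<eta> / 2)"
  have d0: "d0 > 0" "d0 \<le> c0" "2 * d0 \<le> \<eta>"
    using pos \<eta> by (auto simp: d0_def)
  define R where "R = cm * (2 * T + 2) + c0 + (\<bar>x\<bar> + d0 + cm)"
  define Qc where "Qc = 2 * ((2 + T) * exp (2 * Ka + 2))"
  have Qc: "Qc > 0"
    using t by (simp add: Qc_def T_def)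
  obtain M where M: "M > 0" "\<forall>\<^sub>F e in at_right 0. layer T R (M * e powr 1) Ka e"
    using eventually_layer[OF _ _ _ Ka, of T R 1] d0 cm(3) t by (auto simp: T_def R_def)
  define B where "B = Qc * M + 4 * cm * Qc * M"
  have B: "Qc * M \<le> B" "4 * cm * Qc * M \<le> B" "0 \<le> B"
    using M(1) cm(3) Qc by (auto simp: B_def)
  define zf where "zf e = \<rho> * c0 + s * c1 * (t - 1 - e)" for e
  have s_abs: "\<bar>s * r\<bar> = \<bar>r\<bar>" for r
    using s by (auto simp: abs_mult)
  have zf: "\<bar>zf e - x\<bar> \<le> cm * e" if "e > 0" for e
  proof -
    have "zf e - x = - (s * (c1 * e))"
      by (simp add: zf_def x_def algebra_simps)
    then show ?thesis
      using s_abs[of "c1 * e"] that pos cm(2) by simp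
  qed
  have quiet: "\<bar>ww e s' t (zf e + y)\<bar> \<le> B * e"
    if e: "layer T R (M * e powr 1) Ka e" "0 < e" "e < t - 1" "e < 1" and y: "\<bar>y\<bar> \<le> d0"
      and s': "s' = 1 \<or> s' = -1"
      and far: "\<bar>\<bar>zf e + y - s' * c1 * (t - 1 - e)\<bar> - c0\<bar> > (1 + 3 * cm) * e" for e y s'
  proof -
    have "\<bar>ww e s' t (zf e + y)\<bar> \<le> Qc * (M * e powr 1)"
      unfolding Qc_def
    proof (rule layer_quiet[OF e(1) s' _ _ _ _ _ far])
      have "cm * e \<le> cm * 1" "cm * t \<le> cm * (2 * T + 2)"
        using e t cm(3) by (auto simp: T_def intro!: mult_left_mono)
      then show "\<bar>zf e + y\<bar> + cm * t \<le> R"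
        using zf[OF e(2)] y pos unfolding R_def by linarith
    qed (use t e in \<open>auto simp: T_def\<close>)
    also have "\<dots> = Qc * M * e"
      using e(2) by simp
    also have "\<dots> \<le> B * e"
      using B(1) e(2) by (intro mult_right_mono) auto
    finally show ?thesis .
  qed
  \<comment> \<open>The second threshold means \<open>(1 + 5 * cm) * e < \<eta> / 2\<close>: the
    margin \<open>(1 + 3 * cm) * e\<close> demanded by \<open>layer_quiet\<close>, plus
    \<open>2 * (cm * e)\<close> for the shifts.\<close>
  have "t - 1 > 0" "\<eta> / (2 * (1 + 5 * cm)) > 0"
    using t \<eta> cm(3) by auto
  note ev = M(2) eventually_small[OF this(1)] eventually_small[of 1, simplified] eventually_small[OF this(2)]
  have "(1 + s * \<rho> * c1 / c0) / 2 = 0"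
  proof (rule peak_not_regular[OF W reg _ s pos(2) d0(1) \<kappa>(1) B(3), where zf = zf, folded x_def])
    show "\<forall>\<^sub>F e in at_right 0. ce e t = c1"
      using ev(2) by eventually_elim (simp add: ce_right)
    show "\<forall>\<^sub>F e in at_right 0. \<forall>y. \<kappa> * e < \<bar>y\<bar> \<and> \<bar>y\<bar> \<le> d0 \<longrightarrow> \<bar>ww e s t (zf e + y)\<bar> \<le> B * e"
      using ev(1,2,3)
    proof eventually_elim
      case (elim e)
      show ?case
      proof (intro allI impI)
        fix y assume y: "\<kappa> * e < \<bar>y\<bar> \<and> \<bar>y\<bar> \<le> d0"
        have "zf e + y - s * c1 * (t - 1 - e) = \<rho> * c0 + y"
          by (simp add: zf_def)
        moreover have "\<bar>\<bar>\<rho> * c0 + y\<bar> - c0\<bar> = \<bar>y\<bar>"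
          using \<rho> y d0(2) by auto
        moreover have "(1 + 3 * cm) * e > 0"
          using cm(3) elim by simp
        ultimately have "(1 + 3 * cm) * e < \<bar>\<bar>zf e + y - s * c1 * (t - 1 - e)\<bar> - c0\<bar>"
          using y \<kappa>(2)[of e] elim by linarith
        then show "\<bar>ww e s t (zf e + y)\<bar> \<le> B * e"
          using elim y s by (intro quiet) auto
      qed
    qed
    show "\<forall>\<^sub>F e in at_right 0. \<forall>y. \<bar>y\<bar> \<le> d0 \<longrightarrow> \<bar>ww e (-s) t (zf e + y)\<bar> \<le> B * e"
      using ev
    proof eventually_elim
      case (elim e)
      have e: "0 < e" "2 * (1 + 5 * cm) * e < \<eta>"
        using elim(4) cm(3) by (simp_all add: pos_less_divide_eq mult.commute)
      show ?case
      proof (intro allI impI)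
        fix y assume y: "\<bar>y\<bar> \<le> d0"
        have eq: "zf e + y - (-s) * c1 * (t - 1 - e) = A + (y - s * (2 * c1 * e))"
          by (simp add: zf_def A_def algebra_simps)
        have "\<bar>s * (2 * c1 * e)\<bar> \<le> 2 * (cm * e)"
          using s_abs[of "2 * c1 * e"] e(1) pos cm(2) by simp
        then have "\<bar>y - s * (2 * c1 * e)\<bar> \<le> \<eta> / 2 + 2 * (cm * e)"
          using y d0(3) by linarith
        moreover have "\<bar>\<bar>A + r\<bar> - c0\<bar> \<ge> \<eta> - \<bar>r\<bar>" for r
          unfolding \<eta>_def by linarith
        ultimately have "\<bar>\<bar>A + (y - s * (2 * c1 * e))\<bar> - c0\<bar> \<ge> \<eta> / 2 - 2 * (cm * e)"
          by (smt (verit) field_sum_of_halves)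
        moreover have "2 * e + 10 * (cm * e) < \<eta>"
          using e(2) by (simp add: algebra_simps)
        ultimately have "(1 + 3 * cm) * e < \<bar>\<bar>zf e + y - (-s) * c1 * (t - 1 - e)\<bar> - c0\<bar>"
          unfolding eq \<kappa>(3) by linarith
        then show "\<bar>ww e (-s) t (zf e + y)\<bar> \<le> B * e"
          using elim y s by (intro quiet) auto
      qed
    qed
    show "\<forall>\<^sub>F e in at_right 0. \<bar>integral {-(\<kappa> * e)..\<kappa> * e} (\<lambda>y. ww e s t (zf e + y)) -
        (1 + s * \<rho> * c1 / c0) / 2\<bar> \<le> B * e"
      using ev(1,2)
    proof eventually_elim
      case (elim e)
      have "\<bar>integral {-(\<kappa> * e)..\<kappa> * e} (\<lambda>y. ww e s t (zf e + y)) - (1 + s * \<rho> * c1 / c0) / 2\<bar> \<le>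
          8 * cm * ((2 + T) * exp (2 * Ka + 2)) * (M * e powr 1)"
        unfolding zf_def using t elim by (intro layer_mass_after[OF elim(1) \<rho> s]) (auto simp: T_def)
      also have "\<dots> = 4 * cm * Qc * M * e"
        using elim by (simp add: Qc_def)
      also have "\<dots> \<le> B * e"
        using B(2) elim by (intro mult_right_mono) auto
      finally show ?case .
    qed
  qed (use t zf in auto)
  then show False
    using \<rho> s pos neq by (auto simp: field_simps)
qed

end

section \<open>The singular support of the solution\<close>

context wave_problem
begin

lemma regular_off_rays:
  defines "W \<equiv> half_plane - rays c0 c1"
  shows "openin (top_of_set half_plane) W" and "cg_class W u \<in> colombeau_regular W"
proof -
  show W: "openin (top_of_set half_plane) W"
    unfolding W_def openin_open using closed_rays[of c0 c1] by (intro exI[of _ "- rays c0 c1"]) auto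
  have "(u, u) \<in> colombeau_rel W"
    by (intro colombeau_rel_openin[OF W] colombeau_rel_refl forward_domain_half_plane mod)
  then have "u \<in> moderate W"
    by (rule colombeau_relD)
  then show "cg_class W u \<in> colombeau_regular W"
  proof (rule colombeau_regularI[OF forward_domain_openin[OF forward_domain_half_plane W]])
    fix b :: "real \<times> real" and K
    assume b: "b \<in> Basis" and K: "compact K" "K \<subseteq> W"
    have "negligible_on K (\<lambda>e. partial_on half_plane b (u e))"
      using negligible_off_rays[OF K(1) K(2)[unfolded W_def] b] .
    moreover have "partial_on half_plane b (u e) x = partial_on W b (u e) x" if "x \<in> K" for e x
      using multi_partial_on_openin[OF W, of x "[b]" "u e"] that K(2) by (auto simp: multi_partial_on_Cons)
    ultimately show "negligible_on K (\<lambda>e. partial_on W b (u e))"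
      using negligible_on_cong[of K "\<lambda>e. partial_on half_plane b (u e)" "\<lambda>e. partial_on W b (u e)"] by simp
  qed
qed

text \<open>
  Moving along the ray to a slightly later time avoids the initial line, the layer and the point
  where the reflected rays cross.
\<close>

lemma not_regular_on_rays:
  assumes z: "z \<in> rays c0 c1" and W: "openin (top_of_set half_plane) W" "z \<in> W"
    and reg: "cg_class W u \<in> colombeau_regular W"
  shows False
proof -
  obtain t x where tx: "z = (t, x)"
    by (cases z)
  obtain Om where Om: "open Om" "W = half_plane \<inter> Om"
    using W(1) unfolding openin_open by blast
  have later: "\<forall>\<^sub>F \<tau> in at_right t. (\<tau>, g \<tau>) \<in> W"
    if "isCont g t" "g t = x" "0 \<le> t" for g
  proof -
    have "((\<lambda>\<tau>. (\<tau>, g \<tau>)) \<longlongrightarrow> (t, g t)) (at_right t)"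
      using that(1) by (intro tendsto_Pair tendsto_ident_at) (simp add: isCont_def filterlim_at_split)
    then have "\<forall>\<^sub>F \<tau> in at_right t. (\<tau>, g \<tau>) \<in> Om"
      by (rule topological_tendstoD) (use Om W(2) tx that(2) in auto)
    moreover have "\<forall>\<^sub>F \<tau> in at_right t. t < \<tau>"
      by (rule eventually_at_right_less)
    ultimately show ?thesis
      by eventually_elim (use Om that(3) in auto)
  qed
  have gt: "\<forall>\<^sub>F \<tau> in at_right t. t < \<tau>"
    by (rule eventually_at_right_less)
  show False
    using z[unfolded tx] pos
  proof (cases rule: rays_cases)
    case (before s)
    have "\<forall>\<^sub>F \<tau> in at_right t. \<tau> < 1"
      using before(3) by (auto simp: eventually_at_right)
    then have "\<forall>\<^sub>F \<tau> in at_right t. t < \<tau> \<and> \<tau> < 1 \<and> (\<tau>, s * c0 * \<tau>) \<in> W"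
      using gt later[of "\<lambda>\<tau>. s * c0 * \<tau>"] before by (auto intro: eventually_conj)
    then obtain \<tau> where \<tau>: "t < \<tau>" "\<tau> < 1" "(\<tau>, s * c0 * \<tau>) \<in> W"
      using eventually_happens'[OF trivial_limit_at_right_real] by blast
    then show False
      using not_regular_before[OF W(1) \<tau>(3) reg before(1)] \<tau>(1,2) before(2) by simp
  next
    case (after \<rho> s)
    have "\<forall>\<^sub>F \<tau> in at_right t. \<tau> \<noteq> 1 + c0 / c1"
      by (rule eventually_neq_at_within)
    then have "\<forall>\<^sub>F \<tau> in at_right t. t < \<tau> \<and> \<tau> \<noteq> 1 + c0 / c1 \<and> (\<tau>, \<rho> * c0 + s * c1 * (\<tau> - 1)) \<in> W"
      using gt later[of "\<lambda>\<tau>. \<rho> * c0 + s * c1 * (\<tau> - 1)"] after by (auto intro: eventually_conj)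
    then obtain \<tau> where \<tau>: "t < \<tau>" "\<tau> \<noteq> 1 + c0 / c1" "(\<tau>, \<rho> * c0 + s * c1 * (\<tau> - 1)) \<in> W"
      using eventually_happens'[OF trivial_limit_at_right_real] by blast
    have "c1 * (\<tau> - 1) \<noteq> c0"
      using \<tau>(2) pos by (auto simp: field_simps)
    then show False
      using not_regular_after[OF W(1) \<tau>(3) reg after(1,2)] \<tau>(1) after(3) by simp
  qed
qed

lemma sing_supp_eq_rays: "sing_supp (cg_class half_plane u) = rays c0 c1"
proof -
  have restrict: "cg_restrict W (cg_class half_plane u) = cg_class W u"
    if "openin (top_of_set half_plane) W" for W
    by (rule cg_restrict_class[OF forward_domain_half_plane that mod])
  have sub: "rays c0 c1 \<subseteq> half_plane"
    by (auto simp: rays_def)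
  define W where "W = half_plane - rays c0 c1"
  have W: "openin (top_of_set half_plane) W" "cg_restrict W (cg_class half_plane u) \<in> colombeau_regular W"
    using regular_off_rays restrict by (simp_all add: W_def)
  have "z \<in> rays c0 c1" if "z \<in> sing_supp (cg_class half_plane u)" for z
    using that W unfolding sing_supp_def by (auto simp: W_def)
  moreover have "z \<in> sing_supp (cg_class half_plane u)" if z: "z \<in> rays c0 c1" for z
    unfolding sing_supp_def
  proof
    show "z \<in> half_plane"
      using z sub by blast
    show "z \<notin> \<Union> {W. openin (top_of_set half_plane) W \<and>
        cg_restrict W (cg_class half_plane u) \<in> colombeau_regular W}"
    proof
      assume "z \<in> \<Union> {W. openin (top_of_set half_plane) W \<and>
        cg_restrict W (cg_class half_plane u) \<in> colombeau_regular W}"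
      then obtain V where V: "openin (top_of_set half_plane) V" "z \<in> V"
        "cg_restrict V (cg_class half_plane u) \<in> colombeau_regular V"
        by blast
      show False
        using not_regular_on_rays[OF z V(1,2)] V(3) restrict[OF V(1)] by simp
    qed
  qed
  ultimately show ?thesis
    by blast
qed

end

text \<open>Passes from classes to values of \<open>u\<close>. The zero initial value becomes a
  bound on \<open>Dx\<close> because negligible families are closed under differentiation of the
  trace.\<close>

lemma wave_problemI:
  fixes c0 c1 :: real
  assumes "c0 > 0" "c1 > 0" "c0 \<noteq> c1" "admissible_mollifier \<phi>" "admissible_mollifier \<psi>"
    and C: "C = cg_class half_plane (\<lambda>e (t, x). convol (jump_coeff c0 c1) (scaled \<phi> e) t)"
    and u: "u \<in> moderate half_plane" and U: "U = cg_class half_plane u"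
    and eq: "cg_diff half_plane (D_t (D_t U)) (cg_mult half_plane (cg_mult half_plane C C) (D_x (D_x U)))
           = cg_zero half_plane"
    and U0: "cg_initial U = cg_zero UNIV" and U1: "cg_initial (D_t U) = cg_class UNIV (scaled \<psi>)"
  shows "wave_problem \<phi> \<psi> c0 c1 u"
proof -
  interpret \<phi>: mollifier \<phi> by unfold_locales fact
  have smooth: "smooth_on half_plane (u e)" if "e \<in> {0<..1}" for e
    using moderateD(1)[OF u] that by (auto simp: smooth_family_def)
  show ?thesis
  proof
    fix K :: "(real \<times> real) set" assume K: "compact K" "K \<subseteq> half_plane"
    have E: "(\<lambda>(t, x). convol (jump_coeff c0 c1) (scaled \<phi> e) t) z =
        c0 + (c1 - c0) * \<phi>.cdf ((fst z - 1) / e)" if "e \<in> {0<..1}" for e and z :: "real \<times> real"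
      using that \<phi>.convol_eq_cdf[of e c0 c1 "fst z"] by (simp add: case_prod_unfold)
    show "negligible_on K (\<lambda>e z. Dt (Dt (u e)) z -
        (c0 + (c1 - c0) * \<phi>.cdf ((fst z - 1) / e)) * (c0 + (c1 - c0) * \<phi>.cdf ((fst z - 1) / e)) *
          Dx (Dx (u e)) z)"
      by (rule iffD1[OF negligible_on_cong wave_equation_representative[OF C u U eq K]]) (simp only: E)
  next
    fix K :: "real set" assume K: "compact K"
    have "(\<lambda>e x. u e (0, x) - 0) \<in> negligible_families UNIV"
      using U0 by (intro initial_value_representative[OF u]) (simp add: U cg_zero_def)
    from negligible_familiesD(2)[OF this K, of "[1]"]
    have "negligible_on K (\<lambda>e. multi_partial_on UNIV [1] (\<lambda>x. u e (0, x)))"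
      by simp
    moreover have "multi_partial_on UNIV [1] (\<lambda>x. u e (0, x)) x = Dx (u e) (0, x)"
      if "e \<in> {0<..1}" for e x
      using multi_partial_on_trace[OF smooth[OF that], of "[1]" x] by (simp add: multi_partial_on_Cons)
    ultimately show "negligible_on K (\<lambda>e x. Dx (u e) (0, x))"
      using negligible_on_cong[of K "\<lambda>e. multi_partial_on UNIV [1] (\<lambda>x. u e (0, x))"
          "\<lambda>e x. Dx (u e) (0, x)"] by simp
    have "D_t U = cg_class half_plane (\<lambda>e. Dt (u e))"
      unfolding U by (intro cg_partial_class forward_domain_half_plane u) simp
    then have "(\<lambda>e x. Dt (u e) (0, x) - scaled \<psi> e x) \<in> negligible_families UNIV"
      using U1 by (intro initial_value_representative moderate_partial_on u) simp_all
    then show "negligible_on K (\<lambda>e x. Dt (u e) (0, x) - scaled \<psi> e x)"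
      by (rule negligible_familiesD(3)[OF _ K subset_UNIV])
  qed (use assms in auto)
qed

section \<open>The rays as integrals of the propagation speed\<close>

lemma set_lebesgue_integral_jump_coeff:
  assumes "0 \<le> t"
  shows "(LINT s:{0..t}|lborel. jump_coeff c0 c1 s) = (if t \<le> 1 then c0 * t else c0 + c1 * (t - 1))"
proof -
  have "indicator {0..t} s *\<^sub>R jump_coeff c0 c1 s = c0 * indicator {0..t} s + (c1 - c0) * indicator {1..t} s" for s
    by (auto simp: jump_coeff_def heaviside_def indicator_def)
  then have "(LINT s:{0..t}|lborel. jump_coeff c0 c1 s) =
      (LINT s|lborel. c0 * indicator {0..t} s + (c1 - c0) * indicator {1..t} s)"
    unfolding set_lebesgue_integral_def by (simp only:)
  also have "\<dots> = c0 * measure lborel {0..t} + (c1 - c0) * measure lborel {1..t}"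
    by (subst Bochner_Integration.integral_add) (auto simp: emeasure_lborel_Icc_eq)
  also have "\<dots> = (if t \<le> 1 then c0 * t else c0 + c1 * (t - 1))"
    using assms by (cases "t = 1") (auto simp: algebra_simps)
  finally show ?thesis .
qed

text \<open>For t \<ge> 1 the reflected expression \<open>2 * c0 - (c0 + c1 * (t - 1))\<close> is
  \<open>c0 - c1 * (t - 1)\<close>; it may have either sign, which the two signs of x
  absorb.\<close>

lemma rays_eq_integrals:
  fixes c0 c1 :: real
  assumes "c0 > 0" "c1 > 0"
  defines "c \<equiv> jump_coeff c0 c1"
  shows "rays c0 c1 =
      {(t, x). t \<ge> 0 \<and> (x = (LINT s:{0..t}|lborel. c s) \<or> x = - (LINT s:{0..t}|lborel. c s))} \<union>
      {(t, x). t \<ge> 1 \<and>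
         (x = 2 * (LINT s:{0..1}|lborel. c s) - (LINT s:{0..t}|lborel. c s) \<or>
          x = - (2 * (LINT s:{0..1}|lborel. c s) - (LINT s:{0..t}|lborel. c s)))}"
    (is "_ = ?R")
proof -
  note int = set_lebesgue_integral_jump_coeff[of _ c0 c1, folded c_def]
  have *: "(t, x) \<in> rays c0 c1 \<longleftrightarrow> (t, x) \<in> ?R" for t x
  proof -
    consider "t < 0" | "0 \<le> t" "t < 1" | "t = 1" | "1 < t"
      by linarith
    then show ?thesis
    proof cases
      case 2
      then have "0 \<le> c0 * t"
        using assms by simp
      then show ?thesis
        using 2 int[of t] by (auto simp: rays_def abs_real_def split: if_splits)
    next
      case 3
      then show ?thesis
        using int[of t] assms by (auto simp: rays_def abs_real_def split: if_splits)
    next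
      case 4
      then have "0 < c1 * (t - 1)"
        using assms by simp
      then have "0 < c0 + c1 * (t - 1)"
        using assms by simp
      moreover have "2 * c0 - (c0 + c1 * (t - 1)) = c0 - c1 * (t - 1)"
        by simp
      ultimately show ?thesis
        using 4 int[of t] int[of 1] by (auto simp: rays_def abs_real_def split: if_splits)
    qed (auto simp: rays_def)
  qed
  show ?thesis
  proof (rule set_eqI)
    fix z :: "real \<times> real"
    obtain t x where z: "z = (t, x)"
      by (cases z)
    show "z \<in> rays c0 c1 \<longleftrightarrow> z \<in> ?R"
      unfolding z by (rule *)
  qed
qed

theorem theorem4p1:
  fixes c0 c1 :: real and \<phi> \<psi> c :: "real \<Rightarrow> real"
    and C U :: "(real \<Rightarrow> real \<times> real \<Rightarrow> real) set" and U0 U1 :: "(real \<Rightarrow> real \<Rightarrow> real) set"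
  assumes "c0 > 0" and "c1 > 0" and "c0 \<noteq> c1"
    and "admissible_mollifier \<phi>" and "admissible_mollifier \<psi>"
    and "c = jump_coeff c0 c1"
    and "C = cg_class half_plane (\<lambda>\<epsilon> (t, x). convol c (scaled \<phi> \<epsilon>) t)"
    and "U0 = cg_zero UNIV"
    and "U1 = cg_class UNIV (scaled \<psi>)"
    and "U \<in> colombeau half_plane"
    and "cg_diff half_plane (D_t (D_t U)) (cg_mult half_plane (cg_mult half_plane C C) (D_x (D_x U)))
           = cg_zero half_plane"
    and "cg_initial U = U0"
    and "cg_initial (D_t U) = U1"
  shows "sing_supp U =
      {(t, x). t \<ge> 0 \<and> (x = (LINT s:{0..t}|lborel. c s) \<or> x = - (LINT s:{0..t}|lborel. c s))} \<union>
      {(t, x). t \<ge> 1 \<and>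
         (x = 2 * (LINT s:{0..1}|lborel. c s) - (LINT s:{0..t}|lborel. c s) \<or>
          x = - (2 * (LINT s:{0..1}|lborel. c s) - (LINT s:{0..t}|lborel. c s)))}"
proof -
  obtain u where u: "u \<in> moderate half_plane" "U = cg_class half_plane u"
    using colombeauE[OF forward_domain_half_plane assms(10)] .
  interpret wave_problem \<phi> \<psi> c0 c1 u
    by (rule wave_problemI[OF assms(1-5) assms(7)[unfolded assms(6)] u assms(11)])
      (use assms(8,9,12,13) in simp_all)
  show ?thesis
    unfolding u(2) assms(6) sing_supp_eq_rays rays_eq_integrals[OF assms(1,2)] ..
qed

end
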